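(* Let $d\ge1$ and $f\in C_0([0,1]^d)$. (A) If $$\limsup_{n\to\infty}\frac{1}{2^{n(d/2+1)}}\max_{1\le r\le2^d-1}\sum_{k=0}^{2^{nd}-1}|\lambda_{n,k,r}(f)|>0,$$ then $f$ is not strongly chargeable. (B) If $$\sum_{n=0}^\infty2^{n(d/2-1)}\max_{k,r}|\lambda_{n,k,r}(f)|<\infty,$$ where for each $n$ the maximum is over $0\le k\le2^{nd}-1$ and $1\le r\le2^d-1$, then $f$ is strongly chargeable.
   Context: $C_0([0,1]^d)$ is the space of continuous real functions on $[0,1]^d$ that vanish at every point having at least one zero coordinate. For $f\in C_0([0,1]^d)$ and a rectangle $K=\prod_{i=1}^d[a_i,b_i]\subseteq[0,1]^d$ (with $a_i<b_i$), $\Delta_f(K)=\sum_{(c_i)\in\prod_i\{a_i,b_i\}}(-1)^{\#\{i:\,c_i=a_i\}}f(c_1,\dots,c_d)$. A figure is a finite union of rectangles contained in $[0,1]^d$; $\Delta_f$ extends uniquely to a function on figures that is additive on almost disjoint figures (i.e. figures whose intersection is Lebesgue negligible). Let $A_1=\begin{pmatrix}1&1\\1&-1\end{pmatrix}$ and $A_{m+1}=\begin{pmatrix}A_m&A_m\\ A_m&-A_m\end{pmatrix}$; the entries of $A_d$ are $(A_d)_{r,\ell}$ with $r,\ell\in\{0,\dots,2^d-1\}$. For each $n\ge0$, let $K_{n,k}$, $k=0,\dots,2^{nd}-1$, be an enumeration of the dyadic cubes $\prod_{i=1}^d[2^{-n}k_i,2^{-n}(k_i+1)]$ ($0\le k_i\le2^n-1$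 integers), chosen so that for all $n,k$ the cubes $K_{n+1,2^dk},\dots,K_{n+1,2^dk+2^d-1}$ are the $2^d$ subcubes of $K_{n,k}$ of side $2^{-(n+1)}$. For $n\ge0$, $0\le k\le2^{nd}-1$, $1\le r\le2^d-1$ define $\lambda_{n,k,r}(f)=2^{nd/2}\sum_{\ell=0}^{2^d-1}(A_d)_{r,\ell}\,\Delta_f(K_{n+1,2^dk+\ell})$. $BV([0,1]^d)$ is the space of $u\in BV(\mathbb{R}^d)$ that vanish a.e. outside $[0,1]^d$, with norm $\|u\|_{BV}=\|u\|_1+\|Du\|(\mathbb{R}^d)$, where $\|Du\|$ is the total variation measure of the distributional gradient $Du$. For $g\in L^d([0,1]^d)$, $T_g\in BV([0,1]^d)^*$ is $T_g(u)=\int_{[0,1]^d}gu$. $SCH([0,1]^d)$ is the closure of $\{T_g: g\in L^d([0,1]^d)\}$ in $BV([0,1]^d)^*$ (operator norm). A $BV$-subset of $[0,1]^d$ is a measurable $B\subseteq[0,1]^d$ with finite perimeter $\|D\mathbf{1}_B\|(\mathbb{R}^d)<\infty$. A strong charge is a function on the $BV$-subsets of $[0,1]^d$ of the form $B\mapsto\alpha(\mathbf{1}_B)$ with $\alpha\in SCH([0,1]^d)$. A function $f\in C_0([0,1]^d)$ is strongly chargeable if $\Delta_f$ (defined on figures) extends to a strong charge. *)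

theory Defs
  imports "HOL-Analysis.Analysis"
begin

text \<open>
  The dimension \<open>d\<close> is \<open>CARD('n)\<close>, and \<open>[0,1]^d\<close> is \<open>cbox 0 (1 :: real^'n)\<close>.
  Functions on \<open>[0,1]^d\<close> are total functions whose values off the cube are never used.
\<close>

subsection \<open>Continuous functions, rectangles, figures\<close>

definition C0_cube :: "(real^'n \<Rightarrow> real) set" where
  "C0_cube = {f. continuous_on (cbox 0 1) f \<and>
                 (\<forall>x\<in>cbox 0 1. (\<exists>i. x $ i = 0) \<longrightarrow> f x = 0)}"

definition rectangles :: "(real^'n) set set" where
  "rectangles = {cbox a b | a b. (\<forall>i. a $ i < b $ i) \<and> cbox a b \<subseteq> cbox 0 1}"

text \<open>The vertices \<open>a\<close>, \<open>b\<close> of \<open>K = cbox a b\<close> are recovered from the set \<open>K\<close>.\<close>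

definition rect_increment :: "(real^'n \<Rightarrow> real) \<Rightarrow> (real^'n) set \<Rightarrow> real" where
  "rect_increment f K =
     (let a = interval_lowerbound K; b = interval_upperbound K in
      \<Sum>c\<in>{c. \<forall>i. c $ i \<in> {a $ i, b $ i}}. (-1) ^ card {i. c $ i = a $ i} * f c)"

definition figures :: "(real^'n) set set" where
  "figures = {\<Union>\<R> | \<R>. finite \<R> \<and> \<R> \<subseteq> rectangles}"

text \<open>
  \<open>G\<close> is the additive extension of the increment of \<open>f\<close> to figures; such a \<open>G\<close> exists
  and its values on figures are uniquely determined.
\<close>

definition is_figure_increment ::
  "(real^'n \<Rightarrow> real) \<Rightarrow> ((real^'n) set \<Rightarrow> real) \<Rightarrow> bool" where
  "is_figure_increment f G \<longleftrightarrow>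
     (\<forall>K\<in>rectangles. G K = rect_increment f K) \<and>
     (\<forall>E\<in>figures. \<forall>F\<in>figures. negligible (E \<inter> F) \<longrightarrow> G (E \<union> F) = G E + G F)"

subsection \<open>Dyadic cubes and the coefficients\<close>

text \<open>
  Entries of the matrices \<open>A\<^sub>m\<close>, with rows and columns indexed from 0. Starting the
  recursion at the \<open>1 \<times> 1\<close> matrix \<open>A\<^sub>0 = (1)\<close> gives the rows \<open>(1, 1)\<close> and
  \<open>(1, -1)\<close> for \<open>A\<^sub>1\<close>.
\<close>

fun hadamard :: "nat \<Rightarrow> nat \<Rightarrow> nat \<Rightarrow> real" where
  "hadamard 0 r l = 1"
| "hadamard (Suc m) r l =
     (if 2 ^ m \<le> r \<and> 2 ^ m \<le> l then - 1 else 1) * hadamard m (r mod 2 ^ m) (l mod 2 ^ m)"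

definition dyadic_cubes :: "nat \<Rightarrow> (real^'n) set set" where
  "dyadic_cubes n =
     {cbox (\<chi> i. real (j i) / 2 ^ n) (\<chi> i. (real (j i) + 1) / 2 ^ n) | j. \<forall>i. j i < 2 ^ n}"

definition dyadic_enumeration :: "(nat \<Rightarrow> nat \<Rightarrow> (real^'n) set) \<Rightarrow> bool" where
  "dyadic_enumeration K \<longleftrightarrow>
     (\<forall>n. bij_betw (K n) {..<2 ^ (n * CARD('n))} (dyadic_cubes n)) \<and>
     (\<forall>n. \<forall>k<2 ^ (n * CARD('n)).
        K (Suc n) ` {2 ^ CARD('n) * k..<2 ^ CARD('n) * k + 2 ^ CARD('n)} =
          {Q \<in> dyadic_cubes (Suc n). Q \<subseteq> K n k})"

definition haar_coeff ::
  "(nat \<Rightarrow> nat \<Rightarrow> (real^'n) set) \<Rightarrow> (real^'n \<Rightarrow> real) \<Rightarrow> nat \<Rightarrow> nat \<Rightarrow> nat \<Rightarrow> real" where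
  "haar_coeff K f n k r =
     2 powr (real n * real CARD('n) / 2) *
     (\<Sum>l<2 ^ CARD('n).
        hadamard CARD('n) r l * rect_increment f (K (Suc n) (2 ^ CARD('n) * k + l)))"

subsection \<open>Functions of bounded variation\<close>

text \<open>\<open>C\<^sup>\<infinity>\<close> on the whole space: differentiable with all directional derivatives again
  \<open>C\<^sup>\<infinity>\<close>.\<close>

coinductive smooth_fun :: "(real^'n \<Rightarrow> real) \<Rightarrow> bool" where
  "(\<forall>x. (\<phi> has_derivative \<phi>' x) (at x)) \<Longrightarrow> (\<forall>h. smooth_fun (\<lambda>x. \<phi>' x h)) \<Longrightarrow> smooth_fun \<phi>"

definition test_functions :: "(real^'n \<Rightarrow> real) set" where
  "test_functions = {\<phi>. smooth_fun \<phi> \<and> compact (closure {x. \<phi> x \<noteq> 0})}"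

definition partial_deriv :: "'n \<Rightarrow> (real^'n \<Rightarrow> real) \<Rightarrow> real^'n \<Rightarrow> real" where
  "partial_deriv i \<phi> x = frechet_derivative \<phi> (at x) (axis i 1)"

text \<open>
  The distributional gradient of \<open>u\<close> is the \<open>\<real>\<^sup>d\<close>-valued Borel measure \<open>D\<close>. The
  \<open>i\<close>-th component of such a measure is a finite signed measure, i.e. a difference
  of finite measures \<open>P i\<close> and \<open>N i\<close>, and integration against it is integration against
  \<open>P i\<close> minus integration against \<open>N i\<close> (whichever decomposition is taken).
  The values of \<open>D\<close> off the Borel sets are irrelevant.
\<close>

definition is_distr_gradient ::
  "(real^'n \<Rightarrow> real) \<Rightarrow> ((real^'n) set \<Rightarrow> real^'n) \<Rightarrow> bool" where
  "is_distr_gradient u D \<longleftrightarrow>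
     (\<exists>P N. \<forall>i.
        finite_measure (P i) \<and> sets (P i) = sets borel \<and>
        finite_measure (N i) \<and> sets (N i) = sets borel \<and>
        (\<forall>B\<in>sets borel. D B $ i = measure (P i) B - measure (N i) B) \<and>
        (\<forall>\<phi>\<in>test_functions.
           (\<integral>x. u x * partial_deriv i \<phi> x \<partial>lebesgue) =
             - ((\<integral>x. \<phi> x \<partial>P i) - (\<integral>x. \<phi> x \<partial>N i))))"

definition variation_measure ::
  "((real^'n) set \<Rightarrow> real^'n) \<Rightarrow> (real^'n) set \<Rightarrow> ennreal" where
  "variation_measure D B =
     (SUP A\<in>{A :: nat \<Rightarrow> (real^'n) set.
              range A \<subseteq> sets borel \<and> disjoint_family A \<and> \<Union>(range A) = B}.
        \<Sum>m. ennreal (norm (D (A m))))"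

text \<open>
  The total variation of the distributional gradient over the whole space. The gradient
  \<open>D\<close> is unique on Borel sets, so the infimum runs over a single value; it is \<open>\<infinity>\<close> if the
  gradient is not a finite measure.
\<close>

definition total_gradient :: "(real^'n \<Rightarrow> real) \<Rightarrow> ennreal" where
  "total_gradient u = (INF D\<in>{D. is_distr_gradient u D}. variation_measure D UNIV)"

definition BV_space :: "(real^'n \<Rightarrow> real) set" where
  "BV_space = {u. integrable lebesgue u \<and> total_gradient u < \<infinity>}"

definition BV_cube :: "(real^'n \<Rightarrow> real) set" where
  "BV_cube = {u \<in> BV_space. AE x in lebesgue. x \<notin> cbox 0 1 \<longrightarrow> u x = 0}"

definition BV_norm :: "(real^'n \<Rightarrow> real) \<Rightarrow> real" where
  "BV_norm u = (\<integral>x. \<bar>u x\<bar> \<partial>lebesgue) + enn2real (total_gradient u)"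

subsection \<open>The dual space and strong charges\<close>

definition BV_dual_norm :: "((real^'n \<Rightarrow> real) \<Rightarrow> real) \<Rightarrow> ennreal" where
  "BV_dual_norm \<alpha> = (SUP u\<in>{u \<in> BV_cube. BV_norm u \<le> 1}. ennreal \<bar>\<alpha> u\<bar>)"

text \<open>Elements of \<open>BV_cube\<close> are functions rather than classes; a bounded linear \<open>\<alpha>\<close>
  vanishes on null functions, hence is compatible with almost everywhere equality.\<close>

definition BV_dual :: "((real^'n \<Rightarrow> real) \<Rightarrow> real) set" where
  "BV_dual = {\<alpha>. (\<forall>u\<in>BV_cube. \<forall>v\<in>BV_cube. \<alpha> (\<lambda>x. u x + v x) = \<alpha> u + \<alpha> v) \<and>
                 (\<forall>c. \<forall>u\<in>BV_cube. \<alpha> (\<lambda>x. c * u x) = c * \<alpha> u) \<and>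
                 BV_dual_norm \<alpha> < \<infinity>}"

definition Ld_cube :: "(real^'n \<Rightarrow> real) set" where
  "Ld_cube = {g. g \<in> borel_measurable (lebesgue_on (cbox 0 1)) \<and>
                 integrable (lebesgue_on (cbox 0 1)) (\<lambda>x. \<bar>g x\<bar> ^ CARD('n))}"

definition T_functional :: "(real^'n \<Rightarrow> real) \<Rightarrow> (real^'n \<Rightarrow> real) \<Rightarrow> real" where
  "T_functional g u = (\<integral>x. g x * u x \<partial>lebesgue_on (cbox 0 1))"

text \<open>The closure in \<open>BV_dual\<close>; that \<open>T_functional g\<close> itself lies in \<open>BV_dual\<close> for
  \<open>g \<in> Ld_cube\<close> is the Sobolev embedding.\<close>

definition SCH :: "((real^'n \<Rightarrow> real) \<Rightarrow> real) set" where
  "SCH = {\<alpha> \<in> BV_dual.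
            \<forall>e>0. \<exists>g\<in>Ld_cube. BV_dual_norm (\<lambda>u. \<alpha> u - T_functional g u) < ennreal e}"

definition BV_subsets :: "(real^'n) set set" where
  "BV_subsets = {B. B \<subseteq> cbox 0 1 \<and> B \<in> sets lebesgue \<and>
                    total_gradient (indicat_real B) < \<infinity>}"

definition strong_charge :: "((real^'n) set \<Rightarrow> real) \<Rightarrow> bool" where
  "strong_charge \<mu> \<longleftrightarrow> (\<exists>\<alpha>\<in>SCH. \<forall>B\<in>BV_subsets. \<mu> B = \<alpha> (indicat_real B))"

text \<open>Figures are BV-subsets, so a strong charge does restrict to them.\<close>

definition strongly_chargeable :: "(real^'n \<Rightarrow> real) \<Rightarrow> bool" where
  "strongly_chargeable f \<longleftrightarrow>
     (\<exists>G \<mu>. is_figure_increment f G \<and> strong_charge \<mu> \<and> (\<forall>F\<in>figures. \<mu> F = G F))"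

end

theory Submission
  imports Defs
begin

text \<open>
  Let \<open>d\<close> be the dimension and \<open>\<Delta>\<close> the increment of \<open>f\<close>. Both parts test a charge against step
  functions on dyadic cubes. In every pairing \<open>\<integral> g u\<close> that occurs, one factor is bounded and the
  other is in \<open>L\<^sup>1\<close>.

  Necessity. Suppose that \<open>\<Delta>\<close> extends to \<open>\<alpha> \<in> SCH\<close>, and let \<open>g \<in> L\<^sup>d\<close> be such that \<open>\<alpha> - T\<^sub>g\<close> has
  norm less than \<open>e\<close>. For fixed \<open>n\<close> and \<open>r\<close>, choosing the signs of the coefficients writes
  \<open>\<Sum>\<^sub>k \<bar>\<lambda>\<^sub>n\<^sub>,\<^sub>k\<^sub>,\<^sub>r\<bar>\<close> as \<open>2\<^bsup>nd/2\<^esup> \<alpha>(u)\<close>, where \<open>u\<close> is a step function on the cubes of level \<open>n + 1\<close> with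
  values in \<open>[-1, 1]\<close> (\<open>sum_abs_haar_coeff_le\<close>). There are \<open>2\<^bsup>(n+1)d\<^esup>\<close> such cubes, each of perimeter
  \<open>2 d 2\<^bsup>-(n+1)(d-1)\<^esup>\<close>, so the BV norm of \<open>u\<close> is \<open>O(2\<^sup>n)\<close> (\<open>signed_dyadic_sum\<close>), while
  \<open>\<bar>T\<^sub>g u\<bar> \<le> \<parallel>g\<parallel>\<^sub>1\<close>. Division by \<open>2\<^bsup>n(d/2+1)\<^esup>\<close> leaves \<open>O(e) + O(2\<^bsup>-n\<^esup>)\<close>, hence the limit superior is at most 0.

  Sufficiency. Let \<open>g\<^sub>n\<close> have the value \<open>2\<^bsup>nd\<^esup> \<Delta>(Q)\<close> on each cube \<open>Q\<close> of level \<open>n\<close>. The charge is the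
  limit of the functionals \<open>T\<close> given by \<open>g\<^sub>n\<close>. The difference \<open>g\<^sub>n\<^sub>+\<^sub>1 - g\<^sub>n\<close> has mean zero on each cube of level \<open>n\<close>, and
  inverting the Hadamard matrix bounds it by a multiple of \<open>2\<^bsup>nd/2\<^esup> max \<bar>\<lambda>\<^sub>n\<^sub>,\<^sub>k\<^sub>,\<^sub>r\<bar>\<close>
  (\<open>hadamard_deviation\<close>, \<open>haar_coeff_bound\<close>). A mean zero combination of the \<open>2\<^sup>d\<close> subcubes of a cube
  is an average of differences between two subcubes, and these are translates of each other by a
  vector of length \<open>O(2\<^bsup>-n\<^esup>)\<close>. Since translating by \<open>v\<close> moves \<open>u\<close> in \<open>L\<^sup>1\<close> by at most \<open>\<bar>v\<bar>\<close> times
  the total variation of \<open>Du\<close>, in the dual form of \<open>box_integral_translate_sum_le\<close>, the pairings of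
  \<open>u\<close> with \<open>g\<^sub>n\<^sub>+\<^sub>1\<close> and \<open>g\<^sub>n\<close> differ by at most a constant times \<open>2\<^bsup>n(d/2-1)\<^esup> max \<bar>\<lambda>\<^sub>n\<^sub>,\<^sub>k\<^sub>,\<^sub>r\<bar>\<close> times that
  variation (\<open>dyadic_pairing_step\<close>). This is summable, so the limit exists in the dual norm. On a
  dyadic box the pairings are eventually equal to the increment, because increments add up; general
  rectangles follow by approximation, as the limit is continuous under \<open>L\<^sup>1\<close> convergence with
  bounded variation and \<open>f\<close> is continuous (\<open>limit_charge_rectangle\<close>).
\<close>

section \<open>The total gradient as a seminorm\<close>

text \<open>
  A component of a gradient is encoded as a difference of two measures. The gradient of a sum of
  functions is a sum of gradients, so its positive and negative parts are sums of measures.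
\<close>

definition plus_measure :: "'a measure \<Rightarrow> 'a measure \<Rightarrow> 'a measure" where
  "plus_measure M N = measure_of (space M) (sets M) (\<lambda>A. emeasure M A + emeasure N A)"

lemma space_plus_measure [simp]: "space (plus_measure M N) = space M"
  by (simp add: plus_measure_def space_measure_of_conv)

lemma sets_plus_measure [simp, measurable_cong]: "sets (plus_measure M N) = sets M"
  by (simp add: plus_measure_def)

lemma emeasure_plus_measure:
  assumes "sets N = sets M"
  shows "emeasure (plus_measure M N) A = emeasure M A + emeasure N A"
proof (cases "A \<in> sets M")
  case True
  show ?thesis
    unfolding plus_measure_def
  proof (subst emeasure_measure_of_sigma)
    show "sigma_algebra (space M) (sets M)" ..
    show "positive (sets M) (\<lambda>A. emeasure M A + emeasure N A)"
      by (simp add: positive_def)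
    show "countably_additive (sets M) (\<lambda>A. emeasure M A + emeasure N A)"
      unfolding countably_additive_def
    proof (intro allI impI)
      fix B :: "nat \<Rightarrow> 'a set"
      assume B: "range B \<subseteq> sets M" "disjoint_family B" "(\<Union>i. B i) \<in> sets M"
      have "(\<Sum>i. emeasure M (B i) + emeasure N (B i)) = (\<Sum>i. emeasure M (B i)) + (\<Sum>i. emeasure N (B i))"
        by (rule suminf_add[symmetric]) auto
      with B assms show "(\<Sum>i. emeasure M (B i) + emeasure N (B i)) = emeasure M (\<Union>i. B i) + emeasure N (\<Union>i. B i)"
        by (simp add: suminf_emeasure)
    qed
    show "A \<in> sets M" by fact
  qed simp
next
  case False
  then show ?thesis using assms by (simp add: emeasure_notin_sets)
qed

lemma nn_integral_plus_measure:
  assumes N: "sets N = sets M" and "f \<in> borel_measurable M"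
  shows "nn_integral (plus_measure M N) f = nn_integral M f + nn_integral N f"
  using assms(2)
proof (induct rule: borel_measurable_induct)
  case (cong f g)
  moreover have "space N = space M" using N by (rule sets_eq_imp_space_eq)
  ultimately have "nn_integral (plus_measure M N) f = nn_integral (plus_measure M N) g"
    and "nn_integral M f = nn_integral M g" and "nn_integral N f = nn_integral N g"
    by - (rule nn_integral_cong; simp)+
  then show ?case using cong(4) by (simp only:)
next
  case (set A)
  then show ?case using N by (simp add: emeasure_plus_measure)
next
  case (mult u c)
  moreover have "u \<in> borel_measurable N" "u \<in> borel_measurable (plus_measure M N)"
    using mult N by (auto cong: measurable_cong_sets)
  ultimately show ?case by (simp add: nn_integral_cmult distrib_left)
next
  case (add u v)
  moreover have "u \<in> borel_measurable N" "u \<in> borel_measurable (plus_measure M N)"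
     "v \<in> borel_measurable N" "v \<in> borel_measurable (plus_measure M N)"
    using add N by (auto cong: measurable_cong_sets)
  ultimately show ?case by (simp add: nn_integral_add algebra_simps)
next
  case (seq U)
  have m: "U i \<in> borel_measurable N" "U i \<in> borel_measurable (plus_measure M N)" for i
    using seq N by (auto cong: measurable_cong_sets)
  have "nn_integral (plus_measure M N) (SUP i. U i) = (SUP i. nn_integral (plus_measure M N) (U i))"
    unfolding SUP_apply[abs_def] using seq m by (intro nn_integral_monotone_convergence_SUP) auto
  also have "\<dots> = (SUP i. nn_integral M (U i) + nn_integral N (U i))"
    using seq by simp
  also have "\<dots> = (SUP i. nn_integral M (U i)) + (SUP i. nn_integral N (U i))"
    using seq by (intro ennreal_SUP_add) (auto intro!: incseq_nn_integral)
  also have "\<dots> = nn_integral M (SUP i. U i) + nn_integral N (SUP i. U i)"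
    unfolding SUP_apply[abs_def] using seq m
    by (simp add: nn_integral_monotone_convergence_SUP)
  finally show ?case .
qed

lemma finite_measure_plus_measure:
  assumes "finite_measure M" "finite_measure N" "sets N = sets M"
  shows "finite_measure (plus_measure M N)"
proof
  have "space N = space M" using assms(3) by (rule sets_eq_imp_space_eq)
  then show "emeasure (plus_measure M N) (space (plus_measure M N)) \<noteq> \<infinity>"
    using finite_measure.emeasure_finite[OF assms(1)] finite_measure.emeasure_finite[OF assms(2)]
    by (simp add: emeasure_plus_measure assms(3))
qed

lemma measure_plus_measure:
  assumes "finite_measure M" "finite_measure N" "sets N = sets M"
  shows "measure (plus_measure M N) A = measure M A + measure N A"
  using finite_measure.emeasure_finite[OF assms(1)] finite_measure.emeasure_finite[OF assms(2)]
  by (simp add: measure_def emeasure_plus_measure assms(3) enn2real_plus less_top)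

lemma integral_plus_measure:
  fixes f :: "'a \<Rightarrow> real"
  assumes N: "sets N = sets M" and fM: "integrable M f" and fN: "integrable N f"
  shows "(\<integral>x. f x \<partial>plus_measure M N) = (\<integral>x. f x \<partial>M) + (\<integral>x. f x \<partial>N)"
proof -
  have m: "f \<in> borel_measurable M" using fM by simp
  have fin: "(\<integral>\<^sup>+x. ennreal (f x) \<partial>M) \<noteq> \<infinity>" "(\<integral>\<^sup>+x. ennreal (- f x) \<partial>M) \<noteq> \<infinity>"
      "(\<integral>\<^sup>+x. ennreal (f x) \<partial>N) \<noteq> \<infinity>" "(\<integral>\<^sup>+x. ennreal (- f x) \<partial>N) \<noteq> \<infinity>"
    using fM fN by (simp_all add: real_integrable_def)
  have eq: "(\<integral>\<^sup>+x. ennreal (f x) \<partial>plus_measure M N) = (\<integral>\<^sup>+x. ennreal (f x) \<partial>M) + (\<integral>\<^sup>+x. ennreal (f x) \<partial>N)"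
    "(\<integral>\<^sup>+x. ennreal (- f x) \<partial>plus_measure M N) = (\<integral>\<^sup>+x. ennreal (- f x) \<partial>M) + (\<integral>\<^sup>+x. ennreal (- f x) \<partial>N)"
    using m by (auto intro!: nn_integral_plus_measure N)
  have "integrable (plus_measure M N) f"
    using fin m by (simp add: real_integrable_def eq cong: measurable_cong_sets)
  then show ?thesis
    using fin by (simp add: real_lebesgue_integral_def fM fN eq enn2real_plus less_top)
qed

subsection \<open>Test functions\<close>

lemma smooth_fun_derivative:
  assumes "smooth_fun \<phi>"
  obtains \<phi>' where "\<And>x. (\<phi> has_derivative \<phi>' x) (at x)" "\<And>h. smooth_fun (\<lambda>x. \<phi>' x h)"
  using assms by (cases rule: smooth_fun.cases) auto

lemma smooth_fun_continuous_on: "smooth_fun \<phi> \<Longrightarrow> continuous_on S \<phi>"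
  by (meson continuous_at_imp_continuous_on has_derivative_continuous smooth_fun_derivative)

lemma test_function_continuous_on: "\<phi> \<in> test_functions \<Longrightarrow> continuous_on S \<phi>"
  by (simp add: test_functions_def smooth_fun_continuous_on)

lemma test_function_borel [measurable_dest]: "\<phi> \<in> test_functions \<Longrightarrow> \<phi> \<in> borel_measurable borel"
  by (simp add: test_function_continuous_on borel_measurable_continuous_onI)

lemma test_function_has_derivative:
  assumes "\<phi> \<in> test_functions"
  shows "(\<phi> has_derivative frechet_derivative \<phi> (at x)) (at x)"
proof -
  have "smooth_fun \<phi>" using assms by (simp add: test_functions_def)
  then have "\<phi> differentiable (at x)"
    by (rule smooth_fun_derivative) (auto simp: differentiable_def)
  then show ?thesis by (simp add: frechet_derivative_works)
qed

lemma partial_deriv_test_function: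
  assumes "\<phi> \<in> test_functions"
  shows "partial_deriv i \<phi> \<in> test_functions"
proof -
  obtain \<phi>' where d: "\<And>x. (\<phi> has_derivative \<phi>' x) (at x)" "\<And>h. smooth_fun (\<lambda>x. \<phi>' x h)"
    by (rule smooth_fun_derivative[of \<phi>]) (use assms in \<open>auto simp: test_functions_def\<close>)
  have eq: "partial_deriv i \<phi> = (\<lambda>x. \<phi>' x (axis i 1))"
    using frechet_derivative_at[OF d(1)] by (auto simp: partial_deriv_def fun_eq_iff)
  have "\<phi>' x (axis i 1) = 0" if "x \<notin> closure {x. \<phi> x \<noteq> 0}" for x
  proof -
    have z: "0 = \<phi> y" if "y \<in> - closure {x. \<phi> x \<noteq> 0}" for y
      using that closure_subset[of "{x. \<phi> x \<noteq> 0}"] by auto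
    have "((\<lambda>y. 0::real) has_derivative (\<lambda>h. 0)) (at x)" by simp
    moreover have "open (- closure {x. \<phi> x \<noteq> 0})" by (rule open_Compl[OF closed_closure])
    moreover have "x \<in> - closure {x. \<phi> x \<noteq> 0}" using that by simp
    ultimately have "(\<phi> has_derivative (\<lambda>h. 0)) (at x)"
      using z by (rule has_derivative_transform_within_open)
    from has_derivative_unique[OF d(1) this] show ?thesis by simp
  qed
  then have "{x. partial_deriv i \<phi> x \<noteq> 0} \<subseteq> closure {x. \<phi> x \<noteq> 0}"
    unfolding eq by auto
  then have "closure {x. partial_deriv i \<phi> x \<noteq> 0} \<subseteq> closure {x. \<phi> x \<noteq> 0}"
    by (intro closure_minimal) simp_all
  moreover have "compact (closure {x. \<phi> x \<noteq> 0})"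
    using assms by (simp add: test_functions_def)
  ultimately have "compact (closure {x. partial_deriv i \<phi> x \<noteq> 0})"
    using compact_Int_closed[of "closure {x. \<phi> x \<noteq> 0}" "closure {x. partial_deriv i \<phi> x \<noteq> 0}"]
    by (simp add: Int_absorb1)
  moreover have "smooth_fun (partial_deriv i \<phi>)"
    unfolding eq by (rule d(2))
  ultimately show ?thesis by (simp add: test_functions_def)
qed

lemma test_function_bounded:
  assumes "\<phi> \<in> test_functions"
  obtains B where "B > 0" "\<And>x. \<bar>\<phi> x\<bar> \<le> B"
proof -
  let ?K = "closure {x. \<phi> x \<noteq> 0}"
  have "compact (\<phi> ` ?K)"
    using assms by (intro compact_continuous_image test_function_continuous_on) (auto simp: test_functions_def)
  then have "bounded (\<phi> ` ?K)" by (rule compact_imp_bounded)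
  then obtain B where B: "B > 0" "\<And>x. x \<in> ?K \<Longrightarrow> \<bar>\<phi> x\<bar> \<le> B"
    by (auto simp: bounded_pos)
  have "\<bar>\<phi> x\<bar> \<le> B" for x
    using B closure_subset[of "{x. \<phi> x \<noteq> 0}"] by (cases "\<phi> x = 0") auto
  with B show ?thesis using that by blast
qed

lemma integrable_test_function:
  assumes "\<phi> \<in> test_functions" "finite_measure M" "sets M = sets borel"
  shows "integrable M \<phi>"
proof -
  obtain B where B: "\<And>x. \<bar>\<phi> x\<bar> \<le> B" using test_function_bounded[OF assms(1)] by blast
  interpret finite_measure M by fact
  show ?thesis
    using B test_function_borel[OF assms(1)] assms(3)
    by (intro integrable_const_bound[of _ B]) (auto cong: measurable_cong_sets)
qed

lemma integrable_mult_bounded_borel: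
  fixes u g :: "real^'n \<Rightarrow> real"
  assumes u: "integrable lebesgue u" and g: "g \<in> borel_measurable borel" and B: "\<And>x. \<bar>g x\<bar> \<le> B"
  shows "integrable lebesgue (\<lambda>x. u x * g x)"
proof -
  have 1: "g \<in> borel_measurable lebesgue"
    using g by (simp add: measurable_completion)
  have 2: "norm (u x * g x) \<le> norm (B * u x)" for x
    using mult_mono[of "\<bar>u x\<bar>" "\<bar>u x\<bar>" "\<bar>g x\<bar>" "\<bar>B\<bar>"] B[of x] by (simp add: abs_mult mult.commute)
  have 3: "integrable lebesgue (\<lambda>x. B * u x)"
    using u by (rule integrable_mult_right)
  have 4: "u \<in> borel_measurable lebesgue"
    using u by (rule borel_measurable_integrable)
  show ?thesis
    by (rule Bochner_Integration.integrable_bound[OF 3 borel_measurable_times[OF 4 1] AE_I2[OF 2]])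
qed

lemma integrable_mult_test_function:
  assumes "integrable lebesgue u" "\<phi> \<in> test_functions"
  shows "integrable lebesgue (\<lambda>x. u x * \<phi> x)"
proof -
  obtain B where "\<And>x. \<bar>\<phi> x\<bar> \<le> B" using test_function_bounded[OF assms(2)] by blast
  then show ?thesis
    by (rule integrable_mult_bounded_borel[OF assms(1) test_function_borel[OF assms(2)]])
qed

subsection \<open>Algebra of gradients\<close>

text \<open>
  The matrix of the existential statement in \<open>is_distr_gradient\<close>, named so that the two families of
  measures can be passed around as witnesses.
\<close>

definition gradient_parts ::
  "(real^'n \<Rightarrow> real) \<Rightarrow> ((real^'n) set \<Rightarrow> real^'n) \<Rightarrow>
    ('n \<Rightarrow> (real^'n) measure) \<Rightarrow> ('n \<Rightarrow> (real^'n) measure) \<Rightarrow> bool" where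
  "gradient_parts u D P N \<longleftrightarrow> (\<forall>i.
        finite_measure (P i) \<and> sets (P i) = sets borel \<and>
        finite_measure (N i) \<and> sets (N i) = sets borel \<and>
        (\<forall>B\<in>sets borel. D B $ i = measure (P i) B - measure (N i) B) \<and>
        (\<forall>\<phi>\<in>test_functions.
           (\<integral>x. u x * partial_deriv i \<phi> x \<partial>lebesgue) =
             - ((\<integral>x. \<phi> x \<partial>P i) - (\<integral>x. \<phi> x \<partial>N i))))"

lemma is_distr_gradient_iff: "is_distr_gradient u D \<longleftrightarrow> (\<exists>P N. gradient_parts u D P N)"
  unfolding is_distr_gradient_def gradient_parts_def ..

lemma gradient_partsD:
  assumes "gradient_parts u D P N"
  shows "finite_measure (P i)" "sets (P i) = sets borel"
    "finite_measure (N i)" "sets (N i) = sets borel"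
    "B \<in> sets borel \<Longrightarrow> D B $ i = measure (P i) B - measure (N i) B"
    "\<phi> \<in> test_functions \<Longrightarrow>
       (\<integral>x. u x * partial_deriv i \<phi> x \<partial>lebesgue) = - ((\<integral>x. \<phi> x \<partial>P i) - (\<integral>x. \<phi> x \<partial>N i))"
  using assms unfolding gradient_parts_def by simp_all

lemma is_distr_gradient_add:
  fixes u v :: "real^'n \<Rightarrow> real"
  assumes u: "integrable lebesgue u" and v: "integrable lebesgue v"
    and "is_distr_gradient u D" "is_distr_gradient v E"
  shows "is_distr_gradient (\<lambda>x. u x + v x) (\<lambda>B. D B + E B)"
proof -
  obtain P N where "gradient_parts u D P N"
    using assms(3) unfolding is_distr_gradient_iff by blast
  note PN = gradient_partsD[OF this]
  obtain P' N' where "gradient_parts v E P' N'"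
    using assms(4) unfolding is_distr_gradient_iff by blast
  note PN' = gradient_partsD[OF this]
  have int: "(\<integral>x. (u x + v x) * partial_deriv i \<phi> x \<partial>lebesgue) =
       (\<integral>x. u x * partial_deriv i \<phi> x \<partial>lebesgue) + (\<integral>x. v x * partial_deriv i \<phi> x \<partial>lebesgue)"
    if "\<phi> \<in> test_functions" for i \<phi>
    unfolding distrib_right using that u v
    by (intro Bochner_Integration.integral_add integrable_mult_test_function partial_deriv_test_function)
  show ?thesis
    unfolding is_distr_gradient_iff gradient_parts_def
  proof (intro exI allI conjI ballI)
    fix i
    show "finite_measure (plus_measure (P i) (P' i))" "finite_measure (plus_measure (N i) (N' i))"
      using PN PN' by (auto intro!: finite_measure_plus_measure)
    show "sets (plus_measure (P i) (P' i)) = sets borel" "sets (plus_measure (N i) (N' i)) = sets borel"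
      using PN by auto
    show "(D B + E B) $ i = measure (plus_measure (P i) (P' i)) B - measure (plus_measure (N i) (N' i)) B"
      if "B \<in> sets borel" for B
      using that PN PN' by (simp add: measure_plus_measure)
    show "(\<integral>x. (u x + v x) * partial_deriv i \<phi> x \<partial>lebesgue) =
       - ((\<integral>x. \<phi> x \<partial>plus_measure (P i) (P' i)) - (\<integral>x. \<phi> x \<partial>plus_measure (N i) (N' i)))"
      if "\<phi> \<in> test_functions" for \<phi>
      using that PN PN' by (simp add: int integral_plus_measure integrable_test_function)
  qed
qed

lemma is_distr_gradient_cmult:
  fixes u :: "real^'n \<Rightarrow> real"
  assumes "is_distr_gradient u D"
  shows "is_distr_gradient (\<lambda>x. c * u x) (\<lambda>B. c *\<^sub>R D B)"
proof -
  obtain P N where "gradient_parts u D P N"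
    using assms(1) unfolding is_distr_gradient_iff by blast
  note PN = gradient_partsD[OF this]
  define Q where "Q M = density M (\<lambda>_::real^'n. ennreal \<bar>c\<bar>)" for M
  have sets_Q: "sets (Q M) = sets M" for M by (simp add: Q_def)
  have em: "emeasure (Q M) B = ennreal \<bar>c\<bar> * emeasure M B" if "B \<in> sets M" for M B
    using that by (simp add: Q_def emeasure_density nn_integral_cmult)
  have fin: "finite_measure (Q M)" if "finite_measure M" for M
  proof
    show "emeasure (Q M) (space (Q M)) \<noteq> \<infinity>"
      using finite_measure.emeasure_finite[OF that] em[of "space M" M]
      by (simp add: Q_def ennreal_mult_eq_top_iff)
  qed
  have meas: "measure (Q M) B = \<bar>c\<bar> * measure M B" if "B \<in> sets M" for M B
    using em[OF that] by (simp add: measure_def enn2real_mult)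
  have int: "(\<integral>x. \<phi> x \<partial>Q M) = \<bar>c\<bar> * (\<integral>x. \<phi> x \<partial>M)"
    if "\<phi> \<in> test_functions" "sets M = sets borel" for M \<phi>
    using that test_function_borel[OF that(1)]
    unfolding Q_def by (subst integral_density) (auto cong: measurable_cong_sets)
  \<comment> \<open>A negative factor exchanges the positive and the negative part.\<close>
  define P' where "P' i = (if c \<ge> 0 then Q (P i) else Q (N i))" for i
  define N' where "N' i = (if c \<ge> 0 then Q (N i) else Q (P i))" for i
  show ?thesis
    unfolding is_distr_gradient_iff gradient_parts_def
  proof (intro exI allI conjI ballI)
    fix i
    show "finite_measure (P' i)" "finite_measure (N' i)" "sets (P' i) = sets borel" "sets (N' i) = sets borel"
      using PN fin sets_Q by (auto simp: P'_def N'_def)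
    show "(c *\<^sub>R D B) $ i = measure (P' i) B - measure (N' i) B"
      if "B \<in> sets borel" for B
      using PN(5)[OF that, of i] that by (simp add: P'_def N'_def meas PN(2,4) right_diff_distrib)
    show "(\<integral>x. c * u x * partial_deriv i \<phi> x \<partial>lebesgue) = - ((\<integral>x. \<phi> x \<partial>P' i) - (\<integral>x. \<phi> x \<partial>N' i))"
      if "\<phi> \<in> test_functions" for \<phi>
      using PN(6)[OF that, of i] that by (simp add: P'_def N'_def int PN(2,4) mult.assoc right_diff_distrib)
  qed
qed

lemma is_distr_gradient_AE_cong:
  assumes "AE x in lebesgue. u x = v x" "u \<in> borel_measurable lebesgue" "v \<in> borel_measurable lebesgue"
  shows "is_distr_gradient u D \<longleftrightarrow> is_distr_gradient v D"
proof -
  have "(\<integral>x. u x * partial_deriv i \<phi> x \<partial>lebesgue) = (\<integral>x. v x * partial_deriv i \<phi> x \<partial>lebesgue)"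
    if "\<phi> \<in> test_functions" for i \<phi>
  proof -
    have "partial_deriv i \<phi> \<in> borel_measurable lebesgue"
      using test_function_borel[OF partial_deriv_test_function[OF that]]
      by (simp add: measurable_completion)
    then show ?thesis
      using assms by (intro integral_cong_AE) auto
  qed
  then show ?thesis by (simp add: is_distr_gradient_def)
qed

lemma total_gradient_AE_cong:
  assumes "AE x in lebesgue. u x = v x" "u \<in> borel_measurable lebesgue" "v \<in> borel_measurable lebesgue"
  shows "total_gradient u = total_gradient v"
  by (simp add: total_gradient_def is_distr_gradient_AE_cong[OF assms])

lemma variation_measure_add:
  "variation_measure (\<lambda>B. D B + E B) S \<le> variation_measure D S + variation_measure E S"
  unfolding variation_measure_def
proof (rule SUP_least)
  fix A :: "nat \<Rightarrow> (real^'a) set"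
  assume A: "A \<in> {A. range A \<subseteq> sets borel \<and> disjoint_family A \<and> \<Union> (range A) = S}"
  have "(\<Sum>m. ennreal (norm (D (A m) + E (A m)))) \<le> (\<Sum>m. ennreal (norm (D (A m))) + ennreal (norm (E (A m))))"
    by (intro suminf_le) (auto simp flip: ennreal_plus intro!: ennreal_leI norm_triangle_ineq)
  also have "\<dots> = (\<Sum>m. ennreal (norm (D (A m)))) + (\<Sum>m. ennreal (norm (E (A m))))"
    by (rule suminf_add[symmetric]) auto
  also have "\<dots> \<le> (SUP A\<in>{A. range A \<subseteq> sets borel \<and> disjoint_family A \<and> \<Union> (range A) = S}. \<Sum>m. ennreal (norm (D (A m)))) +
     (SUP A\<in>{A. range A \<subseteq> sets borel \<and> disjoint_family A \<and> \<Union> (range A) = S}. \<Sum>m. ennreal (norm (E (A m))))"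
    using A by (intro add_mono SUP_upper)
  finally show "(\<Sum>m. ennreal (norm (D (A m) + E (A m)))) \<le> \<dots>" .
qed

lemma variation_measure_cmult:
  "variation_measure (\<lambda>B. c *\<^sub>R D B) S \<le> ennreal \<bar>c\<bar> * variation_measure D S"
  unfolding variation_measure_def
proof (rule SUP_least)
  fix A :: "nat \<Rightarrow> (real^'a) set"
  assume A: "A \<in> {A. range A \<subseteq> sets borel \<and> disjoint_family A \<and> \<Union> (range A) = S}"
  have "(\<Sum>m. ennreal (norm (c *\<^sub>R D (A m)))) = ennreal \<bar>c\<bar> * (\<Sum>m. ennreal (norm (D (A m))))"
    by (simp add: ennreal_mult)
  also have "\<dots> \<le> ennreal \<bar>c\<bar> * (SUP A\<in>{A. range A \<subseteq> sets borel \<and> disjoint_family A \<and> \<Union> (range A) = S}. \<Sum>m. ennreal (norm (D (A m))))"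
    using A by (intro mult_left_mono SUP_upper) auto
  finally show "(\<Sum>m. ennreal (norm (c *\<^sub>R D (A m)))) \<le> \<dots>" .
qed

lemma total_gradient_le: "is_distr_gradient u D \<Longrightarrow> total_gradient u \<le> variation_measure D UNIV"
  unfolding total_gradient_def by (auto intro: INF_lower)

text \<open>
  The total gradient is an infimum over gradients. Every bound by it is proved for a gradient that
  almost attains the infimum, and then by letting \<open>e\<close> tend to 0.
\<close>

lemma total_gradient_approx:
  assumes "total_gradient u < \<infinity>" "e > 0"
  obtains D where "is_distr_gradient u D" "variation_measure D UNIV \<le> total_gradient u + ennreal e"
proof -
  have "total_gradient u < total_gradient u + ennreal e"
    using assms by (simp add: ennreal_add_less_top)
  then show ?thesis
    using that unfolding total_gradient_def INF_less_iff by (auto intro: less_imp_le)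
qed

lemma total_gradient_add:
  fixes u v :: "real^'n \<Rightarrow> real"
  assumes "integrable lebesgue u" "integrable lebesgue v"
  shows "total_gradient (\<lambda>x. u x + v x) \<le> total_gradient u + total_gradient v"
proof (cases "total_gradient u = \<infinity> \<or> total_gradient v = \<infinity>")
  case False
  then have fin: "total_gradient u < \<infinity>" "total_gradient v < \<infinity>" by (auto simp: less_top)
  show ?thesis
  proof (rule ennreal_le_epsilon)
    fix e :: real assume e: "e > 0"
    obtain D where D: "is_distr_gradient u D" "variation_measure D UNIV \<le> total_gradient u + ennreal (e/2)"
      using total_gradient_approx[OF fin(1), of "e/2"] e by auto
    obtain E where E: "is_distr_gradient v E" "variation_measure E UNIV \<le> total_gradient v + ennreal (e/2)"
      using total_gradient_approx[OF fin(2), of "e/2"] e by auto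
    have "total_gradient (\<lambda>x. u x + v x) \<le> variation_measure (\<lambda>B. D B + E B) UNIV"
      using D E assms by (intro total_gradient_le is_distr_gradient_add)
    also have "\<dots> \<le> variation_measure D UNIV + variation_measure E UNIV"
      by (rule variation_measure_add)
    also have "\<dots> \<le> (total_gradient u + ennreal (e/2)) + (total_gradient v + ennreal (e/2))"
      using D E by (intro add_mono)
    also have "\<dots> = total_gradient u + total_gradient v + (ennreal (e/2) + ennreal (e/2))"
      by (simp add: algebra_simps)
    also have "ennreal (e/2) + ennreal (e/2) = ennreal e"
      using e by (simp flip: ennreal_plus)
    finally show "total_gradient (\<lambda>x. u x + v x) \<le> total_gradient u + total_gradient v + ennreal e" .
  qed
qed auto

lemma total_gradient_cmult:
  fixes u :: "real^'n \<Rightarrow> real"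
  assumes "total_gradient u < \<infinity>"
  shows "total_gradient (\<lambda>x. c * u x) \<le> ennreal \<bar>c\<bar> * total_gradient u"
proof (rule ennreal_le_epsilon)
  fix e :: real assume e: "e > 0"
  define e' where "e' = e / (\<bar>c\<bar> + 1)"
  have e': "e' > 0" "\<bar>c\<bar> * e' \<le> e"
    using e by (auto simp: e'_def field_simps)
  obtain D where D: "is_distr_gradient u D" "variation_measure D UNIV \<le> total_gradient u + ennreal e'"
    using total_gradient_approx[OF assms e'(1)] by auto
  have "total_gradient (\<lambda>x. c * u x) \<le> variation_measure (\<lambda>B. c *\<^sub>R D B) UNIV"
    using D by (intro total_gradient_le is_distr_gradient_cmult)
  also have "\<dots> \<le> ennreal \<bar>c\<bar> * variation_measure D UNIV"
    by (rule variation_measure_cmult)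
  also have "\<dots> \<le> ennreal \<bar>c\<bar> * (total_gradient u + ennreal e')"
    using D by (intro mult_left_mono) auto
  also have "\<dots> = ennreal \<bar>c\<bar> * total_gradient u + ennreal (\<bar>c\<bar> * e')"
    using e' by (simp add: distrib_left ennreal_mult)
  also have "\<dots> \<le> ennreal \<bar>c\<bar> * total_gradient u + ennreal e"
    using e' by (intro add_left_mono ennreal_leI)
  finally show "total_gradient (\<lambda>x. c * u x) \<le> ennreal \<bar>c\<bar> * total_gradient u + ennreal e" .
qed

lemma BV_space_add: "u \<in> BV_space \<Longrightarrow> v \<in> BV_space \<Longrightarrow> (\<lambda>x. u x + v x) \<in> BV_space"
  unfolding BV_space_def using total_gradient_add[of u v]
  by (simp add: order_le_less_trans)

lemma BV_space_cmult: "u \<in> BV_space \<Longrightarrow> (\<lambda>x. c * u x) \<in> BV_space"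
  unfolding BV_space_def using total_gradient_cmult[of u c]
  by (simp add: order_le_less_trans ennreal_mult_less_top)

lemma BV_cube_add: "u \<in> BV_cube \<Longrightarrow> v \<in> BV_cube \<Longrightarrow> (\<lambda>x. u x + v x) \<in> BV_cube"
  unfolding BV_cube_def by (auto simp: BV_space_add elim: AE_mp)

lemma BV_cube_cmult: "u \<in> BV_cube \<Longrightarrow> (\<lambda>x. c * u x) \<in> BV_cube"
  unfolding BV_cube_def by (auto simp: BV_space_cmult elim: AE_mp)

section \<open>The gradient of the indicator function of a box\<close>

lemma emeasure_lborel_box_cart:
  fixes l u :: "real^'n"
  assumes "\<And>j. l $ j \<le> u $ j"
  shows "emeasure lborel (box l u) = ennreal (\<Prod>j\<in>UNIV. u $ j - l $ j)"
    and "emeasure lborel (cbox l u) = ennreal (\<Prod>j\<in>UNIV. u $ j - l $ j)"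
proof -
  have le: "\<And>b. b \<in> Basis \<Longrightarrow> l \<bullet> b \<le> u \<bullet> b"
    using assms by (auto simp: Basis_vec_def inner_axis)
  have "(\<Prod>b\<in>Basis. (u - l) \<bullet> b) = (\<Prod>j\<in>UNIV. u $ j - l $ j)"
    by (simp add: Basis_vec_def cart_eq_inner_axis axis_eq_axis prod.UNION_disjoint inner_diff_left)
  then show "emeasure lborel (box l u) = ennreal (\<Prod>j\<in>UNIV. u $ j - l $ j)"
    and "emeasure lborel (cbox l u) = ennreal (\<Prod>j\<in>UNIV. u $ j - l $ j)"
    using le by (simp_all add: emeasure_lborel_cbox_eq emeasure_lborel_box_eq)
qed

definition vec_upd :: "real^'n \<Rightarrow> 'n \<Rightarrow> real \<Rightarrow> real^'n" where
  "vec_upd x i s = (\<chi> j. if j = i then s else x $ j)"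

lemma vec_upd_nth [simp]: "vec_upd x i s $ j = (if j = i then s else x $ j)"
  by (simp add: vec_upd_def)

lemma measurable_vec_upd [measurable]:
  assumes [measurable]: "f \<in> M \<rightarrow>\<^sub>M borel" "g \<in> M \<rightarrow>\<^sub>M borel"
  shows "(\<lambda>x. vec_upd (f x) i (g x)) \<in> M \<rightarrow>\<^sub>M borel"
proof -
  have [measurable]: "(\<lambda>x. f x $ j) \<in> M \<rightarrow>\<^sub>M borel" for j
    by (rule borel_measurable_continuous_on[OF _ assms(1)]) (intro continuous_intros)
  show ?thesis
    unfolding borel_measurable_euclidean_space[of "\<lambda>x. vec_upd (f x) i (g x)"]
    by (auto simp: Basis_vec_def inner_axis)
qed

definition slab :: "'n \<Rightarrow> (real^'n) set" where
  "slab i = {x. 0 < x $ i \<and> x $ i < 1}"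

lemma slab_borel [measurable]: "slab i \<in> sets borel"
proof -
  have "slab i = {x. 0 < x $ i} \<inter> {x. x $ i < 1}" by (auto simp: slab_def)
  moreover have "open {x::real^'n. 0 < x $ i}" "open {x::real^'n. x $ i < 1}" for i
    by (intro open_Collect_less continuous_intros)+
  ultimately show ?thesis by simp
qed

text \<open>
  Fubini for the \<open>i\<close>-th coordinate without leaving the type \<open>real^'n\<close>: that coordinate only has to
  range over an interval of length 1, and is then overwritten by an independent Lebesgue
  distributed variable. Both measures agree on open boxes.
\<close>

lemma lborel_eq_distr_vec_upd:
  fixes i :: "'n::finite"
  shows "lborel = distr (density lborel (indicator (slab i)) \<Otimes>\<^sub>M lborel) borel (\<lambda>(x, s). vec_upd x i s)"
    (is "_ = distr (?S \<Otimes>\<^sub>M lborel) _ _")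
proof (rule lborel_eqI)
  fix l u :: "real^'n"
  assume "\<And>b. b \<in> Basis \<Longrightarrow> l \<bullet> b \<le> u \<bullet> b"
  then have le: "\<And>j. l $ j \<le> u $ j"
    by (auto simp: cart_eq_inner_axis Basis_vec_def)
  define A where "A = {x::real^'n. \<forall>j. j \<noteq> i \<longrightarrow> l $ j < x $ j \<and> x $ j < u $ j}"
  have "open A"
  proof -
    have "A = (\<Inter>j\<in>-{i}. {x. l $ j < x $ j} \<inter> {x. x $ j < u $ j})"
      by (auto simp: A_def)
    moreover have "open \<dots>"
      by (intro open_INT open_Int ballI open_Collect_less continuous_intros) simp
    ultimately show ?thesis by simp
  qed
  then have [measurable]: "A \<in> sets borel" by simp
  have pre: "(\<lambda>(x, s). vec_upd x i s) -` box l u \<inter> space (?S \<Otimes>\<^sub>M lborel) = A \<times> {l $ i<..<u $ i}"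
    by (auto simp: mem_box_cart A_def space_pair_measure split: if_splits)
  have slabA: "slab i \<inter> A = box (vec_upd l i 0) (vec_upd u i 1)"
    by (auto simp: mem_box_cart A_def slab_def split: if_splits)
  have "emeasure ?S A = emeasure lborel (slab i \<inter> A)"
    by (subst emeasure_density) (simp_all add: indicator_inter_arith[symmetric])
  also have "\<dots> = ennreal (\<Prod>j\<in>UNIV. (if j = i then 1 else u $ j - l $ j))"
    unfolding slabA
    by (subst emeasure_lborel_box_cart) (auto simp: le intro!: arg_cong[where f=ennreal] prod.cong)
  also have "(\<Prod>j\<in>UNIV. (if j = i then 1 else u $ j - l $ j)) = (\<Prod>j\<in>UNIV - {i}. u $ j - l $ j)"
    by (rule prod.mono_neutral_cong_right) auto
  finally have "emeasure ?S A = ennreal (\<Prod>j\<in>UNIV - {i}. u $ j - l $ j)" .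
  then have "emeasure (?S \<Otimes>\<^sub>M lborel) (A \<times> {l $ i<..<u $ i}) =
      ennreal (\<Prod>j\<in>UNIV - {i}. u $ j - l $ j) * ennreal (u $ i - l $ i)"
    using le by (subst lborel.emeasure_pair_measure_Times) auto
  also have "\<dots> = ennreal ((u $ i - l $ i) * (\<Prod>j\<in>UNIV - {i}. u $ j - l $ j))"
    using le by (subst ennreal_mult[symmetric]) (auto intro!: prod_nonneg simp: mult.commute)
  also have "(u $ i - l $ i) * (\<Prod>j\<in>UNIV - {i}. u $ j - l $ j) = (\<Prod>j\<in>UNIV. u $ j - l $ j)"
    by (rule prod.remove[symmetric]) auto
  also have "\<dots> = (\<Prod>b\<in>Basis. (u - l) \<bullet> b)"
    by (simp add: Basis_vec_def cart_eq_inner_axis axis_eq_axis prod.UNION_disjoint inner_diff_left)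
  finally show "emeasure (distr (?S \<Otimes>\<^sub>M lborel) borel (\<lambda>(x, s). vec_upd x i s)) (box l u) =
      ennreal (\<Prod>b\<in>Basis. (u - l) \<bullet> b)"
    by (subst emeasure_distr) (auto simp: pre)
qed simp

text \<open>
  The surface measure on the part of the hyperplane \<open>x\<^sub>i = t\<close> that projects onto the sides of
  \<open>cbox a b\<close> other than the \<open>i\<close>-th. It is the image of Lebesgue measure on a box whose \<open>i\<close>-th side has
  length 1, so that its mass is the \<open>(d-1)\<close>-dimensional volume of the face.
\<close>

definition box_face :: "real^'n \<Rightarrow> real^'n \<Rightarrow> 'n \<Rightarrow> real \<Rightarrow> (real^'n) measure" where
  "box_face a b i t =
     distr (density lborel (indicator (slab i \<inter> {x. \<forall>j. j \<noteq> i \<longrightarrow> a $ j \<le> x $ j \<and> x $ j \<le> b $ j})))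
       borel (\<lambda>x. vec_upd x i t)"

lemma sets_box_face [simp]: "sets (box_face a b i t) = sets borel"
  by (simp add: box_face_def)

lemma box_side_borel: "{x::real^'n. \<forall>j. j \<noteq> i \<longrightarrow> a $ j \<le> x $ j \<and> x $ j \<le> b $ j} \<in> sets borel"
proof -
  have "{x. \<forall>j. j \<noteq> i \<longrightarrow> a $ j \<le> x $ j \<and> x $ j \<le> b $ j} =
      (\<Inter>j\<in>-{i}. {x::real^'n. a $ j \<le> x $ j} \<inter> {x. x $ j \<le> b $ j})"
    by auto
  moreover have "closed \<dots>"
    by (intro closed_INT closed_Int ballI closed_Collect_le continuous_intros)
  ultimately show ?thesis by simp
qed

lemma emeasure_box_face_le:
  assumes "\<And>j. a $ j \<le> b $ j"
  shows "emeasure (box_face a b i t) UNIV \<le> ennreal (\<Prod>j\<in>UNIV - {i}. b $ j - a $ j)"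
proof -
  let ?B = "slab i \<inter> {x. \<forall>j. j \<noteq> i \<longrightarrow> a $ j \<le> x $ j \<and> x $ j \<le> b $ j}"
  note [measurable] = box_side_borel
  have "emeasure (box_face a b i t) UNIV = emeasure (density lborel (indicator ?B)) UNIV"
    unfolding box_face_def by (subst emeasure_distr) auto
  also have "\<dots> = emeasure lborel ?B"
    by (subst emeasure_density) (simp_all add: box_side_borel)
  also have "\<dots> \<le> emeasure lborel (cbox (vec_upd a i 0) (vec_upd b i 1))"
    by (rule emeasure_mono) (auto simp: mem_box_cart slab_def)
  also have "\<dots> = ennreal (\<Prod>j\<in>UNIV. (if j = i then 1 else b $ j - a $ j))"
    by (subst emeasure_lborel_box_cart) (auto simp: assms intro!: arg_cong[where f=ennreal] prod.cong)
  also have "(\<Prod>j\<in>UNIV. (if j = i then 1 else b $ j - a $ j)) = (\<Prod>j\<in>UNIV - {i}. b $ j - a $ j)"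
    by (rule prod.mono_neutral_cong_right) auto
  finally show ?thesis .
qed

lemma finite_measure_box_face:
  assumes "\<And>j. a $ j \<le> b $ j"
  shows "finite_measure (box_face a b i t)"
proof
  have "emeasure (box_face a b i t) UNIV < \<infinity>"
    by (rule le_less_trans[OF emeasure_box_face_le[OF assms]]) simp
  then show "emeasure (box_face a b i t) (space (box_face a b i t)) \<noteq> \<infinity>"
    by (simp add: box_face_def)
qed

text \<open>
  The fundamental theorem of calculus in the \<open>i\<close>-th coordinate: the \<open>i\<close>-th component of the gradient
  of the indicator is the measure of the lower face minus that of the upper face.
\<close>

lemma integral_partial_deriv_box:
  fixes \<phi> :: "real^'n \<Rightarrow> real"
  assumes \<phi>: "\<phi> \<in> test_functions" and ab: "\<And>j. a $ j \<le> b $ j"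
  shows "(\<integral>x. indicat_real (cbox a b) x * partial_deriv i \<phi> x \<partial>lebesgue) =
     (\<integral>x. \<phi> x \<partial>box_face a b i (b $ i)) - (\<integral>x. \<phi> x \<partial>box_face a b i (a $ i))"
proof -
  note [measurable] = box_side_borel test_function_borel[OF \<phi>]
    test_function_borel[OF partial_deriv_test_function[OF \<phi>, of i]]
  let ?S = "density lborel (indicator (slab i)) :: (real^'n) measure"
  let ?C = "{x::real^'n. \<forall>j. j \<noteq> i \<longrightarrow> a $ j \<le> x $ j \<and> x $ j \<le> b $ j}"
  let ?f = "\<lambda>x. indicat_real (cbox a b) x * partial_deriv i \<phi> x"
  have sf: "sigma_finite_measure ?S"
    by (subst sigma_finite_measure.sigma_finite_iff_density_finite[OF sigma_finite_lborel])
       (auto simp: indicator_def)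
  interpret pair_sigma_finite ?S "lborel :: real measure"
    by (intro pair_sigma_finite.intro sf) standard
  have int: "integrable lborel ?f"
  proof -
    have "integrable lborel (indicat_real (cbox a b))"
      using emeasure_lborel_cbox_finite[of a b] by (simp add: integrable_indicator_iff)
    then have "integrable lebesgue (indicat_real (cbox a b))"
      by (simp add: integrable_completion)
    then have "integrable lebesgue ?f"
      by (rule integrable_mult_test_function) (rule partial_deriv_test_function[OF \<phi>])
    then show ?thesis by (simp add: integrable_completion)
  qed
  have FTC: "(\<integral>s. ?f (vec_upd x i s) \<partial>lborel) =
      indicat_real ?C x * (\<phi> (vec_upd x i (b $ i)) - \<phi> (vec_upd x i (a $ i)))" for x
  proof -
    have lin: "vec_upd x i = (\<lambda>s. vec_upd x i 0 + s *\<^sub>R axis i 1)"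
      by (rule ext) (simp add: vec_eq_iff axis_def)
    have der: "((\<lambda>s. \<phi> (vec_upd x i s)) has_real_derivative partial_deriv i \<phi> (vec_upd x i s)) (at s)" for s
    proof -
      let ?D = "frechet_derivative \<phi> (at (vec_upd x i s))"
      have "((\<lambda>s. vec_upd x i s) has_derivative (\<lambda>h. h *\<^sub>R axis i 1)) (at s)"
        by (subst lin) (auto intro!: derivative_eq_intros)
      from diff_chain_at[OF this test_function_has_derivative[OF \<phi>]]
      have *: "((\<lambda>s. \<phi> (vec_upd x i s)) has_derivative (\<lambda>h. ?D (h *\<^sub>R axis i 1))) (at s)"
        by (simp add: o_def)
      have "?D (h *\<^sub>R axis i 1) = h * ?D (axis i 1)" for h
        using linear_cmul[OF has_derivative_linear[OF test_function_has_derivative[OF \<phi>]]]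
        by simp
      then have "(\<lambda>h. ?D (h *\<^sub>R axis i 1)) = (*) (partial_deriv i \<phi> (vec_upd x i s))"
        by (auto simp: fun_eq_iff partial_deriv_def mult.commute)
      with * show ?thesis
        by (simp add: has_field_derivative_def)
    qed
    have cont: "isCont (\<lambda>s. partial_deriv i \<phi> (vec_upd x i s)) s" for s
    proof -
      have "continuous_on UNIV (\<lambda>s. vec_upd x i s)"
        by (subst lin) (intro continuous_intros)
      then have "continuous_on UNIV (\<lambda>s. partial_deriv i \<phi> (vec_upd x i s))"
        by (rule continuous_on_compose2[OF test_function_continuous_on[of _ UNIV, OF partial_deriv_test_function[OF \<phi>]]]) simp
      then show ?thesis by (simp add: continuous_on_eq_continuous_at)
    qed
    have "(\<integral>s. ?f (vec_upd x i s) \<partial>lborel) =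
        (\<integral>s. indicat_real ?C x * (partial_deriv i \<phi> (vec_upd x i s) * indicator {a $ i..b $ i} s) \<partial>lborel)"
      by (intro Bochner_Integration.integral_cong refl) (auto simp: indicator_def mem_box_cart split: if_splits)
    also have "\<dots> = indicat_real ?C x * (\<integral>s. partial_deriv i \<phi> (vec_upd x i s) * indicator {a $ i..b $ i} s \<partial>lborel)"
      by simp
    also have "(\<integral>s. partial_deriv i \<phi> (vec_upd x i s) * indicator {a $ i..b $ i} s \<partial>lborel) =
        \<phi> (vec_upd x i (b $ i)) - \<phi> (vec_upd x i (a $ i))"
      by (rule integral_FTC_Icc_real[OF ab der cont])
    finally show ?thesis .
  qed
  have face: "(\<integral>x. \<phi> x \<partial>box_face a b i t) = (\<integral>x. indicator ?C x * \<phi> (vec_upd x i t) \<partial>?S)"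
    and face_int: "integrable ?S (\<lambda>x. indicator ?C x * \<phi> (vec_upd x i t))" for t
  proof -
    have ind: "indicator (slab i \<inter> ?C) = (\<lambda>x. ennreal (indicat_real (slab i \<inter> ?C) x))"
      by (auto simp: indicator_def fun_eq_iff)
    have ind': "indicator (slab i) = (\<lambda>x::real^'n. ennreal (indicat_real (slab i) x))"
      by (auto simp: indicator_def fun_eq_iff)
    have "(\<integral>x. \<phi> x \<partial>box_face a b i t) = (\<integral>x. \<phi> (vec_upd x i t) \<partial>density lborel (indicator (slab i \<inter> ?C)))"
      unfolding box_face_def by (subst integral_distr) auto
    also have "\<dots> = (\<integral>x. indicator (slab i \<inter> ?C) x * \<phi> (vec_upd x i t) \<partial>lborel)"
      unfolding ind by (subst integral_density) auto
    also have "\<dots> = (\<integral>x. indicator (slab i) x * (indicator ?C x * \<phi> (vec_upd x i t)) \<partial>lborel)"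
      by (simp add: indicator_inter_arith mult.assoc)
    also have "\<dots> = (\<integral>x. indicator ?C x * \<phi> (vec_upd x i t) \<partial>?S)"
      unfolding ind' by (subst integral_density) auto
    finally show "(\<integral>x. \<phi> x \<partial>box_face a b i t) = (\<integral>x. indicator ?C x * \<phi> (vec_upd x i t) \<partial>?S)" .
    have "integrable (box_face a b i t) \<phi>"
      by (rule integrable_test_function[OF \<phi> finite_measure_box_face[OF ab] sets_box_face])
    then have "integrable (density lborel (indicator (slab i \<inter> ?C))) (\<lambda>x. \<phi> (vec_upd x i t))"
      unfolding box_face_def by (subst (asm) integrable_distr_eq) auto
    then have "integrable lborel (\<lambda>x. indicator (slab i \<inter> ?C) x * \<phi> (vec_upd x i t))"
      unfolding ind by (subst (asm) integrable_density) auto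
    then have "integrable lborel (\<lambda>x. indicator (slab i) x * (indicator ?C x * \<phi> (vec_upd x i t)))"
      by (simp add: indicator_inter_arith mult.assoc)
    then show "integrable ?S (\<lambda>x. indicator ?C x * \<phi> (vec_upd x i t))"
      unfolding ind' by (subst integrable_density) auto
  qed
  have "(\<integral>x. ?f x \<partial>lebesgue) = (\<integral>x. ?f x \<partial>lborel)"
    by (rule integral_completion) simp
  also have "\<dots> = (\<integral>z. ?f (case z of (x, s) \<Rightarrow> vec_upd x i s) \<partial>(?S \<Otimes>\<^sub>M lborel))"
    by (subst lborel_eq_distr_vec_upd[of i], subst integral_distr) auto
  also have "\<dots> = (\<integral>x. (\<integral>s. ?f (vec_upd x i s) \<partial>lborel) \<partial>?S)"
  proof -
    have "integrable (?S \<Otimes>\<^sub>M lborel) (\<lambda>z. ?f (case z of (x, s) \<Rightarrow> vec_upd x i s))"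
      using int by (subst (asm) lborel_eq_distr_vec_upd[of i], subst (asm) integrable_distr_eq) auto
    from integral_fst'[OF this] show ?thesis by simp
  qed
  also have "\<dots> = (\<integral>x. indicat_real ?C x * \<phi> (vec_upd x i (b $ i)) - indicat_real ?C x * \<phi> (vec_upd x i (a $ i)) \<partial>?S)"
    by (simp only: FTC right_diff_distrib)
  also have "\<dots> = (\<integral>x. \<phi> x \<partial>box_face a b i (b $ i)) - (\<integral>x. \<phi> x \<partial>box_face a b i (a $ i))"
    by (subst Bochner_Integration.integral_diff[OF face_int face_int]) (simp add: face)
  finally show ?thesis .
qed

lemma variation_measure_le:
  assumes "gradient_parts u D P N"
  shows "variation_measure D UNIV \<le> (\<Sum>i\<in>UNIV. emeasure (P i) UNIV + emeasure (N i) UNIV)"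
  unfolding variation_measure_def
proof (rule SUP_least)
  note PN = gradient_partsD[OF assms]
  fix A :: "nat \<Rightarrow> (real^'a) set"
  assume "A \<in> {A. range A \<subseteq> sets borel \<and> disjoint_family A \<and> \<Union> (range A) = UNIV}"
  then have A: "range A \<subseteq> sets borel" "disjoint_family A" "\<Union> (range A) = UNIV" by auto
  have "ennreal (norm (D (A m))) \<le> (\<Sum>i\<in>UNIV. emeasure (P i) (A m) + emeasure (N i) (A m))" for m
  proof -
    have Am: "A m \<in> sets borel" using A by auto
    have "norm (D (A m)) \<le> (\<Sum>i\<in>UNIV. \<bar>D (A m) $ i\<bar>)"
      by (rule norm_le_l1_cart)
    also have "\<dots> \<le> (\<Sum>i\<in>UNIV. measure (P i) (A m) + measure (N i) (A m))"
      by (intro sum_mono) (simp add: PN(5)[OF Am] abs_real_def)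
    finally have "ennreal (norm (D (A m))) \<le> ennreal (\<Sum>i\<in>UNIV. measure (P i) (A m) + measure (N i) (A m))"
      by (rule ennreal_leI)
    also have "\<dots> = (\<Sum>i\<in>UNIV. emeasure (P i) (A m) + emeasure (N i) (A m))"
      by (subst sum_ennreal[symmetric])
        (simp_all add: finite_measure.emeasure_eq_measure[OF PN(1)] finite_measure.emeasure_eq_measure[OF PN(3)])
    finally show ?thesis .
  qed
  then have "(\<Sum>m. ennreal (norm (D (A m)))) \<le> (\<Sum>m. \<Sum>i\<in>UNIV. emeasure (P i) (A m) + emeasure (N i) (A m))"
    by (intro suminf_le) auto
  also have "\<dots> = (\<Sum>i\<in>UNIV. \<Sum>m. emeasure (P i) (A m) + emeasure (N i) (A m))"
    by (rule suminf_sum) simp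
  also have "\<dots> = (\<Sum>i\<in>UNIV. emeasure (P i) UNIV + emeasure (N i) UNIV)"
  proof (rule sum.cong[OF refl])
    fix i
    have "(\<Sum>m. emeasure (P i) (A m) + emeasure (N i) (A m)) =
        (\<Sum>m. emeasure (P i) (A m)) + (\<Sum>m. emeasure (N i) (A m))"
      by (rule suminf_add[symmetric]) auto
    also have "\<dots> = emeasure (P i) UNIV + emeasure (N i) UNIV"
      using A PN(2,4) by (simp add: suminf_emeasure)
    finally show "(\<Sum>m. emeasure (P i) (A m) + emeasure (N i) (A m)) = emeasure (P i) UNIV + emeasure (N i) UNIV" .
  qed
  finally show "(\<Sum>m. ennreal (norm (D (A m)))) \<le> (\<Sum>i\<in>UNIV. emeasure (P i) UNIV + emeasure (N i) UNIV)" .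
qed

text \<open>
  The bound is the perimeter of the box: in each direction there are two opposite faces.
\<close>

lemma total_gradient_box:
  fixes a b :: "real^'n"
  assumes ab: "\<And>j. a $ j \<le> b $ j"
  shows "total_gradient (indicat_real (cbox a b)) \<le> ennreal (\<Sum>i\<in>UNIV. 2 * (\<Prod>j\<in>UNIV - {i}. b $ j - a $ j))"
proof -
  define P where "P i = box_face a b i (a $ i)" for i
  define N where "N i = box_face a b i (b $ i)" for i
  define D where "D B = (\<chi> i. measure (P i) B - measure (N i) B)" for B
  have gp: "gradient_parts (indicat_real (cbox a b)) D P N"
    unfolding gradient_parts_def
    using integral_partial_deriv_box[OF _ ab] finite_measure_box_face[OF ab]
    by (simp add: P_def N_def D_def)
  then have "total_gradient (indicat_real (cbox a b)) \<le> variation_measure D UNIV"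
    by (intro total_gradient_le) (auto simp: is_distr_gradient_iff)
  also have "\<dots> \<le> (\<Sum>i\<in>UNIV. emeasure (P i) UNIV + emeasure (N i) UNIV)"
    by (rule variation_measure_le[OF gp])
  also have "\<dots> \<le> (\<Sum>i\<in>UNIV. ennreal (\<Prod>j\<in>UNIV - {i}. b $ j - a $ j) + ennreal (\<Prod>j\<in>UNIV - {i}. b $ j - a $ j))"
    unfolding P_def N_def by (intro sum_mono add_mono emeasure_box_face_le ab)
  also have "\<dots> = (\<Sum>i\<in>UNIV. ennreal (2 * (\<Prod>j\<in>UNIV - {i}. b $ j - a $ j)))"
    using ab by (intro sum.cong refl) (simp add: prod_nonneg flip: ennreal_plus)
  also have "\<dots> = ennreal (\<Sum>i\<in>UNIV. 2 * (\<Prod>j\<in>UNIV - {i}. b $ j - a $ j))"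
    using ab by (intro sum_ennreal) (simp add: prod_nonneg)
  finally show ?thesis .
qed

section \<open>Testing the gradient\<close>

lemma integral_mono_measure_on:
  fixes \<psi> :: "'a \<Rightarrow> real"
  assumes "finite_measure M" "finite_measure N" and sets: "sets N = sets M"
    and Z: "Z \<in> sets M" and le: "\<And>X. X \<in> sets M \<Longrightarrow> X \<subseteq> Z \<Longrightarrow> emeasure N X \<le> emeasure M X"
    and \<psi>: "\<psi> \<in> borel_measurable M" "\<And>x. 0 \<le> \<psi> x" "\<And>x. \<psi> x \<le> C"
  shows "(\<integral>x. indicator Z x * \<psi> x \<partial>N) \<le> (\<integral>x. indicator Z x * \<psi> x \<partial>M)"
proof -
  interpret M: finite_measure M by fact
  interpret N: finite_measure N by fact
  have \<psi>N: "\<psi> \<in> borel_measurable N" and ZN: "Z \<in> sets N"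
    using \<psi>(1) Z sets by (auto cong: measurable_cong_sets)
  have "density N (indicator Z) \<le> density M (indicator Z)"
  proof (subst le_measure)
    show "sets (density N (indicator Z)) = sets (density M (indicator Z))"
      using sets by simp
    show "\<forall>A\<in>sets (density N (indicator Z)). emeasure (density N (indicator Z)) A \<le> emeasure (density M (indicator Z)) A"
    proof
      fix A assume "A \<in> sets (density N (indicator Z))"
      then have A: "A \<in> sets N" "A \<in> sets M" using sets by auto
      have "emeasure (density N (indicator Z)) A = emeasure N (Z \<inter> A)"
        using A ZN by (subst emeasure_density) (auto simp flip: indicator_inter_arith)
      also have "\<dots> \<le> emeasure M (Z \<inter> A)"
        using A Z by (intro le) auto
      also have "\<dots> = emeasure (density M (indicator Z)) A"
        using A Z by (subst emeasure_density) (auto simp flip: indicator_inter_arith)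
      finally show "emeasure (density N (indicator Z)) A \<le> emeasure (density M (indicator Z)) A" .
    qed
  qed
  then have "(\<integral>\<^sup>+x. ennreal (\<psi> x) \<partial>density N (indicator Z)) \<le> (\<integral>\<^sup>+x. ennreal (\<psi> x) \<partial>density M (indicator Z))"
    by (intro nn_integral_mono_measure) (use sets in auto)
  moreover have "(\<integral>\<^sup>+x. ennreal (\<psi> x) \<partial>density N (indicator Z)) = (\<integral>\<^sup>+x. ennreal (indicator Z x * \<psi> x) \<partial>N)"
    using \<psi>N ZN by (subst nn_integral_density) (auto intro!: nn_integral_cong simp: indicator_def)
  moreover have "(\<integral>\<^sup>+x. ennreal (\<psi> x) \<partial>density M (indicator Z)) = (\<integral>\<^sup>+x. ennreal (indicator Z x * \<psi> x) \<partial>M)"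
    using \<psi>(1) Z by (subst nn_integral_density) (auto intro!: nn_integral_cong simp: indicator_def)
  ultimately have le: "(\<integral>\<^sup>+x. ennreal (indicator Z x * \<psi> x) \<partial>N) \<le> (\<integral>\<^sup>+x. ennreal (indicator Z x * \<psi> x) \<partial>M)"
    by simp
  have fin: "(\<integral>\<^sup>+x. ennreal (indicator Z x * \<psi> x) \<partial>M) < \<infinity>"
  proof -
    have "(\<integral>\<^sup>+x. ennreal (indicator Z x * \<psi> x) \<partial>M) \<le> (\<integral>\<^sup>+x. ennreal C \<partial>M)"
      using \<psi>(2,3) order_trans[OF \<psi>(2) \<psi>(3)]
      by (intro nn_integral_mono ennreal_leI) (auto simp: indicator_def)
    also have "\<dots> < \<infinity>"
      by (simp add: ennreal_mult_eq_top_iff less_top[symmetric])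
    finally show ?thesis .
  qed
  show ?thesis
    using \<psi>N ZN \<psi> Z le fin by (auto simp: integral_eq_nn_integral intro!: enn2real_mono)
qed

text \<open>
  On one half of a Hahn decomposition, where \<open>M\<close> dominates \<open>N\<close>, the integrals of the nonnegative
  functions \<open>B - \<phi>\<close> and \<open>B + \<phi>\<close> are monotone in the measure.
\<close>

lemma integral_diff_le_measure_diff:
  fixes \<phi> :: "'a \<Rightarrow> real"
  assumes M: "finite_measure M" and N: "finite_measure N" and sets: "sets N = sets M"
    and Z: "Z \<in> sets M" and le: "\<And>X. X \<in> sets M \<Longrightarrow> X \<subseteq> Z \<Longrightarrow> emeasure N X \<le> emeasure M X"
    and \<phi>: "\<phi> \<in> borel_measurable M" "\<And>x. \<bar>\<phi> x\<bar> \<le> B"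
  shows "\<bar>(\<integral>x. indicator Z x * \<phi> x \<partial>M) - (\<integral>x. indicator Z x * \<phi> x \<partial>N)\<bar> \<le> B * (measure M Z - measure N Z)"
proof -
  interpret M: finite_measure M by fact
  interpret N: finite_measure N by fact
  have \<phi>N: "\<phi> \<in> borel_measurable N" and ZN: "Z \<in> sets N"
    using \<phi>(1) Z sets by (auto cong: measurable_cong_sets)
  have B: "0 \<le> B" using \<phi>(2)[of undefined] by linarith
  have bd: "norm (indicator Z x * \<phi> x) \<le> B" for x
    using \<phi>(2)[of x] B by (auto simp: indicator_def)
  have iM: "integrable M (\<lambda>x. indicator Z x * \<phi> x)"
    using bd \<phi>(1) Z by (intro M.integrable_const_bound[of _ B]) auto
  have iN: "integrable N (\<lambda>x. indicator Z x * \<phi> x)"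
    using bd \<phi>N ZN by (intro N.integrable_const_bound[of _ B]) auto
  have cM: "integrable M (\<lambda>x. indicator Z x * B)" and cN: "integrable N (\<lambda>x. indicator Z x * B)"
    using Z ZN by (auto simp: integrable_indicator_iff less_top[symmetric])
  have vM: "(\<integral>x. indicator Z x * B \<partial>M) = B * measure M Z" and vN: "(\<integral>x. indicator Z x * B \<partial>N) = B * measure N Z"
    using Z ZN by (simp_all add: M.emeasure_eq_measure N.emeasure_eq_measure)
  have a: "0 \<le> B - \<phi> x" "B - \<phi> x \<le> 2 * B" "0 \<le> B + \<phi> x" "B + \<phi> x \<le> 2 * B" for x
    using \<phi>(2)[of x] by linarith+
  have "(\<integral>x. indicator Z x * (B - \<phi> x) \<partial>N) \<le> (\<integral>x. indicator Z x * (B - \<phi> x) \<partial>M)"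
    using \<phi>(1) by (intro integral_mono_measure_on[OF M N sets Z le _ a(1,2)]) auto
  moreover have "(\<integral>x. indicator Z x * (B + \<phi> x) \<partial>N) \<le> (\<integral>x. indicator Z x * (B + \<phi> x) \<partial>M)"
    using \<phi>(1) by (intro integral_mono_measure_on[OF M N sets Z le _ a(3,4)]) auto
  ultimately show ?thesis
    unfolding distrib_left right_diff_distrib Bochner_Integration.integral_add[OF cM iM]
        Bochner_Integration.integral_add[OF cN iN] Bochner_Integration.integral_diff[OF cM iM]
        Bochner_Integration.integral_diff[OF cN iN] vM vN by linarith
qed

text \<open>
  Duality between test functions and total variation. A Hahn decomposition of the \<open>i\<close>-th component
  splits the space into \<open>Y\<close> and its complement. On each half the component has constant sign, so a
  test function bounded by \<open>B\<close> integrates to at most \<open>B\<close> times its mass there, and the two masses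
  are bounded by the variation over the partition into \<open>Y\<close> and \<open>- Y\<close>.
\<close>

lemma weak_partial_deriv_le_variation:
  fixes u \<phi> :: "real^'n \<Rightarrow> real"
  assumes "is_distr_gradient u D" and \<phi>: "\<phi> \<in> test_functions" and B: "\<And>x. \<bar>\<phi> x\<bar> \<le> B"
    and V: "variation_measure D UNIV \<le> ennreal V" "0 \<le> V"
  shows "\<bar>\<integral>x. u x * partial_deriv i \<phi> x \<partial>lebesgue\<bar> \<le> B * V"
proof -
  obtain P N where "gradient_parts u D P N"
    using assms(1) unfolding is_distr_gradient_iff by blast
  note PN = gradient_partsD[OF this]
  interpret P: finite_measure "P i" by (rule PN(1))
  interpret N: finite_measure "N i" by (rule PN(3))
  have sets: "sets (N i) = sets (P i)" by (simp add: PN)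
  from finite_unsigned_Hahn_decomposition[OF PN(1) PN(3) sets]
  obtain Y where Y0: "Y \<in> sets (P i)"
    "(\<forall>X\<in>sets (P i). X \<subseteq> Y \<longrightarrow> emeasure (N i) X \<le> emeasure (P i) X) \<and>
     (\<forall>X\<in>sets (P i). X \<inter> Y = {} \<longrightarrow> emeasure (P i) X \<le> emeasure (N i) X)"
    by (rule bexE)
  then have Y: "Y \<in> sets (P i)"
    "\<And>X. X \<in> sets (P i) \<Longrightarrow> X \<subseteq> Y \<Longrightarrow> emeasure (N i) X \<le> emeasure (P i) X"
    "\<And>X. X \<in> sets (P i) \<Longrightarrow> X \<inter> Y = {} \<Longrightarrow> emeasure (P i) X \<le> emeasure (N i) X"
    by simp_all
  have Yb: "Y \<in> sets borel" "- Y \<in> sets borel" using Y(1) PN(2) by auto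
  then have Y': "- Y \<in> sets (P i)" "- Y \<in> sets (N i)" by (simp_all add: PN)
  have m: "\<phi> \<in> borel_measurable (P i)" "\<phi> \<in> borel_measurable (N i)"
    using test_function_borel[OF \<phi>] PN(2,4) by (auto cong: measurable_cong_sets)
  have 1: "\<bar>(\<integral>x. indicator Y x * \<phi> x \<partial>P i) - (\<integral>x. indicator Y x * \<phi> x \<partial>N i)\<bar> \<le> B * (measure (P i) Y - measure (N i) Y)"
    by (rule integral_diff_le_measure_diff[OF PN(1) PN(3) sets Y(1) Y(2) m(1) B])
  have 2: "\<bar>(\<integral>x. indicator (-Y) x * \<phi> x \<partial>N i) - (\<integral>x. indicator (-Y) x * \<phi> x \<partial>P i)\<bar> \<le> B * (measure (N i) (-Y) - measure (P i) (-Y))"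
  proof (rule integral_diff_le_measure_diff[OF PN(3) PN(1) sets[symmetric] Y'(2) _ m(2) B])
    fix X assume "X \<in> sets (N i)" "X \<subseteq> - Y"
    then show "emeasure (P i) X \<le> emeasure (N i) X" using sets by (intro Y(3)) auto
  qed
  have split: "(\<integral>x. \<phi> x \<partial>M) = (\<integral>x. indicator Y x * \<phi> x \<partial>M) + (\<integral>x. indicator (-Y) x * \<phi> x \<partial>M)"
    if "finite_measure M" "sets M = sets borel" for M
  proof -
    have i: "integrable M \<phi>" by (rule integrable_test_function[OF \<phi> that])
    have "integrable M (\<lambda>x. indicator Y x * \<phi> x)" "integrable M (\<lambda>x. indicator (-Y) x * \<phi> x)"
      using integrable_mult_indicator[OF _ i, of Y] integrable_mult_indicator[OF _ i, of "-Y"] Yb that(2)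
      by auto
    then have "(\<integral>x. indicator Y x * \<phi> x + indicator (-Y) x * \<phi> x \<partial>M) =
        (\<integral>x. indicator Y x * \<phi> x \<partial>M) + (\<integral>x. indicator (-Y) x * \<phi> x \<partial>M)"
      by (rule Bochner_Integration.integral_add)
    moreover have "(\<lambda>x. indicator Y x * \<phi> x + indicator (-Y) x * \<phi> x) = \<phi>"
      by (auto simp: indicator_def fun_eq_iff)
    ultimately show ?thesis by simp
  qed
  have B0: "0 \<le> B" using B[of 0] by linarith
  have le_norm: "B * (measure (P i) Y - measure (N i) Y) \<le> B * norm (D Y)"
     "B * (measure (N i) (-Y) - measure (P i) (-Y)) \<le> B * norm (D (-Y))"
    using component_le_norm_cart[of "D Y" i] component_le_norm_cart[of "D (-Y)" i]
    by (auto intro!: mult_left_mono B0 simp: PN(5)[OF Yb(1)] PN(5)[OF Yb(2)])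
  have "\<bar>\<integral>x. u x * partial_deriv i \<phi> x \<partial>lebesgue\<bar> \<le> B * norm (D Y) + B * norm (D (-Y))"
    using 1 2 le_norm unfolding PN(6)[OF \<phi>] split[OF PN(1) PN(2)] split[OF PN(3) PN(4)] by linarith
  also have "\<dots> = B * (norm (D Y) + norm (D (-Y)))" by (simp add: distrib_left)
  also have "\<dots> \<le> B * V"
  proof (rule mult_left_mono[OF _ B0])
    define A where "A m = (if m = 0 then Y else if m = Suc 0 then -Y else {})" for m
    have "range A \<subseteq> sets borel" "disjoint_family A"
      using Yb by (auto simp: A_def disjoint_family_on_def)
    moreover have "\<Union>(range A) = UNIV"
    proof -
      have "A 0 \<union> A (Suc 0) \<subseteq> \<Union>(range A)" by blast
      then show ?thesis by (auto simp: A_def)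
    qed
    ultimately have "(\<Sum>m. ennreal (norm (D (A m)))) \<le> variation_measure D UNIV"
      unfolding variation_measure_def by (intro SUP_upper) auto
    moreover have "(\<Sum>m<2. ennreal (norm (D (A m)))) \<le> (\<Sum>m. ennreal (norm (D (A m))))"
      by (rule sum_le_suminf) auto
    moreover have "(\<Sum>m<2. ennreal (norm (D (A m)))) = ennreal (norm (D Y) + norm (D (-Y)))"
      by (simp add: A_def numeral_2_eq_2)
    ultimately have "ennreal (norm (D Y) + norm (D (-Y))) \<le> ennreal V"
      using V(1) by (metis order_trans)
    then show "norm (D Y) + norm (D (-Y)) \<le> V" using V(2) by (simp add: ennreal_le_iff flip: ennreal_plus)
  qed
  finally show ?thesis .
qed

abbreviation tvar :: "(real^'n \<Rightarrow> real) \<Rightarrow> real" where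
  "tvar u \<equiv> enn2real (total_gradient u)"

lemma weak_partial_deriv_le:
  fixes u \<phi> :: "real^'n \<Rightarrow> real"
  assumes fin: "total_gradient u < \<infinity>" and \<phi>: "\<phi> \<in> test_functions" and B: "\<And>x. \<bar>\<phi> x\<bar> \<le> B"
  shows "\<bar>\<integral>x. u x * partial_deriv i \<phi> x \<partial>lebesgue\<bar> \<le> B * tvar u"
proof (rule field_le_epsilon)
  fix e :: real assume e: "0 < e"
  have B0: "0 \<le> B" using B[of 0] by linarith
  define e' where "e' = e / (B + 1)"
  have e': "e' > 0" "B * e' \<le> e" using e B0 by (auto simp: e'_def field_simps)
  obtain D where D: "is_distr_gradient u D" "variation_measure D UNIV \<le> total_gradient u + ennreal e'"
    using total_gradient_approx[OF fin e'(1)] by blast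
  have "total_gradient u + ennreal e' = ennreal (tvar u + e')"
    using fin e'(1) by (simp add: less_top)
  with D have "\<bar>\<integral>x. u x * partial_deriv i \<phi> x \<partial>lebesgue\<bar> \<le> B * (tvar u + e')"
    using e' by (intro weak_partial_deriv_le_variation[OF D(1) \<phi> B]) auto
  with e'(2) show "\<bar>\<integral>x. u x * partial_deriv i \<phi> x \<partial>lebesgue\<bar> \<le> B * tvar u + e"
    by (simp add: distrib_left)
qed

section \<open>Translation estimate\<close>

lemma smooth_fun_has_derivatives:
  "smooth_fun \<phi> \<Longrightarrow> \<exists>\<phi>'. (\<forall>x. (\<phi> has_derivative \<phi>' x) (at x)) \<and> (\<forall>h. smooth_fun (\<lambda>x. \<phi>' x h))"
  by (erule smooth_fun.cases) auto

lemma smooth_fun_translate: "smooth_fun \<phi> \<Longrightarrow> smooth_fun (\<lambda>x. \<phi> (x - w))"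
proof (coinduction arbitrary: \<phi>)
  case smooth_fun
  from smooth_fun_has_derivatives[OF smooth_fun] obtain \<phi>'
    where "(\<forall>x. (\<phi> has_derivative \<phi>' x) (at x)) \<and> (\<forall>h. smooth_fun (\<lambda>x. \<phi>' x h))"
    by (rule exE)
  then have d: "\<And>x. (\<phi> has_derivative \<phi>' x) (at x)" "\<And>h. smooth_fun (\<lambda>x. \<phi>' x h)"
    by simp_all
  have "((\<lambda>x. \<phi> (x - w)) has_derivative \<phi>' (x - w)) (at x)" for x
  proof -
    have "((\<lambda>x. x - w) has_derivative (\<lambda>h. h)) (at x)" by (auto intro!: derivative_eq_intros)
    from diff_chain_at[OF this d(1)] show ?thesis by (simp add: o_def)
  qed
  moreover have "\<exists>\<psi>. (\<lambda>x. \<phi>' (x - w) h) = (\<lambda>x. \<psi> (x - w)) \<and> smooth_fun \<psi>" for h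
    using d(2)[of h] by (intro exI[of _ "\<lambda>x. \<phi>' x h"]) auto
  ultimately show ?case
    by (intro exI[of _ "\<lambda>x. \<phi> (x - w)"] exI[of _ "\<lambda>x. \<phi>' (x - w)"]) auto
qed

lemma test_function_translate:
  assumes "\<phi> \<in> test_functions"
  shows "(\<lambda>x. \<phi> (x - w)) \<in> test_functions"
proof -
  have "{x. \<phi> (x - w) \<noteq> 0} = (+) w ` {x. \<phi> x \<noteq> 0}"
    by (auto simp: image_iff) (metis add.commute diff_add_cancel)
  then have "closure {x. \<phi> (x - w) \<noteq> 0} = (+) w ` closure {x. \<phi> x \<noteq> 0}"
    by (simp add: closure_translation)
  moreover have "compact ((+) w ` closure {x. \<phi> x \<noteq> 0})"
    using assms by (intro compact_translation) (simp add: test_functions_def)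
  ultimately have "compact (closure {x. \<phi> (x - w) \<noteq> 0})" by simp
  then show ?thesis
    using assms unfolding test_functions_def by (simp only: mem_Collect_eq smooth_fun_translate simp_thms)
qed

lemma partial_deriv_translate:
  assumes "\<phi> \<in> test_functions"
  shows "partial_deriv i (\<lambda>x. \<phi> (x - w)) x = partial_deriv i \<phi> (x - w)"
proof -
  have "((\<lambda>x. x - w) has_derivative (\<lambda>h. h)) (at x)" by (auto intro!: derivative_eq_intros)
  from diff_chain_at[OF this test_function_has_derivative[OF assms]]
  have "((\<lambda>x. \<phi> (x - w)) has_derivative frechet_derivative \<phi> (at (x - w))) (at x)"
    by (simp add: o_def)
  from frechet_derivative_at[OF this] show ?thesis by (simp add: partial_deriv_def)
qed

lemma frechet_derivative_eq_sum_partial: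
  assumes "\<phi> \<in> test_functions"
  shows "frechet_derivative \<phi> (at x) v = (\<Sum>i\<in>UNIV. v $ i * partial_deriv i \<phi> x)"
proof -
  have lin: "linear (frechet_derivative \<phi> (at x))"
    by (rule has_derivative_linear[OF test_function_has_derivative[OF assms]])
  have "frechet_derivative \<phi> (at x) v = frechet_derivative \<phi> (at x) (\<Sum>i\<in>UNIV. v $ i *\<^sub>R axis i 1)"
    by (simp only: basis_expansion[of v, unfolded scalar_mult_eq_scaleR])
  also have "\<dots> = (\<Sum>i\<in>UNIV. v $ i *\<^sub>R frechet_derivative \<phi> (at x) (axis i 1))"
    by (simp only: linear_sum[OF lin] linear_cmul[OF lin])
  finally show ?thesis by (simp add: partial_deriv_def)
qed

text \<open>
  The estimate of the \<open>L\<^sup>1\<close> distance between \<open>u\<close> and its translate by \<open>v\<close>, in dual form. The function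
  \<open>h t = \<integral> u(x) \<eta>(x - t v) dx\<close> has a derivative that is a combination with coefficients \<open>- v\<^sub>i\<close> of
  integrals of \<open>u\<close> against partial derivatives of translates of \<open>\<eta>\<close>; each of these is at most \<open>B\<close>
  times the variation.
\<close>

lemma integral_translate_test_le:
  fixes u \<eta> :: "real^'n \<Rightarrow> real"
  assumes u: "integrable lebesgue u" and fin: "total_gradient u < \<infinity>"
    and \<eta>: "\<eta> \<in> test_functions" and B: "\<And>x. \<bar>\<eta> x\<bar> \<le> B"
  shows "\<bar>(\<integral>x. u x * \<eta> x \<partial>lebesgue) - (\<integral>x. u x * \<eta> (x - v) \<partial>lebesgue)\<bar> \<le> B * (\<Sum>i\<in>UNIV. \<bar>v $ i\<bar>) * tvar u"
proof -
  define h where "h t = (\<integral>x. u x * \<eta> (x - t *\<^sub>R v) \<partial>lebesgue)" for t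
  define d where "d x = (\<Sum>i\<in>UNIV. v $ i * partial_deriv i \<eta> x)" for x
  define h' where "h' t = - (\<integral>x. u x * d (x - t *\<^sub>R v) \<partial>lebesgue)" for t
  have \<eta>t: "(\<lambda>x. \<eta> (x - w)) \<in> test_functions" for w by (rule test_function_translate[OF \<eta>])
  have pt: "(\<lambda>x. partial_deriv i \<eta> (x - w)) \<in> test_functions" for i w
    by (rule test_function_translate[OF partial_deriv_test_function[OF \<eta>]])
  have "\<forall>i. \<exists>C. \<forall>x. \<bar>partial_deriv i \<eta> x\<bar> \<le> C"
  proof
    fix i
    obtain C where "\<And>x. \<bar>partial_deriv i \<eta> x\<bar> \<le> C"
      by (rule test_function_bounded[OF partial_deriv_test_function[OF \<eta>, of i]]) blast
    then show "\<exists>C. \<forall>x. \<bar>partial_deriv i \<eta> x\<bar> \<le> C" by blast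
  qed
  then obtain C where C: "\<And>i x. \<bar>partial_deriv i \<eta> x\<bar> \<le> C i" by metis
  define L where "L = (\<Sum>i\<in>UNIV. \<bar>v $ i\<bar> * C i)"
  have dL: "\<bar>d x\<bar> \<le> L" for x
    unfolding d_def L_def
    by (rule order_trans[OF sum_abs]) (auto intro!: sum_mono mult_left_mono C simp: abs_mult)
  have der_line: "((\<lambda>t. \<eta> (x - t *\<^sub>R v)) has_real_derivative - d (x - t *\<^sub>R v)) (at t)" for x t
  proof -
    let ?D = "frechet_derivative \<eta> (at (x - t *\<^sub>R v))"
    have "((\<lambda>t. x - t *\<^sub>R v) has_derivative (\<lambda>s. - (s *\<^sub>R v))) (at t)"
      by (auto intro!: derivative_eq_intros)
    from diff_chain_at[OF this test_function_has_derivative[OF \<eta>]]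
    have *: "((\<lambda>t. \<eta> (x - t *\<^sub>R v)) has_derivative (\<lambda>s. ?D (- (s *\<^sub>R v)))) (at t)"
      by (simp add: o_def)
    have lin: "linear ?D"
      by (rule has_derivative_linear[OF test_function_has_derivative[OF \<eta>]])
    have "(\<lambda>s. ?D (- (s *\<^sub>R v))) = (*) (- d (x - t *\<^sub>R v))"
      by (auto simp: fun_eq_iff linear_neg[OF lin] linear_cmul[OF lin] d_def
          frechet_derivative_eq_sum_partial[OF \<eta>] sum_distrib_left sum_negf[symmetric] mult_ac)
    with * show ?thesis by (simp add: has_field_derivative_def)
  qed
  have lip: "\<bar>\<eta> (x - s *\<^sub>R v) - \<eta> (x - t *\<^sub>R v)\<bar> \<le> L * \<bar>s - t\<bar>" for x s t
    using field_differentiable_bound[of UNIV "\<lambda>t. \<eta> (x - t *\<^sub>R v)" "\<lambda>t. - d (x - t *\<^sub>R v)" L s t]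
      der_line[of x] dL by simp
  have meas_u: "u \<in> borel_measurable lebesgue" using u by simp
  have meas_\<eta>: "(\<lambda>x. \<eta> (x - w)) \<in> borel_measurable lebesgue" for w
    using test_function_borel[OF \<eta>t] by (simp add: measurable_completion)
  have meas_d: "(\<lambda>x. d (x - w)) \<in> borel_measurable lebesgue" for w
    unfolding d_def using test_function_borel[OF pt] by (simp add: measurable_completion)
  have der: "(h has_real_derivative h' t) (at t)" for t
    unfolding has_field_derivative_iff
  proof (subst tendsto_at_iff_sequentially, intro allI impI)
    fix X :: "nat \<Rightarrow> real"
    assume X: "\<forall>i. X i \<in> UNIV - {t}" "X \<longlonglongrightarrow> t"
    define q where "q n x = u x * ((\<eta> (x - X n *\<^sub>R v) - \<eta> (x - t *\<^sub>R v)) / (X n - t))" for n x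
    have eq: "(h (X n) - h t) / (X n - t) = (\<integral>x. q n x \<partial>lebesgue)" for n
      unfolding h_def q_def
      by (simp add: right_diff_distrib diff_divide_distrib
          Bochner_Integration.integral_diff integrable_mult_test_function[OF u \<eta>t])
    \<comment> \<open>The difference quotients are dominated by \<open>L \<bar>u\<bar>\<close>, as the test function is Lipschitz along \<open>v\<close>.\<close>
    have "(\<lambda>n. \<integral>x. q n x \<partial>lebesgue) \<longlonglongrightarrow> (\<integral>x. u x * (- d (x - t *\<^sub>R v)) \<partial>lebesgue)"
    proof (rule integral_dominated_convergence)
      show "(\<lambda>x. u x * (- d (x - t *\<^sub>R v))) \<in> borel_measurable lebesgue"
        using meas_u meas_d by (intro borel_measurable_times borel_measurable_uminus)
      show "q n \<in> borel_measurable lebesgue" for n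
        unfolding q_def using meas_u meas_\<eta> by (intro borel_measurable_times borel_measurable_divide borel_measurable_diff borel_measurable_const)
      show "integrable lebesgue (\<lambda>x. \<bar>u x\<bar> * L)" using u by simp
      show "AE x in lebesgue. (\<lambda>n. q n x) \<longlonglongrightarrow> u x * (- d (x - t *\<^sub>R v))"
      proof (rule AE_I2)
        fix x
        have "((\<lambda>s. (\<eta> (x - s *\<^sub>R v) - \<eta> (x - t *\<^sub>R v)) / (s - t)) \<longlongrightarrow> - d (x - t *\<^sub>R v)) (at t)"
          using der_line[of x t] by (simp add: has_field_derivative_iff)
        then have "(\<lambda>n. (\<eta> (x - X n *\<^sub>R v) - \<eta> (x - t *\<^sub>R v)) / (X n - t)) \<longlonglongrightarrow> - d (x - t *\<^sub>R v)"
          using X by (subst (asm) tendsto_at_iff_sequentially) (auto simp: o_def)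
        then show "(\<lambda>n. q n x) \<longlonglongrightarrow> u x * (- d (x - t *\<^sub>R v))"
          unfolding q_def by (intro tendsto_mult tendsto_const)
      qed
      show "AE x in lebesgue. norm (q n x) \<le> \<bar>u x\<bar> * L" for n
      proof (rule AE_I2)
        fix x
        have "\<bar>X n - t\<bar> > 0" using X(1) by auto
        then have "\<bar>\<eta> (x - X n *\<^sub>R v) - \<eta> (x - t *\<^sub>R v)\<bar> / \<bar>X n - t\<bar> \<le> L"
          using lip[of x "X n" t] by (simp add: divide_le_eq)
        then show "norm (q n x) \<le> \<bar>u x\<bar> * L"
          unfolding q_def real_norm_def abs_mult abs_divide by (rule mult_left_mono) simp
      qed
    qed
    then show "((\<lambda>y. (h y - h t) / (y - t)) \<circ> X) \<longlonglongrightarrow> h' t"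
      by (simp add: o_def eq h'_def)
  qed
  have B0: "0 \<le> B" using B[of 0] by linarith
  have bound: "\<bar>h' t\<bar> \<le> B * (\<Sum>i\<in>UNIV. \<bar>v $ i\<bar>) * tvar u" for t
  proof -
    have *: "u x * d (x - t *\<^sub>R v) = (\<Sum>i\<in>UNIV. v $ i * (u x * partial_deriv i (\<lambda>x. \<eta> (x - t *\<^sub>R v)) x))" for x
      by (simp add: d_def partial_deriv_translate[OF \<eta>] sum_distrib_left mult_ac)
    have "\<bar>h' t\<bar> = \<bar>\<Sum>i\<in>UNIV. v $ i * (\<integral>x. u x * partial_deriv i (\<lambda>x. \<eta> (x - t *\<^sub>R v)) x \<partial>lebesgue)\<bar>"
      unfolding h'_def * by (subst Bochner_Integration.integral_sum)
        (auto intro!: integrable_mult_right integrable_mult_test_function u partial_deriv_test_function \<eta>t)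
    also have "\<dots> \<le> (\<Sum>i\<in>UNIV. \<bar>v $ i\<bar> * (B * tvar u))"
      by (rule order_trans[OF sum_abs])
        (auto intro!: sum_mono mult_left_mono weak_partial_deriv_le[OF fin \<eta>t] B simp: abs_mult)
    also have "\<dots> = B * (\<Sum>i\<in>UNIV. \<bar>v $ i\<bar>) * tvar u"
      by (simp add: sum_distrib_left sum_distrib_right mult_ac)
    finally show ?thesis .
  qed
  have "norm (h 0 - h 1) \<le> B * (\<Sum>i\<in>UNIV. \<bar>v $ i\<bar>) * tvar u * norm (0 - 1 :: real)"
    using der bound by (intro field_differentiable_bound[of UNIV h h']) auto
  then show ?thesis by (simp add: h_def)
qed

section \<open>Smooth approximations of box indicators\<close>

text \<open>
  The derivative of \<open>t\<^bsup>-k\<^esup> exp (-1/t)\<close> is a combination of functions of the same form, and all of them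
  extend by 0 to \<open>t \<le> 0\<close>. Smoothness of polynomials in such functions therefore needs no formula for
  higher derivatives.
\<close>

definition flat :: "nat \<Rightarrow> real \<Rightarrow> real" where
  "flat k t = (if t > 0 then (1 / t) ^ k * exp (- (1 / t)) else 0)"

lemma flat_tendsto_0: "(flat k \<longlongrightarrow> 0) (at_right 0)"
proof -
  have "((\<lambda>x::real. x ^ k / exp x) \<longlongrightarrow> 0) at_top" by (rule tendsto_power_div_exp_0)
  from filterlim_compose[OF this filterlim_inverse_at_top_right]
  have "((\<lambda>t::real. inverse t ^ k / exp (inverse t)) \<longlongrightarrow> 0) (at_right 0)" .
  then show ?thesis
  proof (rule Lim_transform_eventually)
    show "\<forall>\<^sub>F t::real in at_right 0. inverse t ^ k / exp (inverse t) = flat k t"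
      by (simp add: eventually_at_filter flat_def exp_minus field_simps)
  qed
qed

lemma DERIV_flat: "(flat k has_real_derivative flat (k + 2) t - real k * flat (k + 1) t) (at t)"
proof -
  consider "t > 0" | "t < 0" | "t = 0" by linarith
  then show ?thesis
  proof cases
    case 1
    define y where "y = 1 / t"
    have inv: "((\<lambda>t. 1 / t) has_real_derivative - (y * y)) (at t)"
      using 1 by (auto intro!: derivative_eq_intros simp: y_def)
    have "((\<lambda>t. (1 / t) ^ k * exp (- (1 / t))) has_real_derivative
        real k * (y ^ (k - Suc 0) * - (y * y)) * exp (- y) + exp (- y) * (y * y) * y ^ k) (at t)"
      using DERIV_mult[OF DERIV_power[OF inv, of k] DERIV_chain2[OF DERIV_exp DERIV_minus[OF inv]]]
      by (simp add: y_def mult_ac)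
    moreover have "real k * (y ^ (k - Suc 0) * - (y * y)) * exp (- y) + exp (- y) * (y * y) * y ^ k
        = flat (k + 2) t - real k * flat (k + 1) t"
      using 1 by (cases k) (simp_all add: flat_def y_def[symmetric] algebra_simps)
    ultimately have "((\<lambda>t. (1 / t) ^ k * exp (- (1 / t))) has_real_derivative flat (k + 2) t - real k * flat (k + 1) t) (at t)"
      by (simp only:)
    then show ?thesis
      by (rule has_field_derivative_transform_within_open[of _ _ _ "{0<..}"]) (use 1 in \<open>auto simp: flat_def\<close>)
  next
    case 2
    have "((\<lambda>t::real. 0) has_real_derivative flat (k + 2) t - real k * flat (k + 1) t) (at t)"
      using 2 by (simp add: flat_def)
    then show ?thesis
      by (rule has_field_derivative_transform_within_open[of _ _ _ "{..<0}"]) (use 2 in \<open>auto simp: flat_def\<close>)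
  next
    case 3
    have "((\<lambda>y. (flat k y - flat k 0) / (y - 0)) \<longlongrightarrow> 0) (at 0)"
      unfolding filterlim_at_split
    proof
      show "((\<lambda>y. (flat k y - flat k 0) / (y - 0)) \<longlongrightarrow> 0) (at_left 0)"
        by (rule tendsto_eventually) (simp add: eventually_at_filter flat_def)
      show "((\<lambda>y. (flat k y - flat k 0) / (y - 0)) \<longlongrightarrow> 0) (at_right 0)"
        by (rule Lim_transform_eventually[OF flat_tendsto_0[of "Suc k"]])
           (simp add: eventually_at_filter flat_def field_simps)
    qed
    then show ?thesis
      using 3 by (simp add: has_field_derivative_iff flat_def)
  qed
qed

lemma flat_0_bounds: "0 \<le> flat 0 t" "flat 0 t \<le> 1"
  by (auto simp: flat_def)

lemma flat_0_scaled_tendsto: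
  "(\<lambda>m. flat 0 (real m * t)) \<longlonglongrightarrow> (if t > 0 then 1 else 0)"
proof (cases "t > 0")
  case True
  have "(\<lambda>m. exp (- (1 / t * (1 / real m)))) \<longlonglongrightarrow> exp (- (1 / t * 0))"
    by (intro tendsto_intros lim_1_over_n)
  then have "(\<lambda>m. exp (- (1 / t * (1 / real m)))) \<longlonglongrightarrow> 1" by simp
  then have "(\<lambda>m. flat 0 (real m * t)) \<longlonglongrightarrow> 1"
  proof (rule Lim_transform_eventually)
    show "\<forall>\<^sub>F m in sequentially. exp (- (1 / t * (1 / real m))) = flat 0 (real m * t)"
      by (rule eventually_mono[OF eventually_gt_at_top[of 0]]) (use True in \<open>auto simp: flat_def mult.commute\<close>)
  qed
  with True show ?thesis by simp
next
  case False
  then have "flat 0 (real m * t) = 0" for m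
    by (auto simp: flat_def zero_less_mult_iff)
  with False show ?thesis by simp
qed

text \<open>
  A class of functions that is closed under directional derivatives. Closure is exactly the
  invariant which the coinduction for \<open>smooth_fun\<close> asks for.
\<close>

inductive_set flat_polynomials :: "(real^'n \<Rightarrow> real) set" where
  const: "(\<lambda>x. c) \<in> flat_polynomials"
| flat: "(\<lambda>x. flat k (c * (x $ i - a))) \<in> flat_polynomials"
| add: "f \<in> flat_polynomials \<Longrightarrow> g \<in> flat_polynomials \<Longrightarrow> (\<lambda>x. f x + g x) \<in> flat_polynomials"
| mult: "f \<in> flat_polynomials \<Longrightarrow> g \<in> flat_polynomials \<Longrightarrow> (\<lambda>x. f x * g x) \<in> flat_polynomials"

lemma flat_polynomials_derivative:
  fixes f :: "real^'n \<Rightarrow> real"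
  shows "f \<in> flat_polynomials \<Longrightarrow>
    \<exists>f'. (\<forall>x. (f has_derivative f' x) (at x)) \<and> (\<forall>h. (\<lambda>x. f' x h) \<in> flat_polynomials)"
proof (induction rule: flat_polynomials.induct)
  case (const c)
  show ?case
    by (intro exI[of _ "\<lambda>x h. 0"]) (auto intro: flat_polynomials.const)
next
  case (flat k c i a)
  define d where "d x = flat (k + 2) (c * (x $ i - a)) + - real k * flat (k + 1) (c * (x $ i - a))" for x :: "real^'n"
  have "((\<lambda>x. flat k (c * (x $ i - a))) has_derivative (\<lambda>h. d x * (c * h $ i))) (at x)" for x
  proof -
    have 1: "((\<lambda>x::real^'n. c * (x $ i - a)) has_derivative (\<lambda>h. c * h $ i)) (at x)"
      by (auto intro!: derivative_eq_intros bounded_linear_imp_has_derivative)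
    have 2: "(flat k has_derivative (*) (d x)) (at (c * (x $ i - a)))"
      using DERIV_flat[of k "c * (x $ i - a)"] by (simp add: has_field_derivative_def d_def)
    from diff_chain_at[OF 1 2] show ?thesis by (simp add: o_def)
  qed
  moreover have "(\<lambda>x. d x * (c * h $ i)) \<in> flat_polynomials" for h
    unfolding d_def by (intro flat_polynomials.intros)
  ultimately show ?case
    by (intro exI[of _ "\<lambda>x h. d x * (c * h $ i)"]) simp
next
  case (add f g)
  then obtain f' g' where d: "\<forall>x. (f has_derivative f' x) (at x)" "\<forall>h. (\<lambda>x. f' x h) \<in> flat_polynomials"
    "\<forall>x. (g has_derivative g' x) (at x)" "\<forall>h. (\<lambda>x. g' x h) \<in> flat_polynomials"
    by (elim exE conjE)
  show ?case
    by (intro exI[of _ "\<lambda>x h. f' x h + g' x h"])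
       (use d in \<open>auto intro!: has_derivative_add flat_polynomials.add\<close>)
next
  case (mult f g)
  then obtain f' g' where d: "\<forall>x. (f has_derivative f' x) (at x)" "\<forall>h. (\<lambda>x. f' x h) \<in> flat_polynomials"
    "\<forall>x. (g has_derivative g' x) (at x)" "\<forall>h. (\<lambda>x. g' x h) \<in> flat_polynomials"
    by (elim exE conjE)
  show ?case
    by (intro exI[of _ "\<lambda>x h. f x * g' x h + f' x h * g x"])
       (use d mult.hyps in \<open>auto intro!: has_derivative_mult flat_polynomials.add flat_polynomials.mult\<close>)
qed

lemma smooth_flat_polynomial: "f \<in> flat_polynomials \<Longrightarrow> smooth_fun f"
proof (coinduction arbitrary: f)
  case smooth_fun
  from flat_polynomials_derivative[OF this] obtain f'
    where "(\<forall>x. (f has_derivative f' x) (at x)) \<and> (\<forall>h. (\<lambda>x. f' x h) \<in> flat_polynomials)"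
    by (rule exE)
  then show ?case
    by (intro exI[of _ f] exI[of _ f']) auto
qed

lemma flat_polynomials_prod:
  "finite I \<Longrightarrow> (\<And>i. i \<in> I \<Longrightarrow> f i \<in> flat_polynomials) \<Longrightarrow> (\<lambda>x. \<Prod>i\<in>I. f i x) \<in> flat_polynomials"
  by (induction rule: finite_induct) (auto intro: flat_polynomials.intros)

lemma flat_polynomials_sum:
  "finite I \<Longrightarrow> (\<And>i. i \<in> I \<Longrightarrow> f i \<in> flat_polynomials) \<Longrightarrow> (\<lambda>x. \<Sum>i\<in>I. f i x) \<in> flat_polynomials"
  by (induction rule: finite_induct) (auto intro: flat_polynomials.intros)

text \<open>
  Since \<open>exp (-1/(m t))\<close> tends to 1 for every \<open>t > 0\<close>, these bumps approximate the indicator of the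
  open box from below, with supports inside the closed box.
\<close>

definition box_bump :: "nat \<Rightarrow> real^'n \<Rightarrow> real^'n \<Rightarrow> real^'n \<Rightarrow> real" where
  "box_bump m a b x = (\<Prod>i\<in>UNIV. flat 0 (real m * (x $ i - a $ i)) * flat 0 (real m * (b $ i - x $ i)))"

lemma box_bump_flat_polynomial: "box_bump m a b \<in> flat_polynomials"
proof -
  have "flat 0 (real m * (b $ i - x $ i)) = flat 0 ((- real m) * (x $ i - b $ i))" for x i
    by (simp add: algebra_simps)
  then show ?thesis
    unfolding box_bump_def[abs_def]
    by (intro flat_polynomials_prod flat_polynomials.mult) (simp_all only: flat_polynomials.flat finite_class.finite)
qed

lemma box_bump_bounds: "0 \<le> box_bump m a b x" "box_bump m a b x \<le> 1"
  unfolding box_bump_def using flat_0_bounds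
  by (auto intro!: prod_nonneg prod_le_1 mult_le_one)

lemma box_bump_eq_0: "x \<notin> box a b \<Longrightarrow> box_bump m a b x = 0"
proof -
  assume "x \<notin> box a b"
  then obtain i where i: "\<not> a $ i < x $ i \<or> \<not> x $ i < b $ i" by (auto simp: mem_box_cart)
  then have "flat 0 (real m * (x $ i - a $ i)) * flat 0 (real m * (b $ i - x $ i)) = 0"
    by (auto simp: flat_def zero_less_mult_iff)
  then show ?thesis unfolding box_bump_def by (intro prod_zero) auto
qed

lemma box_bump_tendsto: "(\<lambda>m. box_bump m a b x) \<longlonglongrightarrow> indicat_real (box a b) x"
proof -
  have "(\<lambda>m. box_bump m a b x) \<longlonglongrightarrow>
      (\<Prod>i\<in>UNIV. (if x $ i - a $ i > 0 then 1 else 0) * (if b $ i - x $ i > 0 then 1 else 0))"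
    unfolding box_bump_def by (intro tendsto_prod tendsto_mult flat_0_scaled_tendsto)
  also have "(\<Prod>i\<in>UNIV. (if x $ i - a $ i > 0 then 1 else 0) * (if b $ i - x $ i > 0 then 1 else 0)) = indicat_real (box a b) x"
  proof (cases "x \<in> box a b")
    case True
    then show ?thesis by (simp add: mem_box_cart)
  next
    case False
    then obtain i where i: "\<not> a $ i < x $ i \<or> \<not> x $ i < b $ i" by (auto simp: mem_box_cart)
    then have "(\<Prod>i\<in>UNIV. (if x $ i - a $ i > 0 then 1 else 0) * (if b $ i - x $ i > 0 then 1 else 0)) = (0::real)"
      by (intro prod_zero) (auto intro!: bexI[of _ i])
    with False show ?thesis by simp
  qed
  finally show ?thesis .
qed

lemma AE_box_eq_cbox:
  fixes a b :: "real^'n"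
  shows "AE x in lebesgue. indicat_real (box a b) x = indicat_real (cbox a b) x"
proof -
  have "cbox a b - box a b \<in> null_sets lebesgue"
    using negligible_frontier_interval[of a b] by (simp add: negligible_iff_null_sets)
  from AE_not_in[OF this] show ?thesis
    by eventually_elim (use box_subset_cbox[of a b] in \<open>auto simp: indicator_def\<close>)
qed

definition box_integral :: "(real^'n \<Rightarrow> real) \<Rightarrow> (real^'n) set \<Rightarrow> real" where
  "box_integral u S = (\<integral>x. u x * indicat_real S x \<partial>lebesgue)"

text \<open>
  The step function with value \<open>c j\<close> on the \<open>j\<close>-th box is a pointwise limit of combinations of bumps.
  As the boxes do not overlap, at most one bump is nonzero at each point, so these test functions
  are bounded by \<open>M\<close> however many boxes there are.
\<close>

lemma box_integral_translate_sum_le: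
  fixes u :: "real^'n \<Rightarrow> real" and a b :: "'j \<Rightarrow> real^'n"
  assumes u: "integrable lebesgue u" and fin: "total_gradient u < \<infinity>"
    and J: "finite J" and disj: "\<And>j k. j \<in> J \<Longrightarrow> k \<in> J \<Longrightarrow> j \<noteq> k \<Longrightarrow> box (a j) (b j) \<inter> box (a k) (b k) = {}"
    and c: "\<And>j. j \<in> J \<Longrightarrow> \<bar>c j\<bar> \<le> M" and M: "0 \<le> M"
  shows "\<bar>\<Sum>j\<in>J. c j * (box_integral u (cbox (a j) (b j)) - box_integral u (cbox (a j + v) (b j + v)))\<bar>
           \<le> M * (\<Sum>i\<in>UNIV. \<bar>v $ i\<bar>) * tvar u"
proof -
  define \<eta> where "\<eta> m x = (\<Sum>j\<in>J. c j * box_bump m (a j) (b j) x)" for m x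
  define g where "g x = (\<Sum>j\<in>J. c j * indicat_real (box (a j) (b j)) x)" for x
  have lim: "(\<lambda>m. \<eta> m x) \<longlonglongrightarrow> g x" for x
    unfolding \<eta>_def g_def by (intro tendsto_sum tendsto_mult tendsto_const box_bump_tendsto)
  have \<eta>_bound: "\<bar>\<eta> m x\<bar> \<le> M" for m x
  proof (cases "\<exists>j\<in>J. x \<in> box (a j) (b j)")
    case True
    then obtain j where j: "j \<in> J" "x \<in> box (a j) (b j)" by blast
    have "(\<Sum>k\<in>J. c k * box_bump m (a k) (b k) x) = (\<Sum>k\<in>{j}. c k * box_bump m (a k) (b k) x)"
    proof (rule sum.mono_neutral_right[OF J])
      show "\<forall>k\<in>J - {j}. c k * box_bump m (a k) (b k) x = 0"
        using j disj box_bump_eq_0 by fastforce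
    qed (use j in auto)
    then have "\<bar>\<eta> m x\<bar> = \<bar>c j\<bar> * box_bump m (a j) (b j) x"
      by (simp add: \<eta>_def abs_mult box_bump_bounds)
    also have "\<dots> \<le> M * 1"
      using c[OF j(1)] M by (intro mult_mono box_bump_bounds) auto
    finally show ?thesis by simp
  next
    case False
    then have "\<eta> m x = 0" unfolding \<eta>_def by (intro sum.neutral) (auto simp: box_bump_eq_0)
    with M show ?thesis by simp
  qed
  have test: "\<eta> m \<in> test_functions" for m
  proof -
    have "\<eta> m \<in> flat_polynomials"
      unfolding \<eta>_def[abs_def]
      by (intro flat_polynomials_sum J flat_polynomials.mult flat_polynomials.const)
         (rule box_bump_flat_polynomial)
    moreover have "{x. \<eta> m x \<noteq> 0} \<subseteq> (\<Union>j\<in>J. cbox (a j) (b j))"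
    proof
      fix x assume "x \<in> {x. \<eta> m x \<noteq> 0}"
      then obtain j where "j \<in> J" "c j * box_bump m (a j) (b j) x \<noteq> 0"
        unfolding \<eta>_def by (auto elim: sum.not_neutral_contains_not_neutral)
      then show "x \<in> (\<Union>j\<in>J. cbox (a j) (b j))"
        using box_bump_eq_0[of x "a j" "b j" m] box_subset_cbox[of "a j" "b j"] by auto
    qed
    then have "bounded {x. \<eta> m x \<noteq> 0}"
      by (rule bounded_subset[rotated]) (use J in auto)
    ultimately show ?thesis
      by (simp add: test_functions_def smooth_flat_polynomial)
  qed
  have meas_u: "u \<in> borel_measurable lebesgue" using u by simp
  have meas_\<eta>: "(\<lambda>x. \<eta> m (x - w)) \<in> borel_measurable lebesgue" for m w
    using test_function_borel[OF test_function_translate[OF test]] by (simp add: measurable_completion)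
  have g_translate: "g (x - w) = (\<Sum>j\<in>J. c j * indicat_real (box (a j + w) (b j + w)) x)" for x w
    unfolding g_def by (intro sum.cong refl arg_cong2[where f="(*)"]) (auto simp: indicator_def mem_box_cart algebra_simps)
  have meas_g: "(\<lambda>x. g (x - w)) \<in> borel_measurable lebesgue" for w
    unfolding g_translate by (intro borel_measurable_sum borel_measurable_times borel_measurable_const borel_measurable_indicator) auto
  have conv: "(\<lambda>m. \<integral>x. u x * \<eta> m (x - w) \<partial>lebesgue) \<longlonglongrightarrow> (\<integral>x. u x * g (x - w) \<partial>lebesgue)" for w
  proof (rule integral_dominated_convergence)
    show "(\<lambda>x. u x * g (x - w)) \<in> borel_measurable lebesgue"
      by (intro borel_measurable_times meas_u meas_g)
    show "(\<lambda>x. u x * \<eta> m (x - w)) \<in> borel_measurable lebesgue" for m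
      by (intro borel_measurable_times meas_u meas_\<eta>)
    show "integrable lebesgue (\<lambda>x. \<bar>u x\<bar> * M)" using u by simp
    show "AE x in lebesgue. (\<lambda>m. u x * \<eta> m (x - w)) \<longlonglongrightarrow> u x * g (x - w)"
      by (intro AE_I2 tendsto_mult tendsto_const lim)
    show "AE x in lebesgue. norm (u x * \<eta> m (x - w)) \<le> \<bar>u x\<bar> * M" for m
      by (intro AE_I2) (simp add: abs_mult mult_left_mono \<eta>_bound)
  qed
  have val: "(\<integral>x. u x * g (x - w) \<partial>lebesgue) = (\<Sum>j\<in>J. c j * box_integral u (cbox (a j + w) (b j + w)))" for w
  proof -
    have ub: "integrable lebesgue (\<lambda>x. u x * indicat_real (box p q) x)" for p q
      by (rule integrable_mult_bounded_borel[OF u, of _ 1]) (auto simp: indicator_def)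
    have "box_integral u (cbox p q) = (\<integral>x. u x * indicat_real (box p q) x \<partial>lebesgue)" for p q :: "real^'n"
      unfolding box_integral_def
    proof (rule integral_cong_AE)
      show "AE x in lebesgue. u x * indicat_real (cbox p q) x = u x * indicat_real (box p q) x"
        using AE_box_eq_cbox[of p q] by eventually_elim simp
    qed (auto intro!: borel_measurable_times meas_u borel_measurable_indicator)
    then show ?thesis
      unfolding g_translate sum_distrib_left
      using ub by (subst Bochner_Integration.integral_sum) (auto simp: mult.left_commute intro!: integrable_mult_right)
  qed
  have "(\<lambda>m. \<bar>(\<integral>x. u x * \<eta> m x \<partial>lebesgue) - (\<integral>x. u x * \<eta> m (x - v) \<partial>lebesgue)\<bar>) \<longlonglongrightarrow>
      \<bar>(\<integral>x. u x * g x \<partial>lebesgue) - (\<integral>x. u x * g (x - v) \<partial>lebesgue)\<bar>"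
    using conv[of 0] conv[of v] by (intro tendsto_rabs tendsto_diff) simp_all
  moreover have "\<bar>(\<integral>x. u x * \<eta> m x \<partial>lebesgue) - (\<integral>x. u x * \<eta> m (x - v) \<partial>lebesgue)\<bar> \<le> M * (\<Sum>i\<in>UNIV. \<bar>v $ i\<bar>) * tvar u" for m
    by (rule integral_translate_test_le[OF u fin test \<eta>_bound])
  ultimately have "\<bar>(\<integral>x. u x * g x \<partial>lebesgue) - (\<integral>x. u x * g (x - v) \<partial>lebesgue)\<bar> \<le> M * (\<Sum>i\<in>UNIV. \<bar>v $ i\<bar>) * tvar u"
    by (intro LIMSEQ_le_const2) auto
  also have "(\<integral>x. u x * g x \<partial>lebesgue) - (\<integral>x. u x * g (x - v) \<partial>lebesgue) =
     (\<Sum>j\<in>J. c j * (box_integral u (cbox (a j) (b j)) - box_integral u (cbox (a j + v) (b j + v))))"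
    using val[of 0] val[of v] by (simp add: right_diff_distrib sum_subtractf)
  finally show ?thesis .
qed

section \<open>Increments\<close>

text \<open>
  The vertex of the box that belongs to \<open>S\<close> takes the lower end in the directions of \<open>S\<close>. In contrast
  to \<open>rect_increment\<close>, which recovers the end points from the set, this takes them as arguments, so
  that they can be moved one at a time.
\<close>

definition box_increment :: "(real^'n \<Rightarrow> real) \<Rightarrow> real^'n \<Rightarrow> real^'n \<Rightarrow> real" where
  "box_increment f a b = (\<Sum>S\<in>UNIV. (-1) ^ card S * f (\<chi> i. if i \<in> S then a $ i else b $ i))"

lemma rect_increment_cbox:
  fixes a b :: "real^'n"
  assumes "\<And>i. a $ i < b $ i"
  shows "rect_increment f (cbox a b) = box_increment f a b"
proof -
  have "\<forall>k\<in>Basis. a \<bullet> k \<le> b \<bullet> k"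
    using assms by (auto simp: Basis_vec_def inner_axis intro: less_imp_le)
  then have "interval_lowerbound (cbox a b) = a" "interval_upperbound (cbox a b) = b"
    by (auto intro: interval_lowerbound interval_upperbound)
  then have "rect_increment f (cbox a b) =
      (\<Sum>c\<in>{c. \<forall>i. c $ i \<in> {a $ i, b $ i}}. (-1) ^ card {i. c $ i = a $ i} * f c)"
    by (simp add: rect_increment_def)
  also have "\<dots> = box_increment f a b"
    unfolding box_increment_def
  proof (rule sum.reindex_bij_witness[where i = "\<lambda>S. \<chi> i. if i \<in> S then a $ i else b $ i" and j = "\<lambda>c. {i. c $ i = a $ i}"])
    fix S :: "'n set"
    show "{i. (\<chi> i. if i \<in> S then a $ i else b $ i) $ i = a $ i} = S"
      using assms by (auto split: if_splits) (metis less_irrefl)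
  next
    fix c assume "c \<in> {c. \<forall>i. c $ i \<in> {a $ i, b $ i}}"
    then have c: "\<And>i. c $ i = a $ i \<or> c $ i = b $ i" by auto
    show eq: "(\<chi> i. if i \<in> {i. c $ i = a $ i} then a $ i else b $ i) = c"
      using c by (auto simp: vec_eq_iff) (metis c)
    show "(-1) ^ card {i. c $ i = a $ i} * f (\<chi> i. if i \<in> {i. c $ i = a $ i} then a $ i else b $ i) =
        (-1) ^ card {i. c $ i = a $ i} * f c"
      unfolding eq ..
  qed auto
  finally show ?thesis .
qed

text \<open>
  The alternating sum over the vertices in the hyperplane \<open>x\<^sub>i = t\<close>. Increments are differences of
  two such sums, so that cutting a box by a hyperplane inserts a term that cancels.
\<close>

definition face_sum :: "(real^'n \<Rightarrow> real) \<Rightarrow> real^'n \<Rightarrow> real^'n \<Rightarrow> 'n \<Rightarrow> real \<Rightarrow> real" where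
  "face_sum f a b i t =
     (\<Sum>S\<in>Pow (- {i}). (-1) ^ card S * f (\<chi> j. if j = i then t else if j \<in> S then a $ j else b $ j))"

lemma box_increment_eq_face_sum:
  "box_increment f a b = face_sum f a b i (b $ i) - face_sum f a b i (a $ i)"
proof -
  let ?h = "\<lambda>S. (-1) ^ card S * f (\<chi> i. if i \<in> S then a $ i else b $ i)"
  have U: "UNIV = Pow (- {i}) \<union> insert i ` Pow (- {i})"
  proof -
    have "S \<in> insert i ` Pow (- {i})" if "i \<in> S" for S
      using that by (intro image_eqI[of _ _ "S - {i}"]) auto
    then show ?thesis by auto
  qed
  have "box_increment f a b = (\<Sum>S\<in>Pow (- {i}) \<union> insert i ` Pow (- {i}). ?h S)"
    unfolding box_increment_def U[symmetric] ..
  also have "\<dots> = (\<Sum>S\<in>Pow (- {i}). ?h S) + (\<Sum>S\<in>insert i ` Pow (- {i}). ?h S)"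
    by (rule sum.union_disjoint) auto
  also have "(\<Sum>S\<in>Pow (- {i}). ?h S) = face_sum f a b i (b $ i)"
    unfolding face_sum_def
    by (intro sum.cong refl arg_cong2[where f="(*)"] arg_cong[where f=f]) (auto simp: vec_eq_iff)
  also have "(\<Sum>S\<in>insert i ` Pow (- {i}). ?h S) = (\<Sum>S\<in>Pow (- {i}). ?h (insert i S))"
  proof (subst sum.reindex)
    show "inj_on (insert i) (Pow (- {i}))"
      by (rule inj_onI) (metis Compl_iff Diff_insert_absorb PowD singletonI subsetD)
  qed simp
  also have "\<dots> = (\<Sum>S\<in>Pow (- {i}). - ((-1) ^ card S * f (\<chi> j. if j = i then a $ i else if j \<in> S then a $ j else b $ j)))"
  proof (rule sum.cong[OF refl])
    fix S assume "S \<in> Pow (- {i})"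
    then have "card (insert i S) = Suc (card S)" by (subst card_insert_disjoint) auto
    moreover have "(\<chi> k. if k \<in> insert i S then a $ k else b $ k) = (\<chi> j. if j = i then a $ i else if j \<in> S then a $ j else b $ j)"
      by (auto simp: vec_eq_iff)
    ultimately show "?h (insert i S) = - ((-1) ^ card S * f (\<chi> j. if j = i then a $ i else if j \<in> S then a $ j else b $ j))"
      by simp
  qed
  also have "\<dots> = - face_sum f a b i (a $ i)"
    by (simp add: face_sum_def sum_negf)
  finally show ?thesis by simp
qed

lemma face_sum_vec_upd: "face_sum f a (vec_upd b i c) i t = face_sum f a b i t"
  "face_sum f (vec_upd a i c) b i t = face_sum f a b i t"
  unfolding face_sum_def
  by (intro sum.cong refl arg_cong2[where f="(*)"] arg_cong[where f=f]; auto simp: vec_eq_iff)+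

lemma box_increment_split:
  "box_increment f a b = box_increment f a (vec_upd b i c) + box_increment f (vec_upd a i c) b"
  by (simp add: box_increment_eq_face_sum[of f a b i] box_increment_eq_face_sum[of f a _ i]
      box_increment_eq_face_sum[of f _ b i] face_sum_vec_upd)

text \<open>
  Operative functions vanish on boxes without interior, but for a degenerate box the vertices
  coincide and \<open>rect_increment\<close> need not vanish.
\<close>

definition interior_increment :: "(real^'n \<Rightarrow> real) \<Rightarrow> (real^'n) set \<Rightarrow> real" where
  "interior_increment f K = (if interior K = {} then 0 else rect_increment f K)"

lemma box_empty_cart: "box a b = {} \<longleftrightarrow> (\<exists>i. b $ i \<le> a $ i)" for a b :: "real^'n"
  by (rule interval_eq_empty_cart)

lemma interior_increment_cbox:
  fixes a b :: "real^'n"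
  shows "interior_increment f (cbox a b) = (if \<forall>i. a $ i < b $ i then box_increment f a b else 0)"
proof (cases "\<forall>i. a $ i < b $ i")
  case True
  then have "box a b \<noteq> {}" by (auto simp: box_empty_cart not_le)
  with True show ?thesis by (simp add: interior_increment_def rect_increment_cbox)
next
  case False
  then have "box a b = {}" by (auto simp: box_empty_cart not_less)
  then show ?thesis unfolding if_not_P[OF False] by (simp add: interior_increment_def)
qed

lemma operative_interior_increment:
  fixes f :: "real^'n \<Rightarrow> real"
  shows "operative plus 0 (interior_increment f)"
proof
  fix a b :: "real^'n"
  assume "box a b = {}"
  then show "interior_increment f (cbox a b) = 0" by (simp add: interior_increment_def)
next
  fix a b :: "real^'n" and c :: real and k :: "real^'n"
  assume "k \<in> Basis"
  then obtain i where k: "k = axis i 1" by (auto simp: Basis_vec_def)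
  have L: "cbox a b \<inter> {x. x \<bullet> k \<le> c} = cbox a (vec_upd b i (min (b $ i) c))"
    by (auto simp: k inner_axis mem_box_cart split: if_splits)
  have R: "cbox a b \<inter> {x. c \<le> x \<bullet> k} = cbox (vec_upd a i (max (a $ i) c)) b"
    by (auto simp: k inner_axis mem_box_cart split: if_splits)
  show "interior_increment f (cbox a b) =
      interior_increment f (cbox a b \<inter> {x. x \<bullet> k \<le> c}) + interior_increment f (cbox a b \<inter> {x. c \<le> x \<bullet> k})"
  proof (cases "\<forall>i. a $ i < b $ i")
    case False
    then obtain j where j: "\<not> a $ j < b $ j" by auto
    have "\<not> (\<forall>l. a $ l < vec_upd b i (min (b $ i) c) $ l)" "\<not> (\<forall>l. vec_upd a i (max (a $ i) c) $ l < b $ l)"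
      using j by (auto intro!: exI[of _ j])
    with False show ?thesis unfolding L R by (simp only: interior_increment_cbox if_False)
  next
    case True
    consider "c \<le> a $ i" | "a $ i < c" "c < b $ i" | "b $ i \<le> c" by linarith
    then show ?thesis
    proof cases
      case 1
      then have "\<not> (\<forall>l. a $ l < vec_upd b i (min (b $ i) c) $ l)" by (auto intro!: exI[of _ i])
      moreover have "vec_upd a i (max (a $ i) c) = a" using 1 by (simp add: vec_eq_iff)
      ultimately show ?thesis unfolding L R by (simp only: interior_increment_cbox if_False)
    next
      case 2
      have m: "min (b $ i) c = c" "max (a $ i) c = c" using 2 by auto
      have l: "\<forall>l. a $ l < vec_upd b i c $ l" "\<forall>l. vec_upd a i c $ l < b $ l"
        using True 2 by auto
      have e: "interior_increment f (cbox p q) = box_increment f p q" if "\<forall>l. p $ l < q $ l" for p q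
        using that by (simp add: interior_increment_cbox)
      show ?thesis
        unfolding L R m e[OF True] e[OF l(1)] e[OF l(2)] by (rule box_increment_split)
    next
      case 3
      then have "\<not> (\<forall>l. vec_upd a i (max (a $ i) c) $ l < b $ l)" by (auto intro!: exI[of _ i])
      moreover have "vec_upd b i (min (b $ i) c) = b" using 3 by (simp add: vec_eq_iff)
      ultimately show ?thesis unfolding L R by (simp only: interior_increment_cbox if_False)
    qed
  qed
qed

lemma rect_increment_division:
  assumes "p division_of cbox a b" "interior (cbox a b) \<noteq> {}" "\<And>K. K \<in> p \<Longrightarrow> interior K \<noteq> {}"
  shows "(\<Sum>K\<in>p. rect_increment f K) = rect_increment f (cbox a b)"
proof -
  interpret operative plus 0 "interior_increment f" by (rule operative_interior_increment)
  have "sum (interior_increment f) p = interior_increment f (cbox a b)"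
    using division[OF assms(1)] by (simp add: sum_def)
  moreover have "sum (interior_increment f) p = (\<Sum>K\<in>p. rect_increment f K)"
    using assms(3) by (intro sum.cong) (auto simp: interior_increment_def)
  ultimately show ?thesis using assms(2) by (simp add: interior_increment_def)
qed

section \<open>Dyadic cubes\<close>

definition dyadic_index :: "nat \<Rightarrow> ('n::finite \<Rightarrow> nat) set" where
  "dyadic_index n = {j. \<forall>i. j i < 2 ^ n}"

definition grid_box :: "nat \<Rightarrow> ('n::finite \<Rightarrow> nat) \<Rightarrow> ('n \<Rightarrow> nat) \<Rightarrow> (real^'n) set" where
  "grid_box n p q = cbox (\<chi> i. real (p i) / 2 ^ n) (\<chi> i. real (q i) / 2 ^ n)"

definition dyadic_cube :: "nat \<Rightarrow> ('n::finite \<Rightarrow> nat) \<Rightarrow> (real^'n) set" where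
  "dyadic_cube n j = grid_box n j (\<lambda>i. Suc (j i))"

lemma dyadic_cube_eq: "dyadic_cube n j = cbox (\<chi> i. real (j i) / 2 ^ n) (\<chi> i. (real (j i) + 1) / 2 ^ n)"
  by (simp add: dyadic_cube_def grid_box_def add.commute)

lemma dyadic_cubes_eq: "dyadic_cubes n = dyadic_cube n ` dyadic_index n"
  by (auto simp: dyadic_cubes_def dyadic_index_def dyadic_cube_eq)

lemma finite_index_box: "finite {j::'n::finite \<Rightarrow> nat. \<forall>i. p i \<le> j i \<and> j i < q i}"
proof -
  have "{j::'n \<Rightarrow> nat. \<forall>i. p i \<le> j i \<and> j i < q i} = Pi\<^sub>E UNIV (\<lambda>i. {p i..<q i})"
    by (auto simp: PiE_def Pi_def)
  then show ?thesis by (simp add: finite_PiE)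
qed

lemma finite_dyadic_index [simp]: "finite (dyadic_index n)"
  using finite_index_box[of "\<lambda>_. 0" "\<lambda>_. 2 ^ n"] by (simp add: dyadic_index_def)

lemma interior_grid_box_nonempty: "(\<And>i. p i < q i) \<Longrightarrow> interior (grid_box n p q) \<noteq> {}"
  by (auto simp: grid_box_def box_empty_cart not_le divide_strict_right_mono)

lemma interior_dyadic_cube_nonempty: "interior (dyadic_cube n j) \<noteq> {}"
  unfolding dyadic_cube_def by (rule interior_grid_box_nonempty) simp

lemma interior_grid_boxes_disjoint:
  assumes "q i \<le> p' i"
  shows "interior (grid_box n p q) \<inter> interior (grid_box n p' q') = {}"
proof -
  have "real (q i) / 2 ^ n \<le> real (p' i) / 2 ^ n" using assms by (simp add: divide_right_mono)
  then have no: "\<not> (x $ i < real (q i) / 2 ^ n \<and> real (p' i) / 2 ^ n < x $ i)" for x :: "real^'a"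
    by linarith
  show ?thesis
  proof (rule ccontr)
    assume "interior (grid_box n p q) \<inter> interior (grid_box n p' q') \<noteq> {}"
    then obtain x where "x \<in> interior (grid_box n p q)" "x \<in> interior (grid_box n p' q')" by blast
    with no[of x] show False by (simp add: grid_box_def mem_box_cart)
  qed
qed

lemma interior_dyadic_cubes_disjoint:
  assumes "j \<noteq> k"
  shows "interior (dyadic_cube n j) \<inter> interior (dyadic_cube n k) = {}"
proof -
  obtain i where "j i \<noteq> k i" using assms by auto
  then consider "Suc (j i) \<le> k i" | "Suc (k i) \<le> j i" by linarith
  then show ?thesis
  proof cases
    case 1
    then show ?thesis unfolding dyadic_cube_def by (rule interior_grid_boxes_disjoint)
  next
    case 2
    then show ?thesis unfolding dyadic_cube_def by (subst Int_commute) (rule interior_grid_boxes_disjoint)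
  qed
qed

lemma dyadic_cube_inject: "dyadic_cube n j = dyadic_cube n k \<longleftrightarrow> j = k"
proof
  assume eq: "dyadic_cube n j = dyadic_cube n k"
  show "j = k"
  proof (rule ccontr)
    assume "j \<noteq> k"
    from interior_dyadic_cubes_disjoint[OF this, of n] eq interior_dyadic_cube_nonempty[of n k]
    show False by simp
  qed
qed simp

lemma inj_dyadic_cube: "inj_on (dyadic_cube n) A"
  by (auto simp: inj_on_def dyadic_cube_inject)

lemma dyadic_division:
  assumes "\<And>i. p i < q i"
  shows "dyadic_cube n ` {j. \<forall>i. p i \<le> j i \<and> j i < q i} division_of grid_box n p q"
  (is "?D division_of _")
proof (rule division_ofI)
  show "finite (?D)"
    by (intro finite_imageI finite_index_box)
  show sub: "K \<subseteq> grid_box n p q" if K: "K \<in> ?D" for K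
  proof -
    obtain j where j: "K = dyadic_cube n j" "\<And>i. p i \<le> j i" "\<And>i. Suc (j i) \<le> q i"
      using K unfolding Suc_le_eq by blast
    have pq: "real (p i) / 2 ^ n \<le> real (j i) / 2 ^ n" "real (Suc (j i)) / 2 ^ n \<le> real (q i) / 2 ^ n" for i
      using j(2,3) by (auto intro!: divide_right_mono simp del: of_nat_Suc)
    show ?thesis
    proof
      fix x assume "x \<in> K"
      then have x: "real (j i) / 2 ^ n \<le> x $ i" "x $ i \<le> real (Suc (j i)) / 2 ^ n" for i
        by (simp_all add: j(1) dyadic_cube_def grid_box_def mem_box_cart del: of_nat_Suc)
      show "x \<in> grid_box n p q"
        using order_trans[OF pq(1) x(1)] order_trans[OF x(2) pq(2)]
        by (simp add: grid_box_def mem_box_cart)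
    qed
  qed
  show "K \<noteq> {}" if K: "K \<in> ?D" for K
  proof
    assume "K = {}"
    moreover obtain j where "K = dyadic_cube n j" using K by (rule imageE)
    ultimately show False using interior_dyadic_cube_nonempty[of n j] by simp
  qed
  show "\<exists>a b. K = cbox a b" if "K \<in> ?D" for K
    using that by (auto simp: dyadic_cube_eq)
  show "interior K1 \<inter> interior K2 = {}"
    if K1: "K1 \<in> ?D" and K2: "K2 \<in> ?D" and ne: "K1 \<noteq> K2" for K1 K2
  proof -
    obtain j k where jk: "K1 = dyadic_cube n j" "K2 = dyadic_cube n k" using K1 K2 by (elim imageE)
    then have "j \<noteq> k" using ne by auto
    then show ?thesis unfolding jk by (rule interior_dyadic_cubes_disjoint)
  qed
  show "\<Union>(?D) = grid_box n p q"
  proof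
    show "\<Union>(?D) \<subseteq> grid_box n p q"
      using sub by blast
    show "grid_box n p q \<subseteq> \<Union>(?D)"
    proof
      fix x assume x: "x \<in> grid_box n p q"
      define y where "y i = 2 ^ n * x $ i" for i
      have y: "real (p i) \<le> y i" "y i \<le> real (q i)" for i
        using x by (auto simp: grid_box_def mem_box_cart y_def field_simps)
      \<comment> \<open>On the upper boundary the floor would leave the index range.\<close>
      define j where "j i = (if y i = real (q i) then q i - 1 else nat \<lfloor>y i\<rfloor>)" for i
      have j: "p i \<le> j i \<and> j i < q i \<and> real (j i) \<le> y i \<and> y i \<le> real (j i) + 1" for i
      proof (cases "y i = real (q i)")
        case True
        then show ?thesis using assms[of i] by (auto simp: j_def of_nat_diff)
      next
        case False
        then have "y i < real (q i)" using y(2)[of i] by simp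
        moreover have "0 \<le> y i" using y(1)[of i] by (rule order_trans[rotated]) simp
        moreover have "p i \<le> nat \<lfloor>y i\<rfloor>" using y(1)[of i] by (simp add: le_nat_floor)
        ultimately show ?thesis using False
          by (auto simp: j_def nat_less_iff floor_less_iff)
      qed
      have "x \<in> dyadic_cube n j"
        using j by (auto simp: dyadic_cube_eq mem_box_cart y_def field_simps)
      with j show "x \<in> \<Union>(?D)" by blast
    qed
  qed
qed

lemma rect_increment_grid_box:
  assumes "\<And>i. p i < q i"
  shows "rect_increment f (grid_box n p q) = (\<Sum>j | \<forall>i. p i \<le> j i \<and> j i < q i. rect_increment f (dyadic_cube n j))"
proof -
  have "rect_increment f (grid_box n p q) = (\<Sum>K\<in>dyadic_cube n ` {j. \<forall>i. p i \<le> j i \<and> j i < q i}. rect_increment f K)"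
    unfolding grid_box_def
  proof (rule rect_increment_division[symmetric])
    show "dyadic_cube n ` {j. \<forall>i. p i \<le> j i \<and> j i < q i} division_of cbox (\<chi> i. real (p i) / 2 ^ n) (\<chi> i. real (q i) / 2 ^ n)"
      using dyadic_division[of p q n] assms by (simp add: grid_box_def)
    show "interior (cbox (\<chi> i. real (p i) / 2 ^ n) (\<chi> i. real (q i) / 2 ^ n)) \<noteq> {}"
      using interior_grid_box_nonempty[of p q n] assms by (simp add: grid_box_def)
    show "interior K \<noteq> {}" if "K \<in> dyadic_cube n ` {j. \<forall>i. p i \<le> j i \<and> j i < q i}" for K
      using that by (elim imageE) (simp only: interior_dyadic_cube_nonempty not_False_eq_True)
  qed
  also have "\<dots> = (\<Sum>j | \<forall>i. p i \<le> j i \<and> j i < q i. rect_increment f (dyadic_cube n j))"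
    by (subst sum.reindex) (auto simp: inj_dyadic_cube)
  finally show ?thesis .
qed

text \<open>
  A point outside the boundaries of the pieces lies in at most one of them.
\<close>

lemma AE_division_indicator:
  fixes S :: "(real^'n) set"
  assumes p: "p division_of S"
  shows "AE x in lebesgue. indicat_real S x = (\<Sum>K\<in>p. indicat_real K x)"
proof -
  have "K - interior K \<in> null_sets lebesgue" if "K \<in> p" for K
  proof -
    obtain a b where "K = cbox a b" using division_ofD(4)[OF p \<open>K \<in> p\<close>] by blast
    then show ?thesis
      using negligible_frontier_interval[of a b] by (simp add: negligible_iff_null_sets)
  qed
  then have "AE x in lebesgue. x \<notin> K - interior K" if "K \<in> p" for K
    using that by (intro AE_not_in)
  then have "AE x in lebesgue. \<forall>K\<in>p. x \<notin> K - interior K"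
    using division_ofD(1)[OF p] by (subst AE_finite_all) auto
  then show ?thesis
  proof eventually_elim
    fix x assume x: "\<forall>K\<in>p. x \<notin> K - interior K"
    show "indicat_real S x = (\<Sum>K\<in>p. indicat_real K x)"
    proof (cases "x \<in> S")
      case True
      then obtain K where K: "K \<in> p" "x \<in> K" using division_ofD(6)[OF p] by blast
      have "indicat_real L x = 0" if "L \<in> p - {K}" for L
        using division_ofD(5)[OF p, of K L] K x that by (auto simp: indicator_def)
      then have "(\<Sum>K\<in>p. indicat_real K x) = (\<Sum>K\<in>{K}. indicat_real K x)"
        using division_ofD(1)[OF p] K by (intro sum.mono_neutral_right) auto
      with True K show ?thesis by simp
    next
      case False
      then have "x \<notin> K" if "K \<in> p" for K using division_ofD(2)[OF p that] by blast
      with False show ?thesis by simp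
    qed
  qed
qed

section \<open>Hadamard matrices\<close>

lemma sum_lessThan_double: "(\<Sum>r<2 * (N::nat). g r) = (\<Sum>r<N. g r + g (N + r))" for g :: "nat \<Rightarrow> real"
proof -
  have "(\<Sum>r<2 * N. g r) = (\<Sum>r<N. g r) + (\<Sum>r=N..<N+N. g r)"
    by (metis atLeast0LessThan le_add1 mult_2 sum.atLeastLessThan_concat zero_le)
  also have "(\<Sum>r=N..<N+N. g r) = (\<Sum>r<N. g (N + r))"
    using sum.shift_bounds_nat_ivl[of g 0 N N] by (simp add: atLeast0LessThan add.commute)
  finally show ?thesis by (simp add: sum.distrib)
qed

lemma hadamard_orthogonal:
  "l < 2 ^ m \<Longrightarrow> l' < 2 ^ m \<Longrightarrow>
    (\<Sum>r<2 ^ m. hadamard m r l * hadamard m r l') = (if l = l' then 2 ^ m else 0)"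
proof (induction m arbitrary: l l')
  case 0
  then show ?case by simp
next
  case (Suc m)
  let ?s = "\<lambda>l. if 2 ^ m \<le> l then - 1 else 1 :: real"
  have low: "hadamard (Suc m) r l = hadamard m r (l mod 2 ^ m)" if "r < 2 ^ m" for r l
    using that by simp
  have high: "hadamard (Suc m) (2 ^ m + r) l = ?s l * hadamard m r (l mod 2 ^ m)" if "r < 2 ^ m" for r l
    using that by simp
  have "(\<Sum>r<2 ^ Suc m. hadamard (Suc m) r l * hadamard (Suc m) r l') =
      (\<Sum>r<2 ^ m. hadamard (Suc m) r l * hadamard (Suc m) r l' + hadamard (Suc m) (2 ^ m + r) l * hadamard (Suc m) (2 ^ m + r) l')"
    unfolding power_Suc by (rule sum_lessThan_double)
  also have "\<dots> = (\<Sum>r<2 ^ m. (1 + ?s l * ?s l') * (hadamard m r (l mod 2 ^ m) * hadamard m r (l' mod 2 ^ m)))"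
    by (intro sum.cong refl) (simp only: low high lessThan_iff, simp add: algebra_simps)
  also have "\<dots> = (1 + ?s l * ?s l') * (if l mod 2 ^ m = l' mod 2 ^ m then 2 ^ m else 0)"
    by (simp only: sum_distrib_left[symmetric] Suc.IH[OF mod_less_divisor mod_less_divisor] zero_less_power zero_less_numeral)
  also have "\<dots> = (if l = l' then 2 ^ Suc m else 0)"
  proof -
    have m: "l mod 2 ^ m = (if 2 ^ m \<le> l then l - 2 ^ m else l)" "l' mod 2 ^ m = (if 2 ^ m \<le> l' then l' - 2 ^ m else l')"
      using Suc.prems by (auto simp: le_mod_geq)
    show ?thesis unfolding m using Suc.prems by auto
  qed
  finally show ?case .
qed

lemma hadamard_0: "l < 2 ^ m \<Longrightarrow> hadamard m 0 l = 1"
  by (induction m arbitrary: l) auto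

lemma abs_hadamard: "\<bar>hadamard m r l\<bar> = 1"
  by (induction m arbitrary: r l) (auto simp: abs_mult)

text \<open>
  The columns of the Hadamard matrix are orthogonal, so \<open>2\<^sup>m D\<^sub>l\<close> is the sum over \<open>r\<close> of the \<open>r\<close>-th
  coefficient with sign \<open>hadamard m r l\<close>. Row 0 is constant and contributes the sum of \<open>D\<close>; the
  other rows are bounded by hypothesis.
\<close>

lemma hadamard_deviation:
  fixes D :: "nat \<Rightarrow> real"
  assumes l: "l < 2 ^ m"
    and bound: "\<And>r. r \<in> {1..2 ^ m - 1} \<Longrightarrow> \<bar>\<Sum>l<2 ^ m. hadamard m r l * D l\<bar> \<le> B"
  shows "\<bar>2 ^ m * D l - (\<Sum>l<2 ^ m. D l)\<bar> \<le> (2 ^ m - 1) * B"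
proof -
  let ?S = "\<lambda>r. \<Sum>k<2 ^ m. hadamard m r k * D k"
  have "(\<Sum>r<2 ^ m. hadamard m r l * ?S r) = (\<Sum>k<2 ^ m. D k * (\<Sum>r<2 ^ m. hadamard m r l * hadamard m r k))"
    unfolding sum_distrib_left by (subst sum.swap) (simp add: mult_ac)
  also have "\<dots> = (\<Sum>k<2 ^ m. D k * (if l = k then 2 ^ m else 0))"
    by (intro sum.cong refl) (simp add: hadamard_orthogonal[OF l])
  also have "\<dots> = 2 ^ m * D l"
    using l by (simp add: if_distrib cong: if_cong)
  finally have inv: "(\<Sum>r<2 ^ m. hadamard m r l * ?S r) = 2 ^ m * D l" .
  have "{..<2 ^ m} = insert 0 {1..2 ^ m - 1 :: nat}" by (auto simp: less_eq_Suc_le)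
  then have "(\<Sum>r<2 ^ m. hadamard m r l * ?S r) = hadamard m 0 l * ?S 0 + (\<Sum>r\<in>{1..2 ^ m - 1}. hadamard m r l * ?S r)"
    by (simp only:) (subst sum.insert, auto)
  also have "hadamard m 0 l * ?S 0 = (\<Sum>l<2 ^ m. D l)"
    using l by (simp add: hadamard_0)
  finally have "2 ^ m * D l - (\<Sum>l<2 ^ m. D l) = (\<Sum>r\<in>{1..2 ^ m - 1}. hadamard m r l * ?S r)"
    using inv by simp
  also have "\<bar>\<dots>\<bar> \<le> (\<Sum>r\<in>{1..2 ^ m - 1 :: nat}. B)"
    by (rule order_trans[OF sum_abs] sum_mono)+ (simp add: abs_mult abs_hadamard bound)
  also have "\<dots> = (2 ^ m - 1) * B" by (simp add: of_nat_diff)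
  finally show ?thesis .
qed

section \<open>Refining dyadic step functions\<close>

lemma integrable_mult_indicator_cbox:
  fixes u :: "real^'n \<Rightarrow> real"
  assumes "integrable lebesgue u" "S \<in> sets borel"
  shows "integrable lebesgue (\<lambda>x. u x * indicat_real S x)"
  by (rule integrable_mult_bounded_borel[OF assms(1), of _ 1]) (use assms(2) in \<open>auto simp: indicator_def\<close>)

lemma box_integral_division:
  assumes u: "integrable lebesgue u" and p: "p division_of S" and S: "S \<in> sets borel"
  shows "box_integral u S = (\<Sum>K\<in>p. box_integral u K)"
proof -
  have Kb: "K \<in> sets borel" if "K \<in> p" for K
    using division_ofD(4)[OF p that] by auto
  have i: "integrable lebesgue (\<lambda>x. u x * indicat_real K x)" if "K \<in> p" for K
    by (rule integrable_mult_indicator_cbox[OF u Kb[OF that]])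
  have "box_integral u S = (\<integral>x. (\<Sum>K\<in>p. u x * indicat_real K x) \<partial>lebesgue)"
    unfolding box_integral_def
  proof (rule integral_cong_AE)
    show "(\<lambda>x. u x * indicat_real S x) \<in> borel_measurable lebesgue"
      by (rule borel_measurable_integrable[OF integrable_mult_indicator_cbox[OF u S]])
    show "(\<lambda>x. \<Sum>K\<in>p. u x * indicat_real K x) \<in> borel_measurable lebesgue"
      using i by (intro borel_measurable_sum borel_measurable_integrable)
    show "AE x in lebesgue. u x * indicat_real S x = (\<Sum>K\<in>p. u x * indicat_real K x)"
      using AE_division_indicator[OF p] by eventually_elim (simp add: sum_distrib_left)
  qed
  also have "\<dots> = (\<Sum>K\<in>p. box_integral u K)"
    unfolding box_integral_def using i by (rule Bochner_Integration.integral_sum)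
  finally show ?thesis .
qed

lemma grid_box_borel [measurable]: "grid_box n p q \<in> sets borel"
  by (simp add: grid_box_def)

lemma dyadic_cube_borel [measurable]: "dyadic_cube n j \<in> sets borel"
  by (simp add: dyadic_cube_def)

lemma box_integral_grid_box:
  assumes "integrable lebesgue u" and "\<And>i. p i < q i"
  shows "box_integral u (grid_box n p q) = (\<Sum>j | \<forall>i. p i \<le> j i \<and> j i < q i. box_integral u (dyadic_cube n j))"
proof -
  have "box_integral u (grid_box n p q) = (\<Sum>K\<in>dyadic_cube n ` {j. \<forall>i. p i \<le> j i \<and> j i < q i}. box_integral u K)"
    by (rule box_integral_division[OF assms(1) dyadic_division[OF assms(2)] grid_box_borel])
  also have "\<dots> = (\<Sum>j | \<forall>i. p i \<le> j i \<and> j i < q i. box_integral u (dyadic_cube n j))"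
    by (subst sum.reindex) (auto simp: inj_dyadic_cube)
  finally show ?thesis .
qed

text \<open>
  The subcubes of a dyadic cube are indexed by the set \<open>S\<close> of directions in which the upper half is
  taken. The position of a subcube relative to its parent depends on \<open>S\<close> only.
\<close>

definition child :: "('n::finite \<Rightarrow> nat) \<Rightarrow> 'n set \<Rightarrow> 'n \<Rightarrow> nat" where
  "child j S i = 2 * j i + (if i \<in> S then 1 else 0)"

lemma inj_child: "inj (child j)"
proof (rule injI)
  fix S T :: "'a set" assume eq: "child j S = child j T"
  have "i \<in> S \<longleftrightarrow> i \<in> T" for i
    using fun_cong[OF eq, of i] by (auto simp: child_def split: if_splits)
  then show "S = T" by auto
qed

lemma children_eq: "{k. \<forall>i. 2 * j i \<le> k i \<and> k i < 2 * j i + 2} = range (child j)"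
proof (intro equalityI subsetI)
  fix k assume "k \<in> {k. \<forall>i. 2 * j i \<le> k i \<and> k i < 2 * j i + 2}"
  then have k: "2 * j i \<le> k i" "k i < 2 * j i + 2" for i by auto
  have "k i = child j {i. odd (k i)} i" for i
    using k[of i] unfolding child_def mem_Collect_eq by presburger
  then have "k = child j {i. odd (k i)}" ..
  then show "k \<in> range (child j)" by (rule image_eqI) simp
qed (auto simp: child_def)

lemma dyadic_cube_refine: "dyadic_cube n j = grid_box (Suc n) (\<lambda>i. 2 * j i) (\<lambda>i. 2 * j i + 2)"
proof -
  have "real (2 * j i) / 2 ^ Suc n = real (j i) / 2 ^ n" for i by simp
  moreover have "real (2 * j i + 2) / 2 ^ Suc n = real (Suc (j i)) / 2 ^ n" for i
  proof -
    have "real (2 * j i + 2) = 2 * real (Suc (j i))" by simp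
    then show ?thesis by (simp only: power_Suc mult_divide_mult_cancel_left_if) simp
  qed
  ultimately show ?thesis by (simp only: dyadic_cube_def grid_box_def)
qed

lemma rect_increment_children:
  "rect_increment f (dyadic_cube n j) = (\<Sum>S\<in>UNIV. rect_increment f (dyadic_cube (Suc n) (child j S)))"
proof -
  have "rect_increment f (dyadic_cube n j) =
      (\<Sum>k | \<forall>i. 2 * j i \<le> k i \<and> k i < 2 * j i + 2. rect_increment f (dyadic_cube (Suc n) k))"
    unfolding dyadic_cube_refine[of n] by (rule rect_increment_grid_box) simp
  then show ?thesis
    unfolding children_eq by (simp add: sum.reindex inj_child)
qed

lemma box_integral_children:
  "integrable lebesgue u \<Longrightarrow>
    box_integral u (dyadic_cube n j) = (\<Sum>S\<in>UNIV. box_integral u (dyadic_cube (Suc n) (child j S)))"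
proof -
  assume u: "integrable lebesgue u"
  have "box_integral u (dyadic_cube n j) =
      (\<Sum>k | \<forall>i. 2 * j i \<le> k i \<and> k i < 2 * j i + 2. box_integral u (dyadic_cube (Suc n) k))"
    unfolding dyadic_cube_refine[of n] by (rule box_integral_grid_box[OF u]) simp
  then show ?thesis
    unfolding children_eq by (simp add: sum.reindex inj_child)
qed

lemma sum_dyadic_index_Suc:
  fixes h :: "('a::finite \<Rightarrow> nat) \<Rightarrow> real"
  shows "(\<Sum>k\<in>dyadic_index (Suc n). h k) = (\<Sum>j\<in>dyadic_index n. \<Sum>S\<in>UNIV. h (child j S))"
proof -
  have "(\<Sum>j\<in>dyadic_index n. \<Sum>S\<in>UNIV. h (child j S)) = (\<Sum>(j, S)\<in>dyadic_index n \<times> UNIV. h (child j S))"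
    by (simp add: sum.cartesian_product)
  also have "\<dots> = (\<Sum>k\<in>dyadic_index (Suc n). h k)"
  proof (rule sum.reindex_bij_witness[where i = "\<lambda>k. (\<lambda>i. k i div 2, {i. odd (k i)})" and j = "\<lambda>(j, S). child j S"])
    fix z assume "z \<in> (dyadic_index n :: ('a \<Rightarrow> nat) set) \<times> (UNIV :: 'a set set)"
    then obtain j S where z: "z = (j, S)" "\<And>i. j i < 2 ^ n" by (auto simp: dyadic_index_def)
    show "(\<lambda>i. (case z of (j, S) \<Rightarrow> child j S) i div 2, {i. odd ((case z of (j, S) \<Rightarrow> child j S) i)}) = z"
      unfolding z by (auto simp: child_def)
    have "child j S i < 2 ^ Suc n" for i
      using z(2)[of i] by (auto simp: child_def)
    then show "(case z of (j, S) \<Rightarrow> child j S) \<in> dyadic_index (Suc n)"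
      unfolding z by (simp add: dyadic_index_def)
  next
    fix k :: "'a \<Rightarrow> nat" assume "k \<in> dyadic_index (Suc n)"
    then have "k i < 2 ^ n * 2" for i by (simp add: dyadic_index_def mult.commute)
    then have "k i div 2 < 2 ^ n" for i by (rule less_mult_imp_div_less)
    then show "(\<lambda>i. k i div 2, {i. odd (k i)}) \<in> dyadic_index n \<times> UNIV" by (simp add: dyadic_index_def)
    have "child (\<lambda>i. k i div 2) {i. odd (k i)} i = k i" for i
      by (simp add: child_def)
    then show "(case (\<lambda>i. k i div 2, {i. odd (k i)}) of (j, S) \<Rightarrow> child j S) = k"
      by auto
  qed auto
  finally show ?thesis ..
qed

lemma dyadic_cube_box: "dyadic_cube n j = cbox (\<chi> i. real (j i) / 2 ^ n) (\<chi> i. real (Suc (j i)) / 2 ^ n)"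
  by (simp add: dyadic_cube_def grid_box_def)

text \<open>
  The vector from the subcube \<open>S\<close> to the subcube \<open>S'\<close> is the same for all parents, so one translation
  handles all of them at once.
\<close>

lemma sibling_integrals_le:
  fixes u :: "real^'n \<Rightarrow> real"
  assumes u: "integrable lebesgue u" and fin: "total_gradient u < \<infinity>"
    and c: "\<And>j. j \<in> dyadic_index n \<Longrightarrow> \<bar>c j\<bar> \<le> M" and M: "0 \<le> M"
  shows "\<bar>\<Sum>j\<in>dyadic_index n. c j * (box_integral u (dyadic_cube (Suc n) (child j S)) - box_integral u (dyadic_cube (Suc n) (child j S')))\<bar>
      \<le> M * (real CARD('n) / 2 ^ Suc n) * tvar u"
proof -
  define a where "a j = (\<chi> i. real (child j S i) / 2 ^ Suc n)" for j :: "'n \<Rightarrow> nat"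
  define b where "b j = (\<chi> i. real (Suc (child j S i)) / 2 ^ Suc n)" for j :: "'n \<Rightarrow> nat"
  define v where "v = (\<chi> i. (of_bool (i \<in> S') - of_bool (i \<in> S)) / 2 ^ Suc n :: real^'n)"
  have ab: "dyadic_cube (Suc n) (child j S) = cbox (a j) (b j)" for j
    by (simp only: dyadic_cube_box a_def b_def)
  have "a j + v = (\<chi> i. real (child j S' i) / 2 ^ Suc n)" "b j + v = (\<chi> i. real (Suc (child j S' i)) / 2 ^ Suc n)" for j
    by (simp_all add: vec_eq_iff a_def b_def v_def child_def add_divide_distrib[symmetric] del: power_Suc)
  then have abv: "dyadic_cube (Suc n) (child j S') = cbox (a j + v) (b j + v)" for j
    by (simp only: dyadic_cube_box)
  have disj: "box (a j) (b j) \<inter> box (a k) (b k) = {}" if "j \<noteq> k" for j k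
  proof -
    have "child j S \<noteq> child k S"
    proof
      assume "child j S = child k S"
      then have "child j S i = child k S i" for i by simp
      then have "j i = k i" for i by (simp add: child_def)
      with that show False by auto
    qed
    from interior_dyadic_cubes_disjoint[OF this, of "Suc n"] show ?thesis by (simp add: ab)
  qed
  have v: "\<bar>v $ i\<bar> \<le> 1 / 2 ^ Suc n" for i
    by (auto simp: v_def of_bool_def)
  have "(\<Sum>i\<in>UNIV. \<bar>v $ i\<bar>) \<le> (\<Sum>i\<in>(UNIV::'n set). 1 / 2 ^ Suc n)"
    by (intro sum_mono v)
  then have vs: "(\<Sum>i\<in>UNIV. \<bar>v $ i\<bar>) \<le> real CARD('n) / 2 ^ Suc n" by simp
  have "\<bar>\<Sum>j\<in>dyadic_index n. c j * (box_integral u (cbox (a j) (b j)) - box_integral u (cbox (a j + v) (b j + v)))\<bar>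
      \<le> M * (\<Sum>i\<in>UNIV. \<bar>v $ i\<bar>) * tvar u"
    by (rule box_integral_translate_sum_le[OF u fin finite_dyadic_index disj c M])
  also have "\<dots> \<le> M * (real CARD('n) / 2 ^ Suc n) * tvar u"
    using vs M by (intro mult_right_mono mult_left_mono) auto
  finally show ?thesis unfolding ab abv .
qed

text \<open>
  The integral of \<open>u\<close> against the step function whose integral over each cube of level \<open>n\<close> is the
  increment of \<open>f\<close> over that cube.
\<close>

definition dyadic_pairing :: "(real^'n \<Rightarrow> real) \<Rightarrow> nat \<Rightarrow> (real^'n \<Rightarrow> real) \<Rightarrow> real" where
  "dyadic_pairing f n u = (\<Sum>j\<in>dyadic_index n.
     2 ^ (n * CARD('n)) * rect_increment f (dyadic_cube n j) * box_integral u (dyadic_cube n j))"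

lemma card_UNIV_sets: "card (UNIV :: 'n::finite set set) = 2 ^ CARD('n)"
  using card_Pow[of "UNIV :: 'n set"] by simp

text \<open>
  Additivity of increments gives the change of density from level \<open>n\<close> to level \<open>n + 1\<close> mean zero on
  every cube of level \<open>n\<close>, which turns the pairing into an average over pairs of sibling cubes.
\<close>

lemma dyadic_pairing_step:
  fixes f u :: "real^'n \<Rightarrow> real"
  assumes u: "integrable lebesgue u" and fin: "total_gradient u < \<infinity>"
    and M: "\<And>j S. j \<in> dyadic_index n \<Longrightarrow>
        \<bar>2 ^ CARD('n) * rect_increment f (dyadic_cube (Suc n) (child j S)) - rect_increment f (dyadic_cube n j)\<bar> \<le> M"
  shows "\<bar>dyadic_pairing f (Suc n) u - dyadic_pairing f n u\<bar> \<le>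
     2 ^ CARD('n) * real CARD('n) / 2 * (2 ^ (n * CARD('n)) / 2 ^ n * M) * tvar u"
proof -
  let ?d = "CARD('n)" and ?N = "2 ^ (n * CARD('n)) :: real"
  define I where "I j S = box_integral u (dyadic_cube (Suc n) (child j S))" for j S
  define c where "c j S = ?N * (2 ^ ?d * rect_increment f (dyadic_cube (Suc n) (child j S)) - rect_increment f (dyadic_cube n j))" for j S
  have c_sum: "(\<Sum>S\<in>UNIV. c j S) = 0" for j
    unfolding c_def sum_distrib_left[symmetric] sum_subtractf rect_increment_children[symmetric]
    by (simp add: card_UNIV_sets)
  have diff: "dyadic_pairing f (Suc n) u - dyadic_pairing f n u = (\<Sum>j\<in>dyadic_index n. \<Sum>S\<in>UNIV. c j S * I j S)"
  proof -
    have "dyadic_pairing f (Suc n) u = (\<Sum>j\<in>dyadic_index n. \<Sum>S\<in>UNIV.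
        2 ^ (Suc n * ?d) * rect_increment f (dyadic_cube (Suc n) (child j S)) * I j S)"
      unfolding dyadic_pairing_def sum_dyadic_index_Suc I_def ..
    moreover have "dyadic_pairing f n u = (\<Sum>j\<in>dyadic_index n. \<Sum>S\<in>UNIV. ?N * rect_increment f (dyadic_cube n j) * I j S)"
      unfolding dyadic_pairing_def I_def sum_distrib_left[symmetric] box_integral_children[OF u, symmetric] ..
    ultimately have "dyadic_pairing f (Suc n) u - dyadic_pairing f n u = (\<Sum>j\<in>dyadic_index n. \<Sum>S\<in>UNIV.
        2 ^ (Suc n * ?d) * rect_increment f (dyadic_cube (Suc n) (child j S)) * I j S
          - ?N * rect_increment f (dyadic_cube n j) * I j S)"
      by (simp only: sum_subtractf)
    also have "\<dots> = (\<Sum>j\<in>dyadic_index n. \<Sum>S\<in>UNIV. c j S * I j S)"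
      by (intro sum.cong refl) (simp add: c_def power_add algebra_simps)
    finally show ?thesis .
  qed
  \<comment> \<open>The cross terms \<open>c j S * I j S'\<close> sum to zero because the weights \<open>c j S\<close> do.\<close>
  have pairs: "2 ^ ?d * (\<Sum>S\<in>UNIV. c j S * I j S) = (\<Sum>S\<in>UNIV. \<Sum>S'\<in>UNIV. c j S * (I j S - I j S'))" for j
  proof -
    have "(\<Sum>S\<in>UNIV. \<Sum>S'\<in>UNIV. c j S * (I j S - I j S')) =
        (\<Sum>S\<in>UNIV. 2 ^ ?d * (c j S * I j S)) - (\<Sum>S\<in>UNIV. c j S) * (\<Sum>S'\<in>UNIV. I j S')"
      by (simp add: right_diff_distrib sum_subtractf card_UNIV_sets sum_product)
    then show ?thesis by (simp add: c_sum sum_distrib_left)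
  qed
  have "2 ^ ?d * (dyadic_pairing f (Suc n) u - dyadic_pairing f n u) =
      (\<Sum>j\<in>dyadic_index n. \<Sum>S\<in>UNIV. \<Sum>S'\<in>UNIV. c j S * (I j S - I j S'))"
    unfolding diff sum_distrib_left[of "2 ^ ?d" _ "dyadic_index n"] pairs ..
  also have "\<dots> = (\<Sum>S\<in>UNIV. \<Sum>S'\<in>UNIV. \<Sum>j\<in>dyadic_index n. c j S * (I j S - I j S'))"
    by (subst sum.swap, rule sum.cong[OF refl], rule sum.swap)
  finally have "2 ^ ?d * \<bar>dyadic_pairing f (Suc n) u - dyadic_pairing f n u\<bar> =
      \<bar>\<Sum>S\<in>UNIV. \<Sum>S'\<in>UNIV. \<Sum>j\<in>dyadic_index n. c j S * (I j S - I j S')\<bar>"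
    by (metis abs_mult abs_numeral power_abs)
  also have "\<dots> \<le> (\<Sum>S\<in>(UNIV::'n set set). \<Sum>S'\<in>(UNIV::'n set set). ?N * M * (real ?d / 2 ^ Suc n) * tvar u)"
  proof (rule order_trans[OF sum_abs], rule sum_mono, rule order_trans[OF sum_abs], rule sum_mono)
    fix S S' :: "'n set"
    have "(\<lambda>_. 0) \<in> (dyadic_index n :: ('n \<Rightarrow> nat) set)" by (simp add: dyadic_index_def)
    from order_trans[OF abs_ge_zero M[OF this, of undefined]] have "0 \<le> M" .
    then show "\<bar>\<Sum>j\<in>dyadic_index n. c j S * (I j S - I j S')\<bar> \<le> ?N * M * (real ?d / 2 ^ Suc n) * tvar u"
      unfolding I_def
      by (intro sibling_integrals_le[OF u fin]) (auto simp: c_def abs_mult M)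
  qed
  also have "\<dots> = 2 ^ ?d * (2 ^ ?d * (?N * M * (real ?d / 2 ^ Suc n) * tvar u))"
    by (simp add: card_UNIV_sets)
  finally have "\<bar>dyadic_pairing f (Suc n) u - dyadic_pairing f n u\<bar> \<le> 2 ^ ?d * (?N * M * (real ?d / 2 ^ Suc n) * tvar u)"
    by (rule mult_left_le_imp_le) simp
  also have "\<dots> = 2 ^ ?d * real ?d / 2 * (?N / 2 ^ n * M) * tvar u"
    by (simp add: field_simps)
  finally show ?thesis .
qed

section \<open>Enumerations of dyadic cubes\<close>

text \<open>
  An enumeration may list the subcubes of a cube in any order. This is harmless because the block of
  \<open>2\<^sup>d\<close> indices belonging to a cube is matched with all of its children, and the bound does not
  depend on the position in the block.
\<close>

lemma haar_coeff_bound: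
  fixes K :: "nat \<Rightarrow> nat \<Rightarrow> (real^'n) set"
  assumes K: "dyadic_enumeration K"
    and B: "\<And>k r. k < 2 ^ (n * CARD('n)) \<Longrightarrow> r \<in> {1..2 ^ CARD('n) - 1} \<Longrightarrow> \<bar>haar_coeff K f n k r\<bar> \<le> B"
    and j: "j \<in> dyadic_index n"
  shows "\<bar>2 ^ CARD('n) * rect_increment f (dyadic_cube (Suc n) (child j S)) - rect_increment f (dyadic_cube n j)\<bar>
     \<le> (2 ^ CARD('n) - 1) * (B / 2 powr (real n * real CARD('n) / 2))"
proof -
  let ?d = "CARD('n)"
  have bij: "bij_betw (K m) {..<2 ^ (m * ?d)} (dyadic_cubes m)" for m
    using K unfolding dyadic_enumeration_def by blast
  have "dyadic_cube n j \<in> dyadic_cubes n" using j by (simp add: dyadic_cubes_eq)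
  then obtain k where k: "k < 2 ^ (n * ?d)" "K n k = dyadic_cube n j"
    unfolding bij_betw_imp_surj_on[OF bij[of n], symmetric] by auto
  have img: "K (Suc n) ` {2 ^ ?d * k..<2 ^ ?d * k + 2 ^ ?d} = {Q \<in> dyadic_cubes (Suc n). Q \<subseteq> dyadic_cube n j}"
    using K k(1) unfolding dyadic_enumeration_def k(2)[symmetric] by simp
  have children: "{Q \<in> dyadic_cubes (Suc n). Q \<subseteq> dyadic_cube n j} = dyadic_cube (Suc n) ` range (child j)"
  proof (intro equalityI subsetI)
    fix Q assume "Q \<in> {Q \<in> dyadic_cubes (Suc n). Q \<subseteq> dyadic_cube n j}"
    then obtain l where l: "Q = dyadic_cube (Suc n) l" "dyadic_cube (Suc n) l \<subseteq> dyadic_cube n j"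
      by (auto simp: dyadic_cubes_eq)
    have "2 * j i \<le> l i \<and> l i < 2 * j i + 2" for i
    proof -
      have "interior (dyadic_cube (Suc n) l) \<subseteq> interior (dyadic_cube n j)"
        using l(2) by (rule interior_mono)
      then have "interior (dyadic_cube n j) \<inter> interior (dyadic_cube (Suc n) l) = interior (dyadic_cube (Suc n) l)"
        by (rule Int_absorb1)
      then have ne: "interior (dyadic_cube n j) \<inter> interior (dyadic_cube (Suc n) l) \<noteq> {}"
        using interior_dyadic_cube_nonempty[of "Suc n" l] by simp
      have 1: "\<not> Suc (l i) \<le> 2 * j i"
      proof
        assume "Suc (l i) \<le> 2 * j i"
        from interior_grid_boxes_disjoint[of "\<lambda>i. Suc (l i)" i "\<lambda>i. 2 * j i" "Suc n" l "\<lambda>i. 2 * j i + 2", OF this] ne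
        show False unfolding dyadic_cube_refine[of n] dyadic_cube_def[of "Suc n" l] by (simp add: Int_commute)
      qed
      have 2: "\<not> 2 * j i + 2 \<le> l i"
      proof
        assume "2 * j i + 2 \<le> l i"
        from interior_grid_boxes_disjoint[of "\<lambda>i. 2 * j i + 2" i l "Suc n" "\<lambda>i. 2 * j i" "\<lambda>i. Suc (l i)", OF this] ne
        show False unfolding dyadic_cube_refine[of n] dyadic_cube_def[of "Suc n" l] by simp
      qed
      from 1 2 show ?thesis by simp
    qed
    then have "l \<in> range (child j)" unfolding children_eq[symmetric] by simp
    with l show "Q \<in> dyadic_cube (Suc n) ` range (child j)" by simp
  next
    fix Q assume "Q \<in> dyadic_cube (Suc n) ` range (child j)"
    then obtain T where Q: "Q = dyadic_cube (Suc n) (child j T)" by blast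
    have "child j T i < 2 ^ Suc n" for i
    proof -
      have "j i < 2 ^ n" using j by (simp add: dyadic_index_def)
      then show ?thesis by (simp add: child_def)
    qed
    then have "Q \<in> dyadic_cubes (Suc n)" by (auto simp: Q dyadic_cubes_eq dyadic_index_def)
    moreover have "Q \<subseteq> dyadic_cube n j"
      unfolding dyadic_cube_refine[of n]
    proof (rule division_ofD(2)[OF dyadic_division])
      show "Q \<in> dyadic_cube (Suc n) ` {k. \<forall>i. 2 * j i \<le> k i \<and> k i < 2 * j i + 2}"
        unfolding children_eq Q by simp
    qed simp
    ultimately show "Q \<in> {Q \<in> dyadic_cubes (Suc n). Q \<subseteq> dyadic_cube n j}" by simp
  qed
  have "{2 ^ ?d * k..<2 ^ ?d * k + 2 ^ ?d} \<subseteq> {..<2 ^ (Suc n * ?d)}"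
  proof -
    have "2 ^ ?d * k + 2 ^ ?d = 2 ^ ?d * Suc k" by simp
    also have "\<dots> \<le> 2 ^ ?d * 2 ^ (n * ?d)" using k(1) by (intro mult_left_mono) auto
    finally show ?thesis by (auto simp: power_add)
  qed
  then have inj: "inj_on (K (Suc n)) {2 ^ ?d * k..<2 ^ ?d * k + 2 ^ ?d}"
    using bij_betw_imp_inj_on[OF bij[of "Suc n"]] by (rule inj_on_subset[rotated])
  define D where "D l = rect_increment f (K (Suc n) (2 ^ ?d * k + l))" for l
  have "(\<Sum>l<2 ^ ?d. D l) = (\<Sum>m\<in>{2 ^ ?d * k..<2 ^ ?d * k + 2 ^ ?d}. rect_increment f (K (Suc n) m))"
    unfolding D_def
    by (rule sum.reindex_bij_witness[where i = "\<lambda>m. m - 2 ^ ?d * k" and j = "\<lambda>l. 2 ^ ?d * k + l"]) auto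
  also have "\<dots> = (\<Sum>Q\<in>dyadic_cube (Suc n) ` range (child j). rect_increment f Q)"
    unfolding children[symmetric] img[symmetric] by (simp add: sum.reindex[OF inj])
  also have "\<dots> = rect_increment f (dyadic_cube n j)"
    unfolding rect_increment_children[of f n j] by (simp add: sum.reindex inj_dyadic_cube inj_child)
  finally have D_sum: "(\<Sum>l<2 ^ ?d. D l) = rect_increment f (dyadic_cube n j)" .
  have "dyadic_cube (Suc n) (child j S) \<in> K (Suc n) ` {2 ^ ?d * k..<2 ^ ?d * k + 2 ^ ?d}"
    unfolding img children by simp
  then obtain m where m: "m \<in> {2 ^ ?d * k..<2 ^ ?d * k + 2 ^ ?d}" "dyadic_cube (Suc n) (child j S) = K (Suc n) m"
    by (rule imageE) blast
  define l where "l = m - 2 ^ ?d * k"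
  have l: "l < 2 ^ ?d" "D l = rect_increment f (dyadic_cube (Suc n) (child j S))"
    using m by (auto simp: l_def D_def)
  have "\<bar>\<Sum>l<2 ^ ?d. hadamard ?d r l * D l\<bar> \<le> B / 2 powr (real n * real ?d / 2)" if "r \<in> {1..2 ^ ?d - 1}" for r
    using B[OF k(1) that] by (simp add: haar_coeff_def D_def abs_mult field_simps)
  from hadamard_deviation[OF l(1) this] show ?thesis unfolding D_sum l(2) .
qed

section \<open>Boxes and figures in BV\<close>

lemma integrable_indicator_box: "integrable lebesgue (indicat_real (cbox a b) :: real^'n \<Rightarrow> real)"
  using emeasure_lborel_cbox_finite[of a b] by (simp add: integrable_indicator_iff)

lemma unit_box_corners:
  fixes a b :: "real^'n"
  assumes "cbox a b \<noteq> {}" "cbox a b \<subseteq> cbox 0 1"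
  shows "a $ i \<le> b $ i" "0 \<le> a $ i" "b $ i \<le> 1"
proof -
  have ab: "a $ i \<le> b $ i" for i
    using assms(1) by (auto simp: interval_ne_empty_cart)
  then have "a \<in> cbox a b" "b \<in> cbox a b" by (auto simp: mem_box_cart)
  then have "a \<in> cbox 0 1" "b \<in> cbox 0 1" using assms(2) by auto
  then show "a $ i \<le> b $ i" "0 \<le> a $ i" "b $ i \<le> 1"
    using ab by (auto simp: mem_box_cart)
qed

lemma box_in_BV_cube:
  fixes a b :: "real^'n"
  assumes "cbox a b \<noteq> {}" "cbox a b \<subseteq> cbox 0 1"
  shows "indicat_real (cbox a b) \<in> BV_cube" "tvar (indicat_real (cbox a b)) \<le> 2 * real CARD('n)"
proof -
  note c = unit_box_corners[OF assms]
  have "total_gradient (indicat_real (cbox a b)) \<le> ennreal (\<Sum>i\<in>UNIV. 2 * (\<Prod>j\<in>UNIV - {i}. b $ j - a $ j))"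
    by (rule total_gradient_box) (rule c(1))
  also have "\<dots> \<le> ennreal (\<Sum>i\<in>(UNIV::'n set). 2 * 1)"
  proof (intro ennreal_leI sum_mono mult_left_mono prod_le_1)
    fix j show "0 \<le> b $ j - a $ j \<and> b $ j - a $ j \<le> 1"
      using c[of j] by linarith
  qed simp
  finally have le: "total_gradient (indicat_real (cbox a b)) \<le> ennreal (2 * real CARD('n))" by (simp add: mult.commute)
  show "tvar (indicat_real (cbox a b)) \<le> 2 * real CARD('n)"
    by (rule enn2real_leI[OF _ le]) simp
  have "total_gradient (indicat_real (cbox a b)) < \<infinity>"
    by (rule le_less_trans[OF le]) simp
  moreover have "indicat_real (cbox a b) x = 0" if "x \<notin> cbox 0 1" for x
    using assms(2) that by (auto simp: indicator_def)
  ultimately show "indicat_real (cbox a b) \<in> BV_cube"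
    by (simp add: BV_cube_def BV_space_def integrable_indicator_box)
qed

lemma BV_cubeD:
  assumes "u \<in> BV_cube"
  shows "integrable lebesgue u" "total_gradient u < \<infinity>"
  using assms by (auto simp: BV_cube_def BV_space_def)

lemma BV_cube_0: "(\<lambda>x::real^'n. 0) \<in> BV_cube"
proof -
  have "indicat_real (cbox 0 (1::real^'n)) \<in> BV_cube"
    by (rule box_in_BV_cube) (auto simp: interval_ne_empty_cart)
  from BV_cube_cmult[OF this, of 0] show ?thesis by simp
qed

lemma BV_cube_sum:
  "finite I \<Longrightarrow> (\<And>i. i \<in> I \<Longrightarrow> u i \<in> BV_cube) \<Longrightarrow> (\<lambda>x. \<Sum>i\<in>I. c i * u i x) \<in> BV_cube"
  by (induction rule: finite_induct) (simp_all add: BV_cube_0 BV_cube_add BV_cube_cmult)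

lemma BV_cube_AE_cong:
  assumes "AE x in lebesgue. u x = v x" "u \<in> BV_cube" "v \<in> borel_measurable lebesgue"
  shows "v \<in> BV_cube"
proof -
  have u: "u \<in> borel_measurable lebesgue" using BV_cubeD(1)[OF assms(2)] by simp
  have "integrable lebesgue v"
    using integrable_cong_AE[OF u assms(3,1)] BV_cubeD(1)[OF assms(2)] by simp
  moreover have "total_gradient v < \<infinity>"
    using total_gradient_AE_cong[OF assms(1) u assms(3)] BV_cubeD(2)[OF assms(2)] by simp
  moreover have "AE x in lebesgue. x \<notin> cbox 0 1 \<longrightarrow> v x = 0"
    using assms(1) assms(2)[unfolded BV_cube_def] by (auto elim: AE_mp)
  ultimately show ?thesis by (simp add: BV_cube_def BV_space_def)
qed

text \<open>
  A figure has a division into non-overlapping boxes, so its indicator is a finite sum of indicators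
  of boxes almost everywhere.
\<close>

lemma figure_in_BV_cube:
  fixes E :: "(real^'n) set"
  assumes "E \<in> figures"
  shows "indicat_real E \<in> BV_cube"
proof -
  obtain \<R> where R: "finite \<R>" "\<R> \<subseteq> rectangles" "E = \<Union>\<R>"
    using assms by (auto simp: figures_def)
  have boxes: "\<exists>a b. K = cbox a b" if "K \<in> \<R>" for K
    using that R(2) unfolding rectangles_def by blast
  obtain p where p: "p division_of E"
    using elementary_unions_intervals[OF R(1) boxes] R(3) by blast
  have E: "E \<subseteq> cbox 0 1" using R by (auto simp: rectangles_def)
  have BV: "(\<lambda>x. \<Sum>K\<in>p. 1 * indicat_real K x) \<in> BV_cube"
  proof (rule BV_cube_sum[OF division_ofD(1)[OF p]])
    fix K assume K: "K \<in> p"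
    obtain a b where ab: "K = cbox a b" using division_ofD(4)[OF p K] by blast
    show "indicat_real K \<in> BV_cube"
      using division_ofD(2,3)[OF p K] E unfolding ab by (intro box_in_BV_cube) auto
  qed
  have AE: "AE x in lebesgue. (\<Sum>K\<in>p. 1 * indicat_real K x) = indicat_real E x"
    using AE_division_indicator[OF p] by eventually_elim simp
  have "indicat_real E \<in> borel_measurable lebesgue"
    by (rule measurable_completion) (use division_of_closed[OF p] in \<open>simp add: borel_closed\<close>)
  with AE BV show ?thesis
    by (rule BV_cube_AE_cong)
qed

lemma rectangle_figure: "K \<in> rectangles \<Longrightarrow> K \<in> figures"
  by (auto simp: figures_def intro!: exI[of _ "{K}"])

section \<open>Dyadic pairings as integrals\<close>

lemma box_integral_add:
  assumes "integrable lebesgue u" "integrable lebesgue v" "S \<in> sets borel"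
  shows "box_integral (\<lambda>x. u x + v x) S = box_integral u S + box_integral v S"
  unfolding box_integral_def distrib_right
  by (intro Bochner_Integration.integral_add integrable_mult_indicator_cbox assms)

lemma box_integral_cmult: "box_integral (\<lambda>x. c * u x) S = c * box_integral u S"
  by (simp add: box_integral_def mult.assoc)

lemma box_integral_AE_cong:
  assumes "AE x in lebesgue. u x = v x" "u \<in> borel_measurable lebesgue" "v \<in> borel_measurable lebesgue" "S \<in> sets borel"
  shows "box_integral u S = box_integral v S"
  unfolding box_integral_def
proof (rule integral_cong_AE)
  show "AE x in lebesgue. u x * indicat_real S x = v x * indicat_real S x"
    using assms(1) by eventually_elim simp
  have "indicat_real S \<in> borel_measurable lebesgue"
    by (rule measurable_completion) (use assms(4) in simp)
  then show "(\<lambda>x. u x * indicat_real S x) \<in> borel_measurable lebesgue" "(\<lambda>x. v x * indicat_real S x) \<in> borel_measurable lebesgue"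
    using assms(2,3) by (auto intro: borel_measurable_times)
qed

lemma abs_box_integral_le:
  assumes "integrable lebesgue u" "S \<in> sets borel"
  shows "\<bar>box_integral u S\<bar> \<le> (\<integral>x. \<bar>u x\<bar> \<partial>lebesgue)"
proof -
  have "\<bar>box_integral u S\<bar> \<le> (\<integral>x. \<bar>u x * indicat_real S x\<bar> \<partial>lebesgue)"
    unfolding box_integral_def by (rule integral_abs_bound)
  also have "\<dots> \<le> (\<integral>x. \<bar>u x\<bar> \<partial>lebesgue)"
  proof (rule integral_mono)
    show "integrable lebesgue (\<lambda>x. \<bar>u x * indicat_real S x\<bar>)"
      using integrable_mult_indicator_cbox[OF assms] by simp
    show "integrable lebesgue (\<lambda>x. \<bar>u x\<bar>)" using assms(1) by simp
    show "\<bar>u x * indicat_real S x\<bar> \<le> \<bar>u x\<bar>" for x by (simp add: indicator_def)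
  qed
  finally show ?thesis .
qed

lemma dyadic_pairing_add:
  "integrable lebesgue u \<Longrightarrow> integrable lebesgue v \<Longrightarrow>
    dyadic_pairing f n (\<lambda>x. u x + v x) = dyadic_pairing f n u + dyadic_pairing f n v"
  by (simp add: dyadic_pairing_def box_integral_add distrib_left sum.distrib)

lemma dyadic_pairing_cmult: "dyadic_pairing f n (\<lambda>x. c * u x) = c * dyadic_pairing f n u"
  by (simp add: dyadic_pairing_def box_integral_cmult sum_distrib_left mult_ac)

lemma dyadic_pairing_AE_cong:
  assumes "AE x in lebesgue. u x = v x" "u \<in> borel_measurable lebesgue" "v \<in> borel_measurable lebesgue"
  shows "dyadic_pairing f n u = dyadic_pairing f n v"
  using box_integral_AE_cong[OF assms] by (simp add: dyadic_pairing_def)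

text \<open>
  A bound for the supremum of the density of level \<open>n\<close>. It may grow with \<open>n\<close>: each use is at
  a fixed level, for instance to make the pairing of that level continuous in \<open>L\<^sup>1\<close>.
\<close>

definition pairing_bound :: "(real^'n \<Rightarrow> real) \<Rightarrow> nat \<Rightarrow> real" where
  "pairing_bound f n = (\<Sum>j\<in>dyadic_index n. \<bar>2 ^ (n * CARD('n)) * rect_increment f (dyadic_cube n j)\<bar>)"

lemma pairing_bound_nonneg: "0 \<le> pairing_bound f n"
  by (simp add: pairing_bound_def sum_nonneg)

lemma abs_dyadic_pairing_le:
  assumes "integrable lebesgue u"
  shows "\<bar>dyadic_pairing f n u\<bar> \<le> pairing_bound f n * (\<integral>x. \<bar>u x\<bar> \<partial>lebesgue)"
  unfolding dyadic_pairing_def pairing_bound_def sum_distrib_right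
  by (rule order_trans[OF sum_abs], rule sum_mono, subst abs_mult)
     (intro mult_left_mono abs_box_integral_le assms dyadic_cube_borel abs_ge_zero)

definition dyadic_density :: "(real^'n \<Rightarrow> real) \<Rightarrow> nat \<Rightarrow> real^'n \<Rightarrow> real" where
  "dyadic_density f n x = (\<Sum>j\<in>dyadic_index n.
     2 ^ (n * CARD('n)) * rect_increment f (dyadic_cube n j) * indicat_real (dyadic_cube n j) x)"

lemma dyadic_density_borel [measurable]: "dyadic_density f n \<in> borel_measurable borel"
  unfolding dyadic_density_def[abs_def] by measurable

lemma abs_dyadic_density_le: "\<bar>dyadic_density f n x\<bar> \<le> pairing_bound f n"
  unfolding dyadic_density_def pairing_bound_def
  by (rule order_trans[OF sum_abs], rule sum_mono) (auto simp: abs_mult indicator_def)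

lemma dyadic_cube_subset_unit:
  assumes "j \<in> dyadic_index n"
  shows "dyadic_cube n j \<subseteq> cbox 0 1"
proof
  fix x assume x: "x \<in> dyadic_cube n j"
  have "0 \<le> x $ i \<and> x $ i \<le> 1" for i
  proof -
    have 1: "real (j i) / 2 ^ n \<le> x $ i" "x $ i \<le> real (Suc (j i)) / 2 ^ n"
      using x by (simp_all add: dyadic_cube_box mem_box_cart del: of_nat_Suc)
    have "Suc (j i) \<le> 2 ^ n" using assms by (simp add: dyadic_index_def Suc_le_eq)
    then have "real (Suc (j i)) \<le> 2 ^ n" by (metis of_nat_le_iff of_nat_numeral of_nat_power)
    then have "real (Suc (j i)) / 2 ^ n \<le> 1" by (simp del: of_nat_Suc)
    moreover have "0 \<le> real (j i) / 2 ^ n" by simp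
    ultimately show ?thesis using 1 by linarith
  qed
  then show "x \<in> cbox 0 1" by (simp add: mem_box_cart)
qed

lemma dyadic_density_outside: "x \<notin> cbox 0 1 \<Longrightarrow> dyadic_density f n x = 0"
  unfolding dyadic_density_def using dyadic_cube_subset_unit
  by (intro sum.neutral) (auto simp: indicator_def)

lemma T_functional_dyadic_density:
  assumes u: "integrable lebesgue u"
  shows "T_functional (dyadic_density f n) u = dyadic_pairing f n u"
proof -
  have "T_functional (dyadic_density f n) u = (\<integral>x. indicat_real (cbox 0 1) x *\<^sub>R (dyadic_density f n x * u x) \<partial>lebesgue)"
    unfolding T_functional_def by (rule integral_restrict_space) simp
  also have "\<dots> = (\<integral>x. (\<Sum>j\<in>dyadic_index n. 2 ^ (n * CARD('a)) * rect_increment f (dyadic_cube n j) * (u x * indicat_real (dyadic_cube n j) x)) \<partial>lebesgue)"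
  proof (rule Bochner_Integration.integral_cong[OF refl])
    fix x :: "real^'a"
    have "indicat_real (cbox 0 1) x *\<^sub>R (dyadic_density f n x * u x) = dyadic_density f n x * u x"
      using dyadic_density_outside[of x f n] by (cases "x \<in> cbox 0 1") simp_all
    then show "indicat_real (cbox 0 1) x *\<^sub>R (dyadic_density f n x * u x) =
        (\<Sum>j\<in>dyadic_index n. 2 ^ (n * CARD('a)) * rect_increment f (dyadic_cube n j) * (u x * indicat_real (dyadic_cube n j) x))"
      by (simp add: dyadic_density_def sum_distrib_left sum_distrib_right mult_ac)
  qed
  also have "\<dots> = dyadic_pairing f n u"
    unfolding dyadic_pairing_def box_integral_def
    by (subst Bochner_Integration.integral_sum)
       (auto intro!: integrable_mult_right integrable_mult_indicator_cbox u)
  finally show ?thesis .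
qed

lemma dyadic_density_Ld: "dyadic_density f n \<in> Ld_cube"
proof -
  have fin: "finite_measure (lebesgue_on (cbox 0 1 :: (real^'a) set))"
    by (rule finite_measure_lebesgue_on) simp
  have m: "dyadic_density f n \<in> borel_measurable (lebesgue_on (cbox 0 1))"
    by (rule measurable_restrict_space1) (simp add: measurable_completion)
  have "integrable (lebesgue_on (cbox 0 1)) (\<lambda>x. \<bar>dyadic_density f n x\<bar> ^ CARD('a))"
  proof (rule finite_measure.integrable_const_bound[OF fin])
    show "AE x in lebesgue_on (cbox 0 1). norm (\<bar>dyadic_density f n x\<bar> ^ CARD('a)) \<le> pairing_bound f n ^ CARD('a)"
      by (rule AE_I2) (simp add: power_mono abs_dyadic_density_le)
    show "(\<lambda>x. \<bar>dyadic_density f n x\<bar> ^ CARD('a)) \<in> borel_measurable (lebesgue_on (cbox 0 1))"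
      using m by (intro borel_measurable_power borel_measurable_abs)
  qed
  with m show ?thesis by (simp add: Ld_cube_def)
qed

section \<open>The limit charge\<close>

definition limit_charge :: "(real^'n \<Rightarrow> real) \<Rightarrow> (real^'n \<Rightarrow> real) \<Rightarrow> real" where
  "limit_charge f u = lim (\<lambda>n. dyadic_pairing f n u)"

lemma limit_charge_eqI: "(\<lambda>n. dyadic_pairing f n u) \<longlonglongrightarrow> L \<Longrightarrow> limit_charge f u = L"
  unfolding limit_charge_def by (rule limI)

locale summable_pairing_steps =
  fixes f :: "real^'n \<Rightarrow> real" and c :: "nat \<Rightarrow> real"
  assumes summable_c: "summable c"
    and step: "\<And>n u. integrable lebesgue u \<Longrightarrow> total_gradient u < \<infinity> \<Longrightarrow>
        \<bar>dyadic_pairing f (Suc n) u - dyadic_pairing f n u\<bar> \<le> c n * tvar u"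
begin

definition tail :: "nat \<Rightarrow> real" where
  "tail N = (\<Sum>n. c (n + N))"

lemma tail_tendsto_0: "tail \<longlonglongrightarrow> 0"
  unfolding tail_def[abs_def] by (rule suminf_exist_split2[OF summable_c])

lemma limit_charge_approx:
  assumes u: "integrable lebesgue u" "total_gradient u < \<infinity>"
  shows "(\<lambda>n. dyadic_pairing f n u) \<longlonglongrightarrow> limit_charge f u" (is ?lim)
    and "\<bar>limit_charge f u - dyadic_pairing f N u\<bar> \<le> tail N * tvar u" (is ?approx)
proof -
  define D where "D n = dyadic_pairing f (Suc (n + N)) u - dyadic_pairing f (n + N) u" for n
  have sc: "summable (\<lambda>n. c (n + N) * tvar u)"
    using summable_c by (intro summable_mult2) (simp add: summable_iff_shift)
  have bound: "\<bar>D n\<bar> \<le> c (n + N) * tvar u" for n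
    unfolding D_def by (rule step[OF u])
  have sD: "summable (\<lambda>n. \<bar>D n\<bar>)"
    by (rule summable_comparison_test'[OF sc, of 0]) (simp add: bound)
  then have "summable D" by (rule summable_rabs_cancel)
  then have "(\<lambda>m. \<Sum>n<m. D n) \<longlonglongrightarrow> suminf D" by (rule summable_LIMSEQ)
  moreover have "(\<Sum>n<m. D n) = dyadic_pairing f (m + N) u - dyadic_pairing f N u" for m
    by (induction m) (simp_all add: D_def)
  ultimately have "(\<lambda>m. dyadic_pairing f (m + N) u - dyadic_pairing f N u + dyadic_pairing f N u) \<longlonglongrightarrow> suminf D + dyadic_pairing f N u"
    by (intro tendsto_add tendsto_const) simp
  then have "(\<lambda>m. dyadic_pairing f (m + N) u) \<longlonglongrightarrow> suminf D + dyadic_pairing f N u" by simp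
  then have lim: "(\<lambda>m. dyadic_pairing f m u) \<longlonglongrightarrow> suminf D + dyadic_pairing f N u"
    by (rule LIMSEQ_offset)
  then have eq: "limit_charge f u = suminf D + dyadic_pairing f N u" by (rule limit_charge_eqI)
  with lim show ?lim by simp
  have "\<bar>suminf D\<bar> \<le> (\<Sum>n. \<bar>D n\<bar>)" by (rule summable_rabs[OF sD])
  also have "\<dots> \<le> (\<Sum>n. c (n + N) * tvar u)" by (rule suminf_le[OF bound sD sc])
  also have "\<dots> = tail N * tvar u"
    unfolding tail_def using summable_c by (intro suminf_mult2[symmetric]) (simp add: summable_iff_shift)
  finally show ?approx by (simp add: eq)
qed

lemma limit_charge_add:
  assumes "u \<in> BV_cube" "v \<in> BV_cube"
  shows "limit_charge f (\<lambda>x. u x + v x) = limit_charge f u + limit_charge f v"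
proof (rule limit_charge_eqI)
  note u = BV_cubeD[OF assms(1)] and v = BV_cubeD[OF assms(2)]
  show "(\<lambda>n. dyadic_pairing f n (\<lambda>x. u x + v x)) \<longlonglongrightarrow> limit_charge f u + limit_charge f v"
    unfolding dyadic_pairing_add[OF u(1) v(1)]
    by (intro tendsto_add limit_charge_approx(1) u v)
qed

lemma limit_charge_cmult:
  assumes "u \<in> BV_cube"
  shows "limit_charge f (\<lambda>x. a * u x) = a * limit_charge f u"
  by (rule limit_charge_eqI) (simp only: dyadic_pairing_cmult, intro tendsto_mult_left limit_charge_approx(1) BV_cubeD[OF assms])

text \<open>
  The limit differs from \<open>T_functional\<close> of the density of level \<open>N\<close> by at most \<open>tail N\<close> in the dual
  norm, and the tails tend to 0.
\<close>

lemma limit_charge_SCH: "limit_charge f \<in> SCH"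
proof -
  have tail_bound: "\<bar>limit_charge f u - T_functional (dyadic_density f N) u\<bar> \<le> \<bar>tail N\<bar>"
    if "u \<in> BV_cube" "BV_norm u \<le> 1" for u N
  proof -
    note u = BV_cubeD[OF that(1)]
    have "0 \<le> (\<integral>x. \<bar>u x\<bar> \<partial>lebesgue)" by simp
    then have "tvar u \<le> 1" using that(2) unfolding BV_norm_def by linarith
    then have "\<bar>tail N\<bar> * tvar u \<le> \<bar>tail N\<bar> * 1" by (intro mult_left_mono) auto
    moreover have "tail N * tvar u \<le> \<bar>tail N\<bar> * tvar u" by (intro mult_right_mono) auto
    moreover have "\<bar>limit_charge f u - T_functional (dyadic_density f N) u\<bar> \<le> tail N * tvar u"
      unfolding T_functional_dyadic_density[OF u(1)] by (rule limit_charge_approx(2)[OF u])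
    ultimately show ?thesis by linarith
  qed
  have "BV_dual_norm (limit_charge f) \<le> ennreal (\<bar>tail 0\<bar> + pairing_bound f 0)"
    unfolding BV_dual_norm_def
  proof (rule SUP_least, rule ennreal_leI)
    fix u :: "real^'n \<Rightarrow> real" assume "u \<in> {u \<in> BV_cube. BV_norm u \<le> 1}"
    then have u: "u \<in> BV_cube" "BV_norm u \<le> 1" by auto
    note ui = BV_cubeD[OF u(1)]
    have "\<bar>dyadic_pairing f 0 u\<bar> \<le> pairing_bound f 0 * (\<integral>x. \<bar>u x\<bar> \<partial>lebesgue)"
      by (rule abs_dyadic_pairing_le[OF ui(1)])
    also have "\<dots> \<le> pairing_bound f 0 * 1"
    proof (intro mult_left_mono pairing_bound_nonneg)
      have "0 \<le> tvar u" by simp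
      then show "(\<integral>x. \<bar>u x\<bar> \<partial>lebesgue) \<le> 1" using u(2) unfolding BV_norm_def by linarith
    qed
    finally show "\<bar>limit_charge f u\<bar> \<le> \<bar>tail 0\<bar> + pairing_bound f 0"
      using tail_bound[OF u, of 0] unfolding T_functional_dyadic_density[OF ui(1)] by linarith
  qed
  then have "limit_charge f \<in> BV_dual"
    by (auto simp: BV_dual_def limit_charge_add limit_charge_cmult intro: le_less_trans)
  moreover have "\<exists>g\<in>Ld_cube. BV_dual_norm (\<lambda>u. limit_charge f u - T_functional g u) < ennreal e" if "e > 0" for e
  proof -
    have "\<forall>\<^sub>F N in sequentially. dist (tail N) 0 < e" by (rule tendstoD[OF tail_tendsto_0 that])
    then obtain N where N: "\<bar>tail N\<bar> < e" by (auto simp: eventually_sequentially)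
    have "BV_dual_norm (\<lambda>u. limit_charge f u - T_functional (dyadic_density f N) u) \<le> ennreal \<bar>tail N\<bar>"
      unfolding BV_dual_norm_def by (rule SUP_least, rule ennreal_leI) (auto intro: tail_bound)
    also have "\<dots> < ennreal e" using N that by (intro ennreal_lessI) auto
    finally show ?thesis using dyadic_density_Ld by blast
  qed
  ultimately show ?thesis by (simp add: SCH_def)
qed

text \<open>
  On functions of variation at most \<open>V\<close> the charge is uniformly close to a pairing of fixed level, and
  that pairing is continuous in \<open>L\<^sup>1\<close>.
\<close>

lemma limit_charge_continuous:
  fixes u :: "nat \<Rightarrow> real^'n \<Rightarrow> real"
  assumes u: "\<And>m. integrable lebesgue (u m)" "\<And>m. total_gradient (u m) < \<infinity>" "\<And>m. tvar (u m) \<le> V"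
    and v: "integrable lebesgue v" "total_gradient v < \<infinity>" "tvar v \<le> V"
    and L1: "(\<lambda>m. \<integral>x. \<bar>u m x - v x\<bar> \<partial>lebesgue) \<longlonglongrightarrow> 0"
  shows "(\<lambda>m. limit_charge f (u m)) \<longlonglongrightarrow> limit_charge f v"
proof (rule LIMSEQ_I)
  fix e :: real assume e: "0 < e"
  have V: "0 \<le> V" using v(3) enn2real_nonneg order_trans by blast
  have "(\<lambda>N. \<bar>tail N\<bar> * V) \<longlonglongrightarrow> \<bar>0\<bar> * V"
    by (intro tendsto_mult tendsto_rabs tail_tendsto_0 tendsto_const)
  then have "\<forall>\<^sub>F N in sequentially. \<bar>tail N\<bar> * V < e / 3"
    using e by (intro order_tendstoD(2)) auto
  then obtain N where N: "\<bar>tail N\<bar> * V < e / 3" by (auto simp: eventually_sequentially)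
  have approx: "\<bar>limit_charge f w - dyadic_pairing f N w\<bar> < e / 3"
    if "integrable lebesgue w" "total_gradient w < \<infinity>" "tvar w \<le> V" for w
  proof -
    have "tail N * tvar w \<le> \<bar>tail N\<bar> * V"
      using that(3) by (intro mult_mono) auto
    with limit_charge_approx(2)[OF that(1,2), of N] N show ?thesis by linarith
  qed
  have "(\<lambda>m. pairing_bound f N * (\<integral>x. \<bar>u m x - v x\<bar> \<partial>lebesgue)) \<longlonglongrightarrow> pairing_bound f N * 0"
    by (intro tendsto_mult_left L1)
  then have "\<forall>\<^sub>F m in sequentially. pairing_bound f N * (\<integral>x. \<bar>u m x - v x\<bar> \<partial>lebesgue) < e / 3"
    using e by (intro order_tendstoD(2)) auto
  then obtain m0 where m0: "\<And>m. m \<ge> m0 \<Longrightarrow> pairing_bound f N * (\<integral>x. \<bar>u m x - v x\<bar> \<partial>lebesgue) < e / 3"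
    by (auto simp: eventually_sequentially)
  show "\<exists>m0. \<forall>m\<ge>m0. norm (limit_charge f (u m) - limit_charge f v) < e"
  proof (intro exI allI impI)
    fix m assume "m \<ge> m0"
    have minus: "integrable lebesgue (\<lambda>x. - 1 * v x)" using v(1) by simp
    have "dyadic_pairing f N (u m) - dyadic_pairing f N v = dyadic_pairing f N (\<lambda>x. u m x + - 1 * v x)"
      unfolding dyadic_pairing_add[OF u(1) minus] dyadic_pairing_cmult by simp
    also have "\<bar>\<dots>\<bar> \<le> pairing_bound f N * (\<integral>x. \<bar>u m x + - 1 * v x\<bar> \<partial>lebesgue)"
      by (rule abs_dyadic_pairing_le[OF Bochner_Integration.integrable_add[OF u(1) minus]])
    also have "\<dots> < e / 3" using m0[OF \<open>m \<ge> m0\<close>] by simp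
    finally show "norm (limit_charge f (u m) - limit_charge f v) < e"
      using approx[OF u, of m] approx[OF v] unfolding real_norm_def by linarith
  qed
qed

text \<open>
  From level \<open>n\<close> on, every dyadic cube lies in the box or does not overlap it. The pairing is then
  the sum of the increments over the cubes inside, which is the increment over the box.
\<close>

lemma limit_charge_grid_box:
  assumes pq: "\<And>i. p i < q i" "\<And>i. q i \<le> 2 ^ n"
  shows "limit_charge f (indicat_real (grid_box n p q)) = rect_increment f (grid_box n p q)"
proof (rule limit_charge_eqI, rule tendsto_eventually)
  show "\<forall>\<^sub>F m in sequentially. dyadic_pairing f m (indicat_real (grid_box n p q)) = rect_increment f (grid_box n p q)"
  proof (rule eventually_mono[OF eventually_ge_at_top[of n]])
    fix m assume "n \<le> m"
    then obtain l where l: "m = n + l" by (auto simp: le_iff_add)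
    define p' where "p' i = 2 ^ l * p i" for i
    define q' where "q' i = 2 ^ l * q i" for i
    have eq: "grid_box n p q = grid_box m p' q'"
    proof -
      have "real (p' i) / 2 ^ m = real (p i) / 2 ^ n" "real (q' i) / 2 ^ m = real (q i) / 2 ^ n" for i
        by (simp_all add: p'_def q'_def l power_add)
      then show ?thesis by (simp add: grid_box_def)
    qed
    have pq': "p' i < q' i" "q' i \<le> 2 ^ m" for i
      using pq[of i] by (simp_all add: p'_def q'_def l power_add)
    let ?J = "{j. \<forall>i. p' i \<le> j i \<and> j i < q' i}"
    have J: "?J \<subseteq> dyadic_index m"
      using pq'(2) by (auto simp: dyadic_index_def intro: less_le_trans)
    have I_in: "2 ^ (m * CARD('n)) * box_integral (indicat_real (grid_box m p' q')) (dyadic_cube m j) = 1" if "j \<in> ?J" for j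
    proof -
      have sub: "dyadic_cube m j \<subseteq> grid_box m p' q'"
        by (rule division_ofD(2)[OF dyadic_division[OF pq'(1)]]) (use that in blast)
      have "box_integral (indicat_real (grid_box m p' q')) (dyadic_cube m j) = (\<integral>x. indicat_real (dyadic_cube m j) x \<partial>lebesgue)"
        unfolding box_integral_def using sub by (intro Bochner_Integration.integral_cong) (auto simp: indicator_def)
      also have "\<dots> = measure lborel (dyadic_cube m j)"
        by simp
      also have "\<dots> = (\<Prod>i\<in>(UNIV::'n set). 1 / 2 ^ m)"
        unfolding dyadic_cube_box measure_def
        by (subst emeasure_lborel_box_cart)
           (simp_all add: divide_right_mono diff_divide_distrib[symmetric] enn2real_ennreal prod_nonneg)
      also have "\<dots> = 1 / 2 ^ (m * CARD('n))" by (simp add: power_mult power_one_over)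
      finally show ?thesis by simp
    qed
    have I_out: "box_integral (indicat_real (grid_box m p' q')) (dyadic_cube m j) = 0" if "j \<notin> ?J" for j
    proof -
      have "\<exists>i. \<not> (p' i \<le> j i \<and> j i < q' i)" using that by simp
      then obtain i where "\<not> (p' i \<le> j i \<and> j i < q' i)" ..
      then have "j i < p' i \<or> q' i \<le> j i" by linarith
      then have disj: "interior (dyadic_cube m j) \<inter> interior (grid_box m p' q') = {}"
      proof
        assume "j i < p' i"
        then show ?thesis unfolding dyadic_cube_def by (intro interior_grid_boxes_disjoint[where i = i]) simp
      next
        assume "q' i \<le> j i"
        then show ?thesis unfolding dyadic_cube_def by (subst Int_commute) (intro interior_grid_boxes_disjoint[where i = i])
      qed
      have "AE x in lebesgue. indicat_real (grid_box m p' q') x * indicat_real (dyadic_cube m j) x = 0"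
        using AE_box_eq_cbox[of "\<chi> i. real (p' i) / 2 ^ m" "\<chi> i. real (q' i) / 2 ^ m"]
          AE_box_eq_cbox[of "\<chi> i. real (j i) / 2 ^ m" "\<chi> i. real (Suc (j i)) / 2 ^ m"]
      proof eventually_elim
        case (elim x)
        have "indicat_real (box (\<chi> i. real (p' i) / 2 ^ m) (\<chi> i. real (q' i) / 2 ^ m)) x *
            indicat_real (box (\<chi> i. real (j i) / 2 ^ m) (\<chi> i. real (Suc (j i)) / 2 ^ m)) x = 0"
          using disj unfolding dyadic_cube_box grid_box_def by (auto simp: indicator_def simp del: of_nat_Suc)
        then show ?case unfolding dyadic_cube_box grid_box_def elim .
      qed
      then show ?thesis
        unfolding box_integral_def by (rule integral_eq_zero_AE)
    qed
    have "dyadic_pairing f m (indicat_real (grid_box m p' q')) =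
        (\<Sum>j\<in>?J. 2 ^ (m * CARD('n)) * rect_increment f (dyadic_cube m j) * box_integral (indicat_real (grid_box m p' q')) (dyadic_cube m j))"
      unfolding dyadic_pairing_def by (rule sum.mono_neutral_right[OF finite_dyadic_index J]) (simp add: I_out)
    also have "\<dots> = (\<Sum>j\<in>?J. rect_increment f (dyadic_cube m j))"
    proof (rule sum.cong[OF refl])
      fix j assume "j \<in> ?J"
      have "2 ^ (m * CARD('n)) * rect_increment f (dyadic_cube m j) * box_integral (indicat_real (grid_box m p' q')) (dyadic_cube m j) =
        rect_increment f (dyadic_cube m j) * (2 ^ (m * CARD('n)) * box_integral (indicat_real (grid_box m p' q')) (dyadic_cube m j))"
        by simp
      then show "2 ^ (m * CARD('n)) * rect_increment f (dyadic_cube m j) * box_integral (indicat_real (grid_box m p' q')) (dyadic_cube m j) =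
        rect_increment f (dyadic_cube m j)"
        unfolding I_in[OF \<open>j \<in> ?J\<close>] by simp
    qed
    also have "\<dots> = rect_increment f (grid_box m p' q')"
      by (rule rect_increment_grid_box[symmetric, OF pq'(1)])
    finally show "dyadic_pairing f m (indicat_real (grid_box n p q)) = rect_increment f (grid_box n p q)"
      unfolding eq .
  qed
qed

end

lemma cbox_mono_cart:
  fixes a b c d :: "real^'n"
  assumes "\<And>i. c $ i \<le> a $ i" "\<And>i. b $ i \<le> d $ i"
  shows "cbox a b \<subseteq> cbox c d"
proof
  fix x assume x: "x \<in> cbox a b"
  show "x \<in> cbox c d"
    unfolding mem_box_cart
  proof
    fix i
    from x have "a $ i \<le> x $ i" "x $ i \<le> b $ i" by (simp_all add: mem_box_cart)
    with assms[of i] show "c $ i \<le> x $ i \<and> x $ i \<le> d $ i" by linarith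
  qed
qed

lemma integral_indicator_box:
  fixes a b :: "real^'n"
  assumes "\<And>i. a $ i \<le> b $ i"
  shows "(\<integral>x. indicat_real (cbox a b) x \<partial>lebesgue) = (\<Prod>i\<in>UNIV. b $ i - a $ i)"
proof -
  have "(\<integral>x. indicat_real (cbox a b) x \<partial>lebesgue) = measure lborel (cbox a b)" by simp
  also have "\<dots> = (\<Prod>i\<in>UNIV. b $ i - a $ i)"
    unfolding measure_def using assms
    by (subst emeasure_lborel_box_cart) (simp_all add: prod_nonneg)
  finally show ?thesis .
qed

context summable_pairing_steps
begin

text \<open>
  The rectangle is approximated from outside by dyadic boxes. Their indicators converge in \<open>L\<^sup>1\<close> and
  have perimeter at most \<open>2 d\<close>, so the charges converge; the increments converge since \<open>f\<close> is
  continuous.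
\<close>

lemma limit_charge_rectangle:
  assumes cont: "continuous_on (cbox 0 1) f" and K: "K \<in> rectangles"
  shows "limit_charge f (indicat_real K) = rect_increment f K"
proof -
  obtain a b where ab: "K = cbox a b" "\<And>i. a $ i < b $ i" "cbox a b \<subseteq> cbox 0 1"
    using K by (auto simp: rectangles_def)
  have ne: "cbox a b \<noteq> {}" using ab(2) by (auto simp: interval_ne_empty_cart intro: less_imp_le)
  note c = unit_box_corners[OF ne ab(3)]
  define p where "p m i = nat \<lfloor>2 ^ m * a $ i\<rfloor>" for m :: nat and i
  define q where "q m i = nat \<lceil>2 ^ m * b $ i\<rceil>" for m :: nat and i
  define A where "A m = (\<chi> i. real (p m i) / 2 ^ m)" for m
  define B where "B m = (\<chi> i. real (q m i) / 2 ^ m)" for m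
  have A: "A m $ i \<le> a $ i" "a $ i - (1/2) ^ m \<le> A m $ i" "0 \<le> A m $ i" for m i
  proof -
    have "0 \<le> 2 ^ m * a $ i" using c(2) by simp
    then have "real (p m i) = of_int \<lfloor>2 ^ m * a $ i\<rfloor>" by (simp add: p_def)
    then have le: "real (p m i) \<le> 2 ^ m * a $ i" "2 ^ m * a $ i - 1 \<le> real (p m i)" by linarith+
    then show "A m $ i \<le> a $ i" "0 \<le> A m $ i"
      by (simp_all add: A_def field_simps)
    have "a $ i - (1/2) ^ m = (2 ^ m * a $ i - 1) / 2 ^ m"
      by (simp add: diff_divide_distrib power_one_over)
    also have "\<dots> \<le> A m $ i" using le(2) by (simp add: A_def divide_right_mono)
    finally show "a $ i - (1/2) ^ m \<le> A m $ i" .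
  qed
  have B: "b $ i \<le> B m $ i" "B m $ i \<le> b $ i + (1/2) ^ m" "B m $ i \<le> 1" "q m i \<le> 2 ^ m" for m i
  proof -
    have "0 \<le> 2 ^ m * b $ i" using c(1)[of i] c(2)[of i] by simp
    then have r: "real (q m i) = of_int \<lceil>2 ^ m * b $ i\<rceil>" by (simp add: q_def)
    then have le: "2 ^ m * b $ i \<le> real (q m i)" "real (q m i) \<le> 2 ^ m * b $ i + 1" by linarith+
    then show "b $ i \<le> B m $ i" by (simp add: B_def field_simps)
    have "B m $ i \<le> (2 ^ m * b $ i + 1) / 2 ^ m" using le(2) by (simp add: B_def divide_right_mono)
    also have "\<dots> = b $ i + (1/2) ^ m" by (simp add: add_divide_distrib power_one_over)
    finally show "B m $ i \<le> b $ i + (1/2) ^ m" .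
    have "2 ^ m * b $ i \<le> of_int (2 ^ m)" using c(3)[of i] by simp
    then have "\<lceil>2 ^ m * b $ i\<rceil> \<le> 2 ^ m" by (rule ceiling_le)
    then have "real (q m i) \<le> 2 ^ m"
      unfolding r by (metis of_int_le_iff of_int_numeral of_int_power)
    then show "B m $ i \<le> 1" by (simp add: B_def)
    from \<open>real (q m i) \<le> 2 ^ m\<close> show "q m i \<le> 2 ^ m"
      by (metis of_nat_le_iff of_nat_numeral of_nat_power)
  qed
  have AB: "A m $ i < B m $ i" for m i
    using A(1)[of m i] B(1)[of i m] ab(2)[of i] by linarith
  have pq: "p m i < q m i" for m i
  proof -
    have "real (p m i) < real (q m i)"
      using AB[of m i] by (simp add: A_def B_def divide_less_cancel)
    then show ?thesis by simp
  qed
  have grid: "grid_box m (p m) (q m) = cbox (A m) (B m)" for m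
    by (simp add: grid_box_def A_def B_def)
  have half: "(\<lambda>m. (1/2) ^ m :: real) \<longlonglongrightarrow> 0" by (rule LIMSEQ_realpow_zero) auto
  have A_lim: "(\<lambda>m. A m $ i) \<longlonglongrightarrow> a $ i" for i
  proof (rule tendsto_sandwich[of "\<lambda>m. a $ i - (1/2) ^ m" _ _ "\<lambda>m. a $ i"])
    show "(\<lambda>m. a $ i - (1/2) ^ m) \<longlonglongrightarrow> a $ i"
      using tendsto_diff[OF tendsto_const[of "a $ i"] half] by simp
  qed (auto intro: A always_eventually)
  have B_lim: "(\<lambda>m. B m $ i) \<longlonglongrightarrow> b $ i" for i
  proof (rule tendsto_sandwich[of "\<lambda>m. b $ i" _ _ "\<lambda>m. b $ i + (1/2) ^ m"])
    show "(\<lambda>m. b $ i + (1/2) ^ m) \<longlonglongrightarrow> b $ i"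
      using tendsto_add[OF tendsto_const[of "b $ i"] half] by simp
  qed (auto intro: B always_eventually)
  have sub: "cbox a b \<subseteq> cbox (A m) (B m)" for m
    using A(1) B(1) by (rule cbox_mono_cart)
  have unit: "cbox (A m) (B m) \<subseteq> cbox 0 1" for m
    using A(3) B(3) by (intro cbox_mono_cart) simp_all
  have ne': "cbox (A m) (B m) \<noteq> {}" for m using sub ne by blast
  have "(\<lambda>m. limit_charge f (indicat_real (cbox (A m) (B m)))) \<longlonglongrightarrow> limit_charge f (indicat_real (cbox a b))"
  proof (rule limit_charge_continuous)
    show "integrable lebesgue (indicat_real (cbox (A m) (B m)))" "total_gradient (indicat_real (cbox (A m) (B m))) < \<infinity>"
        "tvar (indicat_real (cbox (A m) (B m))) \<le> 2 * real CARD('n)" for m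
      by (rule BV_cubeD[OF box_in_BV_cube(1)[OF ne' unit]] box_in_BV_cube(2)[OF ne' unit])+
    show "integrable lebesgue (indicat_real (cbox a b))" "total_gradient (indicat_real (cbox a b)) < \<infinity>"
        "tvar (indicat_real (cbox a b)) \<le> 2 * real CARD('n)"
      by (rule BV_cubeD[OF box_in_BV_cube(1)[OF ne ab(3)]] box_in_BV_cube(2)[OF ne ab(3)])+
    have "(\<integral>x. \<bar>indicat_real (cbox (A m) (B m)) x - indicat_real (cbox a b) x\<bar> \<partial>lebesgue) =
        (\<Prod>i\<in>UNIV. B m $ i - A m $ i) - (\<Prod>i\<in>UNIV. b $ i - a $ i)" for m
    proof -
      have "(\<integral>x. \<bar>indicat_real (cbox (A m) (B m)) x - indicat_real (cbox a b) x\<bar> \<partial>lebesgue) =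
          (\<integral>x. indicat_real (cbox (A m) (B m)) x - indicat_real (cbox a b) x \<partial>lebesgue)"
        using sub[of m] by (intro Bochner_Integration.integral_cong refl) (auto simp: indicator_def)
      also have "\<dots> = (\<integral>x. indicat_real (cbox (A m) (B m)) x \<partial>lebesgue) - (\<integral>x. indicat_real (cbox a b) x \<partial>lebesgue)"
        by (rule Bochner_Integration.integral_diff[OF integrable_indicator_box integrable_indicator_box])
      also have "\<dots> = (\<Prod>i\<in>UNIV. B m $ i - A m $ i) - (\<Prod>i\<in>UNIV. b $ i - a $ i)"
        by (simp only: integral_indicator_box[OF c(1)] integral_indicator_box[OF less_imp_le[OF AB]])
      finally show ?thesis .
    qed
    moreover have "(\<lambda>m. (\<Prod>i\<in>UNIV. B m $ i - A m $ i) - (\<Prod>i\<in>UNIV. b $ i - a $ i)) \<longlonglongrightarrow>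
        (\<Prod>i\<in>UNIV. b $ i - a $ i) - (\<Prod>i\<in>UNIV. b $ i - a $ i)"
      by (intro tendsto_diff tendsto_prod A_lim B_lim tendsto_const)
    ultimately show "(\<lambda>m. \<integral>x. \<bar>indicat_real (cbox (A m) (B m)) x - indicat_real (cbox a b) x\<bar> \<partial>lebesgue) \<longlonglongrightarrow> 0"
      by simp
  qed
  moreover have "limit_charge f (indicat_real (cbox (A m) (B m))) = box_increment f (A m) (B m)" for m
    using limit_charge_grid_box[of "p m" "q m" m] pq B(4)
    by (simp only: grid rect_increment_cbox[OF AB])
  moreover have "(\<lambda>m. box_increment f (A m) (B m)) \<longlonglongrightarrow> box_increment f a b"
    unfolding box_increment_def
  proof (intro tendsto_sum tendsto_mult tendsto_const)
    fix S :: "'n set"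
    show "(\<lambda>m. f (\<chi> i. if i \<in> S then A m $ i else B m $ i)) \<longlonglongrightarrow> f (\<chi> i. if i \<in> S then a $ i else b $ i)"
    proof (rule continuous_on_tendsto_compose[OF cont])
      show "(\<lambda>m. \<chi> i. if i \<in> S then A m $ i else B m $ i) \<longlonglongrightarrow> (\<chi> i. if i \<in> S then a $ i else b $ i)"
        by (rule vec_tendstoI) (simp add: A_lim B_lim)
      have "0 \<le> b $ i" "a $ i \<le> 1" for i
        using c(1)[of i] c(2)[of i] c(3)[of i] by linarith+
      then show "(\<chi> i. if i \<in> S then a $ i else b $ i) \<in> cbox 0 1"
        using c(2,3) by (simp add: mem_box_cart)
      have "0 \<le> B m $ i" "A m $ i \<le> 1" for m i
        using A(3)[of m i] B(3)[of m i] AB[of m i] by linarith+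
      then show "\<forall>\<^sub>F m in sequentially. (\<chi> i. if i \<in> S then A m $ i else B m $ i) \<in> cbox 0 1"
        using A(3) B(3) by (simp add: mem_box_cart)
    qed
  qed
  ultimately have "limit_charge f (indicat_real (cbox a b)) = box_increment f a b"
    using LIMSEQ_unique by simp
  then show ?thesis unfolding ab(1) rect_increment_cbox[OF ab(2)] .
qed

text \<open>
  The charge is linear and does not see null sets.
\<close>

lemma limit_charge_figures_additive:
  assumes E: "E \<in> figures" and F: "F \<in> figures" and null: "negligible (E \<inter> F)"
  shows "limit_charge f (indicat_real (E \<union> F)) = limit_charge f (indicat_real E) + limit_charge f (indicat_real F)"
proof -
  have EF: "E \<union> F \<in> figures"
  proof -
    obtain \<R> \<S> where "finite \<R>" "\<R> \<subseteq> rectangles" "E = \<Union>\<R>" "finite \<S>" "\<S> \<subseteq> rectangles" "F = \<Union>\<S>"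
      using E F unfolding figures_def by blast
    then show ?thesis unfolding figures_def by (intro CollectI exI[of _ "\<R> \<union> \<S>"]) auto
  qed
  have m: "indicat_real H \<in> borel_measurable lebesgue" if "H \<in> figures" for H :: "(real^'n) set"
    by (rule borel_measurable_integrable[OF BV_cubeD(1)[OF figure_in_BV_cube[OF that]]])
  have "E \<inter> F \<in> null_sets lebesgue" using null by (simp add: negligible_iff_null_sets)
  from AE_not_in[OF this] have AE: "AE x in lebesgue. indicat_real (E \<union> F) x = indicat_real E x + indicat_real F x"
    by eventually_elim (auto simp: indicator_def)
  have "dyadic_pairing f n (indicat_real (E \<union> F)) = dyadic_pairing f n (\<lambda>x. indicat_real E x + indicat_real F x)" for n
    by (rule dyadic_pairing_AE_cong[OF AE m[OF EF] borel_measurable_add[OF m[OF E] m[OF F]]])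
  then have "limit_charge f (indicat_real (E \<union> F)) = limit_charge f (\<lambda>x. indicat_real E x + indicat_real F x)"
    by (simp add: limit_charge_def)
  also have "\<dots> = limit_charge f (indicat_real E) + limit_charge f (indicat_real F)"
    by (rule limit_charge_add[OF figure_in_BV_cube[OF E] figure_in_BV_cube[OF F]])
  finally show ?thesis .
qed

lemma strongly_chargeable_limit:
  assumes cont: "continuous_on (cbox 0 1) f"
  shows "strongly_chargeable f"
proof -
  let ?G = "\<lambda>B. limit_charge f (indicat_real B)"
  have "is_figure_increment f ?G"
    unfolding is_figure_increment_def
    using limit_charge_rectangle[OF cont] limit_charge_figures_additive by blast
  moreover have "strong_charge ?G"
    unfolding strong_charge_def using limit_charge_SCH by blast
  ultimately show ?thesis unfolding strongly_chargeable_def by blast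
qed

end

lemma strongly_chargeable_if_haar_summable:
  fixes f :: "real^'n \<Rightarrow> real" and K :: "nat \<Rightarrow> nat \<Rightarrow> (real^'n) set"
  assumes f: "f \<in> C0_cube" and K: "dyadic_enumeration K"
    and bound: "\<And>n k r. k < 2 ^ (n * CARD('n)) \<Longrightarrow> r \<in> {1..2 ^ CARD('n) - 1} \<Longrightarrow> \<bar>haar_coeff K f n k r\<bar> \<le> h n"
    and summable: "summable (\<lambda>n. 2 powr (real n * (real CARD('n) / 2 - 1)) * h n)"
  shows "strongly_chargeable f"
proof -
  let ?d = "CARD('n)"
  define C where "C = 2 ^ ?d * real ?d / 2 * (2 ^ ?d - 1)"
  define c where "c n = C * (2 powr (real n * (real ?d / 2 - 1)) * h n)" for n
  interpret summable_pairing_steps f c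
  proof
    show "summable c" unfolding c_def by (intro summable_mult summable)
    fix n and u :: "real^'n \<Rightarrow> real"
    assume u: "integrable lebesgue u" "total_gradient u < \<infinity>"
    have "\<bar>dyadic_pairing f (Suc n) u - dyadic_pairing f n u\<bar> \<le>
        2 ^ ?d * real ?d / 2 * (2 ^ (n * ?d) / 2 ^ n * ((2 ^ ?d - 1) * (h n / 2 powr (real n * real ?d / 2)))) * tvar u"
      by (rule dyadic_pairing_step[OF u haar_coeff_bound[OF K bound]])
    also have "\<dots> = C * (2 ^ (n * ?d) / 2 ^ n / 2 powr (real n * real ?d / 2) * h n) * tvar u"
      by (simp add: C_def)
    also have "2 ^ (n * ?d) / 2 ^ n / 2 powr (real n * real ?d / 2) = 2 powr (real (n * ?d) - real n - real n * real ?d / 2)"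
      unfolding powr_diff by (simp add: powr_realpow[symmetric])
    also have "real (n * ?d) - real n - real n * real ?d / 2 = real n * (real ?d / 2 - 1)"
      by (simp add: field_simps)
    finally show "\<bar>dyadic_pairing f (Suc n) u - dyadic_pairing f n u\<bar> \<le> c n * tvar u"
      by (simp only: c_def)
  qed
  show ?thesis
    using f by (intro strongly_chargeable_limit) (simp add: C0_cube_def)
qed

section \<open>The necessary condition\<close>

lemma tvar_add:
  assumes "u \<in> BV_cube" "v \<in> BV_cube"
  shows "tvar (\<lambda>x. u x + v x) \<le> tvar u + tvar v"
proof -
  note u = BV_cubeD[OF assms(1)] and v = BV_cubeD[OF assms(2)]
  have "tvar (\<lambda>x. u x + v x) \<le> enn2real (total_gradient u + total_gradient v)"
    using u v by (intro enn2real_mono total_gradient_add) (auto simp: ennreal_add_less_top)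
  also have "\<dots> = tvar u + tvar v" using u v by (simp add: enn2real_plus)
  finally show ?thesis .
qed

lemma tvar_cmult:
  assumes "u \<in> BV_cube"
  shows "tvar (\<lambda>x. c * u x) \<le> \<bar>c\<bar> * tvar u"
proof -
  note u = BV_cubeD[OF assms(1)]
  have "tvar (\<lambda>x. c * u x) \<le> enn2real (ennreal \<bar>c\<bar> * total_gradient u)"
    using u by (intro enn2real_mono total_gradient_cmult) (auto simp: ennreal_mult_less_top)
  then show ?thesis by (simp add: enn2real_mult)
qed

lemma tvar_zero: "tvar (\<lambda>x::real^'n. 0) = 0"
proof -
  have "tvar (\<lambda>x::real^'n. 0 * 0) \<le> \<bar>0\<bar> * tvar (\<lambda>x::real^'n. 0)" by (rule tvar_cmult[OF BV_cube_0])
  then show ?thesis by (simp add: order_antisym)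
qed

lemma tvar_sum_le:
  assumes "finite I" "\<And>i. i \<in> I \<Longrightarrow> u i \<in> BV_cube" "\<And>i. i \<in> I \<Longrightarrow> \<bar>c i\<bar> \<le> 1"
  shows "tvar (\<lambda>x. \<Sum>i\<in>I. c i * u i x) \<le> (\<Sum>i\<in>I. tvar (u i))"
  using assms
proof (induction rule: finite_induct)
  case empty
  then show ?case by (simp add: tvar_zero)
next
  case (insert i I)
  have "tvar (\<lambda>x. c i * u i x + (\<Sum>i\<in>I. c i * u i x)) \<le> tvar (\<lambda>x. c i * u i x) + tvar (\<lambda>x. \<Sum>i\<in>I. c i * u i x)"
    using insert.prems insert.hyps by (intro tvar_add BV_cube_cmult BV_cube_sum) auto
  also have "tvar (\<lambda>x. c i * u i x) \<le> \<bar>c i\<bar> * tvar (u i)"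
    using insert.prems by (intro tvar_cmult) auto
  also have "\<bar>c i\<bar> * tvar (u i) \<le> 1 * tvar (u i)"
    using insert.prems by (intro mult_right_mono) auto
  also have "tvar (\<lambda>x. \<Sum>i\<in>I. c i * u i x) \<le> (\<Sum>i\<in>I. tvar (u i))"
    using insert.prems by (intro insert.IH) auto
  finally show ?case using insert.hyps by simp
qed

lemma BV_dualD:
  assumes "\<alpha> \<in> BV_dual" "u \<in> BV_cube"
  shows "v \<in> BV_cube \<Longrightarrow> \<alpha> (\<lambda>x. u x + v x) = \<alpha> u + \<alpha> v" "\<alpha> (\<lambda>x. c * u x) = c * \<alpha> u"
  using assms unfolding BV_dual_def by simp_all

lemma BV_dual_sum:
  assumes \<alpha>: "\<alpha> \<in> BV_dual" and "finite I" "\<And>i. i \<in> I \<Longrightarrow> u i \<in> BV_cube"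
  shows "\<alpha> (\<lambda>x. \<Sum>i\<in>I. c i * u i x) = (\<Sum>i\<in>I. c i * \<alpha> (u i))"
  using assms(2,3)
proof (induction rule: finite_induct)
  case empty
  have "\<alpha> (\<lambda>x. 0 * 0) = 0 * \<alpha> (\<lambda>x. 0)" by (rule BV_dualD(2)[OF \<alpha> BV_cube_0])
  then show ?case by simp
next
  case (insert i I)
  have "\<alpha> (\<lambda>x. c i * u i x + (\<Sum>i\<in>I. c i * u i x)) = \<alpha> (\<lambda>x. c i * u i x) + \<alpha> (\<lambda>x. \<Sum>i\<in>I. c i * u i x)"
    using BV_cube_cmult[of "u i" "c i"] BV_cube_sum[of I u c] insert.hyps insert.prems
    by (intro BV_dualD(1)[OF \<alpha>]) auto
  moreover have "\<alpha> (\<lambda>x. c i * u i x) = c i * \<alpha> (u i)"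
    using insert.prems by (intro BV_dualD(2)[OF \<alpha>]) auto
  ultimately show ?case using insert by simp
qed

lemma BV_dual_norm_less:
  assumes \<alpha>: "\<alpha> \<in> BV_dual" and e: "BV_dual_norm (\<lambda>u. \<alpha> u - T_functional g u) < ennreal e"
    and u: "u \<in> BV_cube" "BV_norm u \<le> B" and B: "0 < B"
  shows "\<bar>\<alpha> u - T_functional g u\<bar> \<le> e * B"
proof -
  have e0: "0 < e"
  proof (rule ccontr)
    assume "\<not> 0 < e"
    then have "ennreal e = 0" by (simp add: ennreal_neg)
    with e show False by simp
  qed
  define v where "v x = 1 / B * u x" for x
  have v: "v \<in> BV_cube" unfolding v_def[abs_def] by (rule BV_cube_cmult[OF u(1)])
  have "(\<integral>x. \<bar>v x\<bar> \<partial>lebesgue) = 1 / B * (\<integral>x. \<bar>u x\<bar> \<partial>lebesgue)"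
    using B by (simp add: v_def abs_mult)
  moreover have "tvar v \<le> 1 / B * tvar u"
    using tvar_cmult[OF u(1), of "1 / B"] B by (simp add: v_def[abs_def])
  ultimately have "BV_norm v \<le> 1 / B * BV_norm u"
    by (simp add: BV_norm_def add_divide_distrib)
  also have "\<dots> \<le> 1" using u(2) B by (simp add: field_simps)
  finally have "ennreal \<bar>\<alpha> v - T_functional g v\<bar> \<le> BV_dual_norm (\<lambda>u. \<alpha> u - T_functional g u)"
    unfolding BV_dual_norm_def using v by (intro SUP_upper) auto
  with e have "ennreal \<bar>\<alpha> v - T_functional g v\<bar> < ennreal e" by (rule le_less_trans[rotated])
  then have "\<bar>\<alpha> v - T_functional g v\<bar> < e" by (simp add: ennreal_less_iff)
  moreover have "\<alpha> v = 1 / B * \<alpha> u"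
    unfolding v_def[abs_def] by (rule BV_dualD(2)[OF \<alpha> u(1)])
  moreover have "T_functional g v = 1 / B * T_functional g u"
    by (simp add: T_functional_def v_def mult.left_commute)
  ultimately have "\<bar>1 / B * (\<alpha> u - T_functional g u)\<bar> < e" by (simp add: right_diff_distrib)
  then show ?thesis using B by (simp add: abs_mult field_simps)
qed

lemma AE_dyadic_cubes_partition:
  "AE x in lebesgue. (\<Sum>j\<in>dyadic_index m. indicat_real (dyadic_cube m j) x) = indicat_real (cbox 0 1) (x :: real^'n)"
proof -
  let ?J = "{j :: 'n \<Rightarrow> nat. \<forall>i. 0 \<le> j i \<and> j i < 2 ^ m}"
  have "dyadic_cube m ` ?J division_of grid_box m (\<lambda>_. 0) (\<lambda>_. 2 ^ m)"
    by (rule dyadic_division) simp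
  moreover have "?J = dyadic_index m" by (simp add: dyadic_index_def)
  moreover have "grid_box m (\<lambda>_. 0) (\<lambda>_. 2 ^ m) = cbox 0 (1 :: real^'n)"
    by (auto simp: grid_box_def mem_box_cart)
  ultimately have "dyadic_cube m ` dyadic_index m division_of cbox 0 (1 :: real^'n)" by simp
  from AE_division_indicator[OF this] show ?thesis
    by eventually_elim (simp add: sum.reindex inj_dyadic_cube)
qed

lemma dyadic_cube_in_BV_cube:
  assumes "j \<in> dyadic_index m"
  shows "indicat_real (dyadic_cube m j) \<in> BV_cube"
  unfolding dyadic_cube_box
  by (rule box_in_BV_cube; unfold dyadic_cube_box[symmetric])
     (use dyadic_cube_subset_unit[OF assms] interior_dyadic_cube_nonempty[of m j] in auto)

lemma card_dyadic_index: "card (dyadic_index m :: ('n::finite \<Rightarrow> nat) set) = 2 ^ (m * CARD('n))"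
proof -
  have "(dyadic_index m :: ('n \<Rightarrow> nat) set) = Pi\<^sub>E UNIV (\<lambda>_. {..<2 ^ m})"
    by (auto simp: dyadic_index_def PiE_def Pi_def)
  then show ?thesis by (simp add: card_PiE power_mult)
qed

text \<open>
  The variation is at most the sum of the perimeters: \<open>2\<^bsup>md\<^esup>\<close> cubes with \<open>2 d\<close> faces of area
  \<open>2\<^bsup>-m(d-1)\<^esup>\<close> each.
\<close>

lemma signed_dyadic_sum:
  fixes s :: "('n::finite \<Rightarrow> nat) \<Rightarrow> real" and m :: nat
  assumes s: "\<And>j. \<bar>s j\<bar> \<le> 1"
  defines "u \<equiv> \<lambda>x. \<Sum>j\<in>dyadic_index m. s j * indicat_real (dyadic_cube m j) x"
  shows "u \<in> BV_cube" and "AE x in lebesgue. \<bar>u x\<bar> \<le> indicat_real (cbox 0 1) x"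
    and "BV_norm u \<le> (1 + 2 * real CARD('n)) * 2 ^ m"
proof -
  let ?d = "CARD('n)"
  note cube = dyadic_cube_in_BV_cube[where m = m]
  show BV: "u \<in> BV_cube"
    unfolding u_def by (rule BV_cube_sum[OF finite_dyadic_index cube])
  show AE: "AE x in lebesgue. \<bar>u x\<bar> \<le> indicat_real (cbox 0 1) x"
    using AE_dyadic_cubes_partition[of m]
  proof eventually_elim
    fix x :: "real^'n"
    assume eq: "(\<Sum>j\<in>dyadic_index m. indicat_real (dyadic_cube m j) x) = indicat_real (cbox 0 1) x"
    show "\<bar>u x\<bar> \<le> indicat_real (cbox 0 1) x"
      unfolding eq[symmetric] u_def
      by (rule order_trans[OF sum_abs], rule sum_mono) (use s in \<open>auto simp: indicator_def\<close>)
  qed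
  have "(\<integral>x. \<bar>u x\<bar> \<partial>lebesgue) \<le> (\<integral>x. indicat_real (cbox 0 (1::real^'n)) x \<partial>lebesgue)"
    using BV_cubeD(1)[OF BV] AE by (intro integral_mono_AE integrable_indicator_box) auto
  also have "\<dots> = 1" by (subst integral_indicator_box) auto
  finally have L1: "(\<integral>x. \<bar>u x\<bar> \<partial>lebesgue) \<le> 1" .
  have "tvar (indicat_real (dyadic_cube m j)) \<le> 2 * real ?d * (1 / 2 ^ m) ^ (?d - 1)" for j :: "'n \<Rightarrow> nat"
  proof -
    have w: "real (Suc (j i)) / 2 ^ m - real (j i) / 2 ^ m = 1 / 2 ^ m" for i
      by (simp add: diff_divide_distrib[symmetric])
    have "total_gradient (indicat_real (dyadic_cube m j)) \<le> ennreal (\<Sum>i\<in>(UNIV::'n set). 2 * (\<Prod>k\<in>UNIV - {i}. 1 / 2 ^ m))"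
      unfolding dyadic_cube_box
      by (rule order_trans[OF total_gradient_box]) (simp_all add: divide_right_mono w del: of_nat_Suc)
    also have "(\<Sum>i\<in>(UNIV::'n set). 2 * (\<Prod>k\<in>UNIV - {i}. 1 / 2 ^ m)) = 2 * real ?d * (1 / 2 ^ m) ^ (?d - 1)"
      by (simp add: card_Diff_singleton)
    finally show ?thesis by (rule enn2real_leI[rotated]) simp
  qed
  then have "(\<Sum>j\<in>(dyadic_index m :: ('n \<Rightarrow> nat) set). tvar (indicat_real (dyadic_cube m j))) \<le>
      (\<Sum>j\<in>(dyadic_index m :: ('n \<Rightarrow> nat) set). 2 * real ?d * (1 / 2 ^ m) ^ (?d - 1))"
    by (intro sum_mono)
  also have "\<dots> = 2 * real ?d * (2 ^ (m * ?d) * (1 / 2 ^ m) ^ (?d - 1))"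
    by (simp add: card_dyadic_index)
  also have "2 ^ (m * ?d) * (1 / 2 ^ m) ^ (?d - 1) = (2 ^ m :: real)"
  proof -
    have "?d = Suc (?d - 1)" by simp
    then have "(2 ^ m) ^ ?d = (2 ^ m :: real) * (2 ^ m) ^ (?d - 1)" by (metis power_Suc)
    then show ?thesis by (simp add: power_mult power_one_over field_simps)
  qed
  finally have "(\<Sum>j\<in>(dyadic_index m :: ('n \<Rightarrow> nat) set). tvar (indicat_real (dyadic_cube m j))) \<le> 2 * real ?d * 2 ^ m" .
  moreover have "tvar u \<le> (\<Sum>j\<in>(dyadic_index m :: ('n \<Rightarrow> nat) set). tvar (indicat_real (dyadic_cube m j)))"
    unfolding u_def by (rule tvar_sum_le[OF finite_dyadic_index]) (rule cube, assumption, rule s)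
  moreover have "(1::real) \<le> 2 ^ m" by simp
  ultimately show "BV_norm u \<le> (1 + 2 * real ?d) * 2 ^ m"
    using L1 unfolding BV_norm_def distrib_right by linarith
qed

lemma Ld_cube_integrable:
  assumes "g \<in> Ld_cube"
  shows "integrable (lebesgue_on (cbox 0 (1::real^'n))) g"
proof -
  have m: "g \<in> borel_measurable (lebesgue_on (cbox 0 1))" and i: "integrable (lebesgue_on (cbox 0 1)) (\<lambda>x. \<bar>g x\<bar> ^ CARD('n))"
    using assms by (auto simp: Ld_cube_def)
  interpret finite_measure "lebesgue_on (cbox 0 (1::real^'n))"
    by (rule finite_measure_lebesgue_on) simp
  have "norm (g x) \<le> norm (1 + \<bar>g x\<bar> ^ CARD('n))" for x
  proof (cases "\<bar>g x\<bar> \<le> 1")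
    case False
    then have "\<bar>g x\<bar> ^ 1 \<le> \<bar>g x\<bar> ^ CARD('n)" by (intro power_increasing) (auto simp: Suc_le_eq)
    then show ?thesis by simp
  qed (simp add: add_increasing2)
  then show ?thesis
    by (intro Bochner_Integration.integrable_bound[OF Bochner_Integration.integrable_add[OF integrable_const[of 1] i] m] AE_I2)
qed

lemma abs_T_functional_le:
  fixes g u :: "real^'n \<Rightarrow> real"
  assumes g: "g \<in> Ld_cube" and u: "u \<in> BV_cube" and le: "AE x in lebesgue. \<bar>u x\<bar> \<le> indicat_real (cbox 0 1) x"
  shows "\<bar>T_functional g u\<bar> \<le> (\<integral>x. \<bar>g x\<bar> \<partial>lebesgue_on (cbox 0 1))"
proof -
  let ?M = "lebesgue_on (cbox 0 (1::real^'n))"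
  have gi: "integrable ?M g" by (rule Ld_cube_integrable[OF g])
  have "u \<in> borel_measurable lebesgue" using BV_cubeD(1)[OF u] by simp
  then have um: "u \<in> borel_measurable ?M" by (rule measurable_restrict_space1)
  have AE: "AE x in ?M. norm (g x * u x) \<le> norm (g x)"
  proof (subst AE_restrict_space_iff)
    show "AE x in lebesgue. x \<in> cbox 0 1 \<longrightarrow> norm (g x * u x) \<le> norm (g x)"
      using le
    proof eventually_elim
      fix x assume "\<bar>u x\<bar> \<le> indicat_real (cbox 0 1) x"
      then have "\<bar>u x\<bar> \<le> 1" by (cases "x \<in> cbox 0 1") simp_all
      then have "\<bar>g x\<bar> * \<bar>u x\<bar> \<le> \<bar>g x\<bar> * 1" by (intro mult_left_mono) auto
      then show "x \<in> cbox 0 1 \<longrightarrow> norm (g x * u x) \<le> norm (g x)" by (simp add: abs_mult)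
    qed
  qed simp
  have "integrable ?M (\<lambda>x. g x * u x)"
    by (rule Bochner_Integration.integrable_bound[OF gi borel_measurable_times[OF borel_measurable_integrable[OF gi] um] AE])
  then have "(\<integral>x. \<bar>g x * u x\<bar> \<partial>?M) \<le> (\<integral>x. \<bar>g x\<bar> \<partial>?M)"
    using gi AE by (intro integral_mono_AE) auto
  then show ?thesis
    unfolding T_functional_def by (rule order_trans[OF integral_abs_bound])
qed

text \<open>
  The sum is the charge of the step function with values \<open>s j\<close>. Its BV norm grows with \<open>m\<close> but is
  multiplied by \<open>e\<close>, whereas its pairing with \<open>g\<close> stays bounded.
\<close>

lemma signed_increment_sum_le:
  fixes f g :: "real^'n \<Rightarrow> real"
  assumes \<alpha>: "\<alpha> \<in> BV_dual" and val: "\<And>Q. Q \<in> dyadic_cubes m \<Longrightarrow> \<alpha> (indicat_real Q) = rect_increment f Q"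
    and g: "g \<in> Ld_cube" and e: "BV_dual_norm (\<lambda>u. \<alpha> u - T_functional g u) < ennreal e"
    and s: "\<And>j. \<bar>s j\<bar> \<le> 1"
  shows "\<bar>\<Sum>j\<in>dyadic_index m. s j * rect_increment f (dyadic_cube m j)\<bar> \<le>
     e * ((1 + 2 * real CARD('n)) * 2 ^ m) + (\<integral>x. \<bar>g x\<bar> \<partial>lebesgue_on (cbox 0 1))"
proof -
  let ?u = "\<lambda>x. \<Sum>j\<in>dyadic_index m. s j * indicat_real (dyadic_cube m j) x"
  note u = signed_dyadic_sum[of s m, OF s]
  note cube = dyadic_cube_in_BV_cube[where m = m]
  have "\<alpha> ?u = (\<Sum>j\<in>dyadic_index m. s j * \<alpha> (indicat_real (dyadic_cube m j)))"
    by (rule BV_dual_sum[OF \<alpha> finite_dyadic_index cube])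
  also have "\<dots> = (\<Sum>j\<in>dyadic_index m. s j * rect_increment f (dyadic_cube m j))"
    by (intro sum.cong refl) (simp add: val dyadic_cubes_eq)
  finally have "\<alpha> ?u = (\<Sum>j\<in>dyadic_index m. s j * rect_increment f (dyadic_cube m j))" .
  moreover have "\<bar>\<alpha> ?u - T_functional g ?u\<bar> \<le> e * ((1 + 2 * real CARD('n)) * 2 ^ m)"
    by (rule BV_dual_norm_less[OF \<alpha> e u(1) u(3)]) (simp add: add_pos_nonneg)
  moreover have "\<bar>T_functional g ?u\<bar> \<le> (\<integral>x. \<bar>g x\<bar> \<partial>lebesgue_on (cbox 0 1))"
    by (rule abs_T_functional_le[OF g u(1,2)])
  ultimately show ?thesis by linarith
qed

text \<open>
  Multiplying the \<open>r\<close>-th row of the Hadamard matrix by the sign of each coefficient turns the sum of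
  absolute values into one signed sum of increments.
\<close>

lemma sum_abs_haar_coeff_le:
  fixes K :: "nat \<Rightarrow> nat \<Rightarrow> (real^'n) set"
  assumes K: "dyadic_enumeration K"
    and B: "\<And>s. (\<And>j. \<bar>s j\<bar> \<le> 1) \<Longrightarrow> \<bar>\<Sum>j\<in>dyadic_index (Suc n). s j * rect_increment f (dyadic_cube (Suc n) j)\<bar> \<le> B"
  shows "(\<Sum>k<2 ^ (n * CARD('n)). \<bar>haar_coeff K f n k r\<bar>) \<le> 2 powr (real n * real CARD('n) / 2) * B"
proof -
  let ?d = "CARD('n)" and ?P = "2 powr (real n * real CARD('n) / 2)" and ?N = "2 ^ CARD('n) :: nat"
  let ?I = "{..<2 ^ (Suc n * ?d)} :: nat set"
  have bij: "bij_betw (K (Suc n)) ?I (dyadic_cubes (Suc n))"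
    using K unfolding dyadic_enumeration_def by blast
  define t where "t i = sgn (haar_coeff K f n (i div ?N) r) * hadamard ?d r (i mod ?N)" for i
  have t: "\<bar>t i\<bar> \<le> 1" for i by (simp add: t_def abs_mult abs_hadamard abs_sgn_eq)
  \<comment> \<open>The signs are given along the enumeration; \<open>s\<close> transports them to indices of cubes.\<close>
  define s where "s j = t (the_inv_into ?I (K (Suc n)) (dyadic_cube (Suc n) j))" for j
  have abs_haar: "\<bar>haar_coeff K f n k r\<bar> = ?P * (\<Sum>i=k * ?N..<k * ?N + ?N. t i * rect_increment f (K (Suc n) i))" for k
  proof -
    have "\<bar>haar_coeff K f n k r\<bar> = sgn (haar_coeff K f n k r) * haar_coeff K f n k r"
      by (simp add: abs_sgn mult.commute)
    also have "\<dots> = ?P * (\<Sum>l<?N. sgn (haar_coeff K f n k r) * hadamard ?d r l * rect_increment f (K (Suc n) (?N * k + l)))"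
      by (subst (2) haar_coeff_def) (simp add: sum_distrib_left mult_ac)
    also have "(\<Sum>l<?N. sgn (haar_coeff K f n k r) * hadamard ?d r l * rect_increment f (K (Suc n) (?N * k + l))) =
        (\<Sum>i=k * ?N..<k * ?N + ?N. t i * rect_increment f (K (Suc n) i))"
    proof (rule sum.reindex_bij_witness[where i = "\<lambda>i. i - k * ?N" and j = "\<lambda>l. k * ?N + l"])
      fix l assume "l \<in> {..<?N}"
      then have "(k * ?N + l) div ?N = k" "(k * ?N + l) mod ?N = l" by simp_all
      then show "t (k * ?N + l) * rect_increment f (K (Suc n) (k * ?N + l)) =
          sgn (haar_coeff K f n k r) * hadamard ?d r l * rect_increment f (K (Suc n) (?N * k + l))"
        by (simp add: t_def mult.commute[of k])
    qed auto
    finally show ?thesis .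
  qed
  have "(\<Sum>k<2 ^ (n * ?d). \<bar>haar_coeff K f n k r\<bar>) =
      ?P * (\<Sum>k<2 ^ (n * ?d). \<Sum>i=k * ?N..<k * ?N + ?N. t i * rect_increment f (K (Suc n) i))"
    by (simp only: abs_haar sum_distrib_left)
  also have "(\<Sum>k<2 ^ (n * ?d). \<Sum>i=k * ?N..<k * ?N + ?N. t i * rect_increment f (K (Suc n) i)) =
      (\<Sum>i<2 ^ (n * ?d) * ?N. t i * rect_increment f (K (Suc n) i))"
    by (rule sum.nat_group)
  also have "2 ^ (n * ?d) * ?N = 2 ^ (Suc n * ?d)" by (simp add: power_add)
  also have "(\<Sum>i\<in>?I. t i * rect_increment f (K (Suc n) i)) =
      (\<Sum>Q\<in>dyadic_cubes (Suc n). t (the_inv_into ?I (K (Suc n)) Q) * rect_increment f Q)"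
  proof (subst sum.reindex_bij_betw[OF bij, symmetric], rule sum.cong[OF refl])
    fix i assume "i \<in> ?I"
    then show "t i * rect_increment f (K (Suc n) i) =
        t (the_inv_into ?I (K (Suc n)) (K (Suc n) i)) * rect_increment f (K (Suc n) i)"
      by (simp only: the_inv_into_f_f[OF bij_betw_imp_inj_on[OF bij]])
  qed
  also have "\<dots> = (\<Sum>j\<in>dyadic_index (Suc n). s j * rect_increment f (dyadic_cube (Suc n) j))"
    unfolding dyadic_cubes_eq s_def by (subst sum.reindex[OF inj_dyadic_cube]) simp
  also have "?P * \<dots> \<le> ?P * B"
    using B[of s] t by (intro mult_left_mono) (auto simp: s_def)
  finally show ?thesis .
qed

lemma dyadic_cubes_rectangles: "dyadic_cubes n \<subseteq> rectangles"
proof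
  fix Q :: "(real^'a) set" assume "Q \<in> dyadic_cubes n"
  then obtain j where j: "Q = dyadic_cube n j" "j \<in> dyadic_index n" by (auto simp: dyadic_cubes_eq)
  have "real (j i) / 2 ^ n < real (Suc (j i)) / 2 ^ n" for i by (simp add: divide_strict_right_mono)
  moreover have "dyadic_cube n j \<subseteq> cbox 0 1" by (rule dyadic_cube_subset_unit[OF j(2)])
  ultimately show "Q \<in> rectangles"
    unfolding rectangles_def j(1) dyadic_cube_box
    by (intro CollectI exI[of _ "\<chi> i. real (j i) / 2 ^ n"] exI[of _ "\<chi> i. real (Suc (j i)) / 2 ^ n"]) simp
qed

lemma strongly_chargeable_limsup:
  fixes f :: "real^'n \<Rightarrow> real" and K :: "nat \<Rightarrow> nat \<Rightarrow> (real^'n) set"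
  assumes K: "dyadic_enumeration K" and f: "strongly_chargeable f"
  shows "limsup (\<lambda>n. ereal (1 / 2 powr (real n * (real CARD('n) / 2 + 1)) *
          Max ((\<lambda>r. \<Sum>k<2 ^ (n * CARD('n)). \<bar>haar_coeff K f n k r\<bar>) ` {1..2 ^ CARD('n) - 1}))) \<le> 0"
    (is "limsup (\<lambda>n. ereal (?x n)) \<le> 0")
proof (rule ccontr)
  let ?d = "CARD('n)"
  assume "\<not> limsup (\<lambda>n. ereal (?x n)) \<le> 0"
  then obtain \<epsilon> where \<epsilon>: "0 < ereal \<epsilon>" "ereal \<epsilon> < limsup (\<lambda>n. ereal (?x n))"
    using ereal_dense2[of 0 "limsup (\<lambda>n. ereal (?x n))"] by (auto simp: not_le)
  then have \<epsilon>0: "0 < \<epsilon>" by simp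
  obtain G \<mu> where G: "is_figure_increment f G" "strong_charge \<mu>" "\<And>F. F \<in> figures \<Longrightarrow> \<mu> F = G F"
    using f unfolding strongly_chargeable_def by blast
  obtain \<alpha> where \<alpha>: "\<alpha> \<in> SCH" "\<And>B. B \<in> BV_subsets \<Longrightarrow> \<mu> B = \<alpha> (indicat_real B)"
    using G(2) unfolding strong_charge_def by blast
  have \<alpha>_dual: "\<alpha> \<in> BV_dual" using \<alpha>(1) by (simp add: SCH_def)
  have val: "\<alpha> (indicat_real Q) = rect_increment f Q" if "Q \<in> dyadic_cubes m" for Q m
  proof -
    have R: "Q \<in> rectangles" using that dyadic_cubes_rectangles by blast
    then have fig: "Q \<in> figures" by (rule rectangle_figure)
    have "Q \<in> BV_subsets"
      using R BV_cubeD(2)[OF figure_in_BV_cube[OF fig]] by (auto simp: BV_subsets_def rectangles_def)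
    then have "\<alpha> (indicat_real Q) = G Q" using \<alpha>(2) G(3)[OF fig] by simp
    also have "\<dots> = rect_increment f Q" using G(1) R by (simp add: is_figure_increment_def)
    finally show ?thesis .
  qed
  define C where "C = 2 * (1 + 2 * real ?d)"
  have C: "0 < C" by (simp add: C_def add_pos_nonneg)
  \<comment> \<open>The BV norm of the test functions contributes \<open>e * C\<close> in the limit, which has to be below \<open>\<epsilon>\<close>.\<close>
  define e where "e = \<epsilon> / (2 * C)"
  have "0 < e" using \<epsilon>0 C by (simp add: e_def)
  then obtain g where g: "g \<in> Ld_cube" "BV_dual_norm (\<lambda>u. \<alpha> u - T_functional g u) < ennreal e"
    using \<alpha>(1) by (auto simp: SCH_def)
  define I where "I = (\<integral>x. \<bar>g x\<bar> \<partial>lebesgue_on (cbox 0 1))"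
  have x_le: "?x n \<le> e * C + I * (1/2) ^ n" for n
  proof -
    have "(\<Sum>k<2 ^ (n * ?d). \<bar>haar_coeff K f n k r\<bar>) \<le> 2 powr (real n * real ?d / 2) * (e * ((1 + 2 * real ?d) * 2 ^ Suc n) + I)" for r
      unfolding I_def
      by (rule sum_abs_haar_coeff_le[OF K signed_increment_sum_le[OF \<alpha>_dual val g]])
    moreover have "(1::nat) \<le> 2 ^ ?d - 1"
    proof -
      have "(2::nat) ^ 1 \<le> 2 ^ ?d" by (rule power_increasing) (simp_all add: Suc_le_eq)
      then show ?thesis by simp
    qed
    ultimately have "Max ((\<lambda>r. \<Sum>k<2 ^ (n * ?d). \<bar>haar_coeff K f n k r\<bar>) ` {1..2 ^ ?d - 1}) \<le>
        2 powr (real n * real ?d / 2) * (e * ((1 + 2 * real ?d) * 2 ^ Suc n) + I)"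
      by (intro Max.boundedI) auto
    then have "?x n \<le> 1 / 2 powr (real n * (real ?d / 2 + 1)) * (2 powr (real n * real ?d / 2) * (e * ((1 + 2 * real ?d) * 2 ^ Suc n) + I))"
      by (intro mult_left_mono) auto
    moreover have "2 powr (real n * (real ?d / 2 + 1)) = 2 powr (real n * real ?d / 2) * 2 ^ n"
      by (simp add: distrib_left powr_add powr_realpow)
    moreover have "1 / (2 powr (real n * real ?d / 2) * 2 ^ n) * (2 powr (real n * real ?d / 2) * (e * ((1 + 2 * real ?d) * 2 ^ Suc n) + I)) =
        e * C + I * (1/2) ^ n"
      by (simp add: C_def field_simps power_one_over)
    ultimately show ?thesis by (simp only:)
  qed
  have "(\<lambda>n. e * C + I * (1/2) ^ n) \<longlonglongrightarrow> e * C + I * 0"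
    by (intro tendsto_add tendsto_mult tendsto_const LIMSEQ_realpow_zero) auto
  moreover have "e * C + I * 0 < \<epsilon>" using \<epsilon>0 C by (simp add: e_def)
  ultimately have "\<forall>\<^sub>F n in sequentially. e * C + I * (1/2) ^ n < \<epsilon>" by (rule order_tendstoD(2))
  then have "\<forall>\<^sub>F n in sequentially. ereal (?x n) \<le> ereal \<epsilon>"
  proof eventually_elim
    case (elim n)
    with x_le[of n] show ?case by simp
  qed
  then have "limsup (\<lambda>n. ereal (?x n)) \<le> ereal \<epsilon>" by (rule Limsup_bounded)
  with \<epsilon>(2) show False by simp
qed

theorem corollary6p5:
  fixes f :: "real^'n \<Rightarrow> real" and K :: "nat \<Rightarrow> nat \<Rightarrow> (real^'n) set"
  assumes "f \<in> C0_cube" and "dyadic_enumeration K"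
  shows
    "(limsup (\<lambda>n. ereal (1 / 2 powr (real n * (real CARD('n) / 2 + 1)) *
          Max ((\<lambda>r. \<Sum>k<2 ^ (n * CARD('n)). \<bar>haar_coeff K f n k r\<bar>) ` {1..2 ^ CARD('n) - 1}))) > 0
        \<longrightarrow> \<not> strongly_chargeable f) \<and>
     (summable (\<lambda>n. 2 powr (real n * (real CARD('n) / 2 - 1)) *
          Max {\<bar>haar_coeff K f n k r\<bar> | k r.
                 k < 2 ^ (n * CARD('n)) \<and> r \<in> {1..2 ^ CARD('n) - 1}})
        \<longrightarrow> strongly_chargeable f)"
proof (intro conjI impI notI)
  assume "limsup (\<lambda>n. ereal (1 / 2 powr (real n * (real CARD('n) / 2 + 1)) *
          Max ((\<lambda>r. \<Sum>k<2 ^ (n * CARD('n)). \<bar>haar_coeff K f n k r\<bar>) ` {1..2 ^ CARD('n) - 1}))) > 0"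
    and "strongly_chargeable f"
  with strongly_chargeable_limsup[OF assms(2), of f] show False by (simp add: not_le)
next
  assume summable: "summable (\<lambda>n. 2 powr (real n * (real CARD('n) / 2 - 1)) *
          Max {\<bar>haar_coeff K f n k r\<bar> | k r.
                 k < 2 ^ (n * CARD('n)) \<and> r \<in> {1..2 ^ CARD('n) - 1}})"
  show "strongly_chargeable f"
  proof (rule strongly_chargeable_if_haar_summable[OF assms _ summable])
    fix n k r :: nat
    assume kr: "k < 2 ^ (n * CARD('n))" "r \<in> {1..2 ^ CARD('n) - 1}"
    let ?S = "{\<bar>haar_coeff K f n k r\<bar> | k r. k < 2 ^ (n * CARD('n)) \<and> r \<in> {1..2 ^ CARD('n) - 1}}"
    have "finite ?S" by (rule finite_image_set2) simp_all
    then show "\<bar>haar_coeff K f n k r\<bar> \<le> Max ?S"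
      using kr by (intro Max_ge) blast+
  qed
qed

end
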